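(* Let $G$ be a linear algebraic group over an algebraically closed field such that the abelianization $G/[G,G]$ is finite. Then $G$ is uniformly bounded.
   Context: Linear algebraic groups over the algebraically closed field $K$ are identified with their (abstract) groups of $K$-points. A subset $S$ of a group $G$ normally generates $G$ if the normal subgroup of $G$ generated by $S$ is $G$; $G$ is finitely normally generated if some finite $S$ normally generates it. For such $S$, $\|g\|_S$ is the least $n\ge 0$ such that $g$ is a product of $n$ conjugates in $G$ of elements of $S$ and their inverses, and $\|G\|_S=\sup_{g\in G}\|g\|_S$. $\Delta(G)=\sup\{\|G\|_S : S \text{ finite, normally generates } G\}$. $G$ is uniformly bounded if it is finitely normally generated and $\Delta(G)<\infty$. *)

theory Defs
  imports
    "HOL-Algebra.Generated_Groups"
    "HOL-Library.Extended_Nat"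
    "Jordan_Normal_Form.Determinant"
begin

definition normal_closure :: "('g, 'b) monoid_scheme \<Rightarrow> 'g set \<Rightarrow> 'g set" where
  "normal_closure G S = \<Inter>{N. N \<lhd> G \<and> S \<subseteq> N}"

definition normally_generates :: "('g, 'b) monoid_scheme \<Rightarrow> 'g set \<Rightarrow> bool" where
  "normally_generates G S \<longleftrightarrow> S \<subseteq> carrier G \<and> normal_closure G S = carrier G"

definition finitely_normally_generated :: "('g, 'b) monoid_scheme \<Rightarrow> bool" where
  "finitely_normally_generated G \<longleftrightarrow> (\<exists>S. finite S \<and> normally_generates G S)"

definition sym_conjugates :: "('g, 'b) monoid_scheme \<Rightarrow> 'g set \<Rightarrow> 'g set" where
  "sym_conjugates G S =
     {x \<otimes>\<^bsub>G\<^esub> t \<otimes>\<^bsub>G\<^esub> inv\<^bsub>G\<^esub> x | x t. x \<in> carrier G \<and> t \<in> S \<union> m_inv G ` S}"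

definition is_product_of_conjugates ::
    "('g, 'b) monoid_scheme \<Rightarrow> 'g set \<Rightarrow> nat \<Rightarrow> 'g \<Rightarrow> bool" where
  "is_product_of_conjugates G S n g \<longleftrightarrow>
     (\<exists>xs. length xs = n \<and> set xs \<subseteq> sym_conjugates G S \<and> g = foldr (\<otimes>\<^bsub>G\<^esub>) xs \<one>\<^bsub>G\<^esub>)"

text \<open>The infimum in \<^typ>\<open>enat\<close> is the least such number when one exists, and is
  \<open>\<infinity>\<close> otherwise; the latter does not occur if \<open>S\<close> normally generates \<open>G\<close> and
  \<open>g \<in> carrier G\<close>.\<close>

definition conj_norm :: "('g, 'b) monoid_scheme \<Rightarrow> 'g set \<Rightarrow> 'g \<Rightarrow> enat" where
  "conj_norm G S g = (INF n \<in> {n. is_product_of_conjugates G S n g}. enat n)"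

definition conj_diameter :: "('g, 'b) monoid_scheme \<Rightarrow> 'g set \<Rightarrow> enat" where
  "conj_diameter G S = (SUP g \<in> carrier G. conj_norm G S g)"

definition Delta :: "('g, 'b) monoid_scheme \<Rightarrow> enat" where
  "Delta G = (SUP S \<in> {S. finite S \<and> normally_generates G S}. conj_diameter G S)"

definition uniformly_bounded :: "('g, 'b) monoid_scheme \<Rightarrow> bool" where
  "uniformly_bounded G \<longleftrightarrow> finitely_normally_generated G \<and> Delta G < \<infinity>"

definition abelianization :: "('g, 'b) monoid_scheme \<Rightarrow> 'g set monoid" where
  "abelianization G = G Mod derived G (carrier G)"

definition GL :: "nat \<Rightarrow> 'a::field mat monoid" where
  "GL n = units_of (ring_mat TYPE('a) n ())"

lemma group_GL: "group (GL n)"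
proof -
  interpret ring "ring_mat TYPE('a) n ()" by (rule ring_mat)
  show "group (GL n :: 'a mat monoid)" unfolding GL_def by (rule units_group)
qed

lemma carrier_GL: "carrier (GL n) = {A \<in> carrier_mat n n. det A \<noteq> 0}"
proof (intro Set.set_eqI iffI)
  fix A :: "'a mat"
  assume "A \<in> carrier (GL n)"
  then have A: "A \<in> Units (ring_mat TYPE('a) n ())"
    by (simp add: GL_def units_of_def)
  then have "A \<in> carrier_mat n n" by (simp add: Units_def ring_mat_simps)
  with unit_imp_det_non_zero[OF A] show "A \<in> {A \<in> carrier_mat n n. det A \<noteq> 0}" by simp
next
  fix A :: "'a mat"
  assume "A \<in> {A \<in> carrier_mat n n. det A \<noteq> 0}"
  then show "A \<in> carrier (GL n)"
    using det_non_zero_imp_unit[of A n "()"] by (simp add: GL_def units_of_def)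
qed

text \<open>The functions on \<open>n \<times> n\<close> matrices given by polynomials in the \<open>n\<^sup>2\<close> entries, with
  coefficients in the field \<open>'a\<close>. Allowing the inverse of the determinant as a further
  generator would give the same closed subsets of \<open>GL n\<close>.\<close>

inductive matrix_polynomial :: "nat \<Rightarrow> ('a::field mat \<Rightarrow> 'a) \<Rightarrow> bool" for n where
  const: "matrix_polynomial n (\<lambda>A. c)"
| entry: "i < n \<Longrightarrow> j < n \<Longrightarrow> matrix_polynomial n (\<lambda>A. A $$ (i, j))"
| add: "matrix_polynomial n p \<Longrightarrow> matrix_polynomial n q \<Longrightarrow> matrix_polynomial n (\<lambda>A. p A + q A)"
| mult: "matrix_polynomial n p \<Longrightarrow> matrix_polynomial n q \<Longrightarrow> matrix_polynomial n (\<lambda>A. p A * q A)"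

definition zariski_closed_in_GL :: "nat \<Rightarrow> 'a::field mat set \<Rightarrow> bool" where
  "zariski_closed_in_GL n H \<longleftrightarrow>
     (\<exists>P. (\<forall>p\<in>P. matrix_polynomial n p) \<and> H = {A \<in> carrier (GL n). \<forall>p\<in>P. p A = 0})"

text \<open>Over an algebraically closed field, the groups of points of linear algebraic groups are
  the Zariski closed subgroups of the general linear groups.\<close>

definition linear_algebraic_group :: "'a::field mat monoid \<Rightarrow> bool" where
  "linear_algebraic_group G \<longleftrightarrow>
     (\<exists>n H. subgroup H (GL n) \<and> zariski_closed_in_GL n H \<and> G = (GL n)\<lparr>carrier := H\<rparr>)"

end

theory Submission
  imports "HOL-Algebra.Multiplicative_Group" "HOL-Library.Function_Algebras" Defs
begin

text \<open>Let \<open>G0\<close> be the identity component, a closed irreducible normal subgroup of finite index. For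
  a subset \<open>C\<close> that is closed under inverses and conjugation and generates \<open>G\<close>, each set
  \<open>{[t, x] | x \<in> G0}\<close> with \<open>t \<in> C\<close> is the image of an irreducible set and consists of products of
  two elements of \<open>C\<close>. Closures of products of such sets form chains of irreducible closed sets, whose
  lengths are bounded in terms of \<open>G\<close> alone. If \<open>Z\<close> is a product with maximal closure, then the
  normal subgroup \<open>N\<close> generated by all these sets is dense in the closure of \<open>Z\<close>. As the image of a
  morphism, \<open>Z\<close> contains a nonempty open subset of its closure, whence \<open>N = Z Z\<^bsup>-1\<^esup>\<close>. The elements of
  \<open>C\<close> commute with \<open>G0\<close> modulo \<open>N\<close>, so \<open>G0 / N\<close> is central of finite index in \<open>G / N\<close>; by Schur's
  theorem and the finiteness of the abelianization \<open>G / N\<close> is finite, and irreducibility gives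
  \<open>N = G0\<close>. Hence \<open>G0\<close> is covered by words in \<open>C\<close> of bounded length, and so is the finite
  quotient \<open>G / G0\<close>.\<close>

section \<open>Polynomials over a subring\<close>

text \<open>The obstacle is uniformity: the bound must not depend on the generating set. Single
  letters are isolated points, so words in them have no dimension to grow. Commuting a letter with a
  connected group spreads it into an irreducible family through the identity at the fixed price of
  two letters, and growth of such families is limited by an invariant of \<open>G\<close>. Closures
  cannot be avoided, because it is not known beforehand that the subgroup generated by the families
  is closed. Maximality therefore gives only density, and a Chevalley-type statement turns density
  back into equality at the cost of a factor two. A torus shows where the abelianization enters: all
  its commutator families are trivial, so nothing is covered. Finite index of the generated subgroup
  has to come from group theory, not from geometry. The geometry uses only points and functions.
  Algebras are subrings of functions on a type, domains are handled by congruences modulo a prime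
  ideal, and points are recovered from characters. Since any finite bound suffices, an exponential
  estimate can stand in for dimension.\<close>

definition unital_subring :: "'r::comm_ring_1 set \<Rightarrow> bool" where
  "unital_subring A \<longleftrightarrow> 1 \<in> A \<and> (\<forall>a\<in>A. \<forall>b\<in>A. a - b \<in> A \<and> a * b \<in> A)"

definition poly_over :: "'r::comm_ring_1 set \<Rightarrow> 'r poly set" where
  "poly_over A = {p. \<forall>i. coeff p i \<in> A}"

definition adjoin :: "'r::comm_ring_1 set \<Rightarrow> 'r \<Rightarrow> 'r set" where
  "adjoin A b = (\<lambda>p. poly p b) ` poly_over A"

lemma
  assumes "unital_subring A"
  shows subring_one: "1 \<in> A" and subring_zero: "0 \<in> A"
    and subring_diff: "a \<in> A \<Longrightarrow> b \<in> A \<Longrightarrow> a - b \<in> A"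
    and subring_mult: "a \<in> A \<Longrightarrow> b \<in> A \<Longrightarrow> a * b \<in> A"
    and subring_uminus: "a \<in> A \<Longrightarrow> - a \<in> A"
    and subring_add: "a \<in> A \<Longrightarrow> b \<in> A \<Longrightarrow> a + b \<in> A"
    and subring_power: "a \<in> A \<Longrightarrow> a ^ n \<in> A"
proof -
  show 1: "1 \<in> A" and d: "\<And>a b. a \<in> A \<Longrightarrow> b \<in> A \<Longrightarrow> a - b \<in> A"
    and m: "\<And>a b. a \<in> A \<Longrightarrow> b \<in> A \<Longrightarrow> a * b \<in> A"
    using assms by (auto simp: unital_subring_def)
  show 0: "0 \<in> A" using d[OF 1 1] by simp
  show u: "\<And>a. a \<in> A \<Longrightarrow> - a \<in> A" using d[OF 0] by simp
  show "\<And>a b. a \<in> A \<Longrightarrow> b \<in> A \<Longrightarrow> a + b \<in> A" using d u by (metis diff_minus_eq_add)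
  show "a \<in> A \<Longrightarrow> a ^ n \<in> A" by (induction n) (auto intro: 1 m)
qed

lemmas subring_intros = subring_one subring_zero subring_diff subring_mult subring_uminus
  subring_add subring_power

lemma subring_sum:
  "unital_subring A \<Longrightarrow> (\<And>i. i \<in> S \<Longrightarrow> f i \<in> A) \<Longrightarrow> sum f S \<in> A"
  by (induction S rule: infinite_finite_induct) (auto intro: subring_intros)

lemma poly_over_coeff: "p \<in> poly_over A \<Longrightarrow> coeff p i \<in> A"
  by (simp add: poly_over_def)

lemma poly_over_subring:
  assumes "unital_subring A"
  shows "unital_subring (poly_over A)"
  using assms by (auto simp: unital_subring_def poly_over_def coeff_mult
      intro!: subring_sum[OF assms] subring_intros[OF assms])

lemma poly_over_pCons: "a \<in> A \<Longrightarrow> p \<in> poly_over A \<Longrightarrow> pCons a p \<in> poly_over A"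
  unfolding poly_over_def mem_Collect_eq by (metis coeff_pCons_0 coeff_pCons_Suc not0_implies_Suc)

lemma poly_over_const: "unital_subring A \<Longrightarrow> a \<in> A \<Longrightarrow> [:a:] \<in> poly_over A"
  by (intro poly_over_pCons) (auto simp: poly_over_def intro: subring_zero)

lemma poly_over_monom: "unital_subring A \<Longrightarrow> a \<in> A \<Longrightarrow> monom a n \<in> poly_over A"
  by (simp add: poly_over_def subring_zero)

lemma poly_over_smult:
  "unital_subring A \<Longrightarrow> a \<in> A \<Longrightarrow> p \<in> poly_over A \<Longrightarrow> smult a p \<in> poly_over A"
  by (simp only: poly_over_def coeff_smult mem_Collect_eq subring_mult simp_thms)

lemma adjoin_subring:
  assumes "unital_subring A"
  shows "unital_subring (adjoin A b)"
proof -
  note P = poly_over_subring[OF assms]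
  have "1 \<in> adjoin A b" unfolding adjoin_def
    by (rule image_eqI[of _ _ 1]) (auto intro: subring_one[OF P])
  moreover have "x - y \<in> adjoin A b \<and> x * y \<in> adjoin A b" if "x \<in> adjoin A b" "y \<in> adjoin A b" for x y
  proof -
    obtain p q where *: "p \<in> poly_over A" "q \<in> poly_over A" "x = poly p b" "y = poly q b"
      using \<open>x \<in> adjoin A b\<close> \<open>y \<in> adjoin A b\<close> by (auto simp: adjoin_def)
    show ?thesis unfolding adjoin_def *(3,4) poly_diff[symmetric] poly_mult[symmetric]
      using subring_diff[OF P *(1,2)] subring_mult[OF P *(1,2)] by blast
  qed
  ultimately show ?thesis by (simp add: unital_subring_def)
qed

lemma adjoin_base: "unital_subring A \<Longrightarrow> a \<in> A \<Longrightarrow> a \<in> adjoin A b"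
  unfolding adjoin_def by (rule image_eqI[of _ _ "[:a:]"]) (auto intro: poly_over_const)

lemma adjoin_gen: "unital_subring A \<Longrightarrow> b \<in> adjoin A b"
  unfolding adjoin_def
  by (rule image_eqI[of _ _ "[:0, 1:]"]) (simp_all add: poly_over_pCons poly_over_const subring_zero subring_one)

lemma adjoin_subset:
  assumes "unital_subring B" and "A \<subseteq> B" and "b \<in> B"
  shows "adjoin A b \<subseteq> B"
  using assms unfolding adjoin_def
  by (auto simp: poly_altdef poly_over_def intro!: subring_sum subring_mult subring_power)

text \<open>Long division without inverting the leading coefficient of the divisor: each step
  multiplies by that coefficient once more. The degree bound on the quotient \<open>s\<close> is
  kept because minimality arguments are later applied to the quotient as well as to the
  remainder.\<close>

lemma pseudo_division:
  fixes p w :: "'r::comm_ring_1 poly"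
  assumes A: "unital_subring A" and w: "w \<in> poly_over A" and p: "p \<in> poly_over A"
  shows "\<exists>k s r. s \<in> poly_over A \<and> r \<in> poly_over A \<and>
    smult (lead_coeff w ^ k) p = s * w + r \<and> degree s \<le> degree p - degree w \<and>
    (r = 0 \<or> degree r < degree w)"
  using p
proof (induction "degree p" arbitrary: p rule: less_induct)
  case less
  note P = poly_over_subring[OF A]
  let ?d = "degree p" and ?e = "degree w"
  show ?case
  proof (cases "?d < ?e \<or> p = 0")
    case True
    then show ?thesis
      using less.prems subring_zero[OF P]
      by (intro exI[of _ 0] exI[of _ 0] exI[of _ p]) auto
  next
    case False
    then have de: "?e \<le> ?d" by simp
    define m where "m = monom (lead_coeff p) (?d - ?e)"
    define p' where "p' = smult (lead_coeff w) p - m * w"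
    have mA: "m \<in> poly_over A" 
      unfolding m_def by (intro poly_over_monom[OF A] poly_over_coeff less.prems)
    have p'A: "p' \<in> poly_over A"
      unfolding p'_def using less.prems w mA
      by (intro subring_diff[OF P] subring_mult[OF P] poly_over_smult[OF A] poly_over_coeff)
    have dm: "degree m \<le> ?d - ?e" unfolding m_def by (rule degree_monom_le)
    have le: "degree p' \<le> ?d"
      unfolding p'_def
      using dm de degree_mult_le[of m w]
      by (intro degree_diff_le) (auto intro: order.trans[OF degree_smult_le])
    have top: "coeff p' ?d = 0"
      unfolding p'_def m_def using de by (simp add: coeff_monom_mult mult.commute[of "lead_coeff p"])
    show ?thesis
    proof (cases "degree p' < ?d")
      case True
      obtain k s r where IH: "s \<in> poly_over A" "r \<in> poly_over A"
        "smult (lead_coeff w ^ k) p' = s * w + r" "degree s \<le> degree p' - ?e"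
        "r = 0 \<or> degree r < ?e"
        using less.hyps[OF True p'A] by blast
      let ?s = "s + smult (lead_coeff w ^ k) m"
      have "smult (lead_coeff w ^ Suc k) p = smult (lead_coeff w ^ k) (p' + m * w)"
        by (simp add: p'_def mult.commute)
      also have "\<dots> = ?s * w + r"
        by (simp only: smult_add_right IH(3)) (simp add: algebra_simps)
      finally have "smult (lead_coeff w ^ Suc k) p = ?s * w + r" .
      moreover have "?s \<in> poly_over A"
        using IH(1) mA w
        by (intro subring_add[OF P] poly_over_smult[OF A] subring_power[OF A] poly_over_coeff)
      moreover have "degree ?s \<le> ?d - ?e"
        using IH(4) le dm
        by (intro degree_add_le) (auto intro: order.trans[OF degree_smult_le])
      ultimately show ?thesis using IH(2,5) by blast
    next
      \<comment> \<open>The top coefficient cancels, so an unchanged degree forces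
        \<open>p' = 0\<close>; this occurs only for constant \<open>p\<close>, as the zero
        polynomial has degree 0.\<close>
      case False
      with le have "degree p' = ?d" by simp
      with top have "p' = 0" by (metis leading_coeff_0_iff)
      then have "smult (lead_coeff w ^ 1) p = m * w + 0" by (simp add: p'_def)
      with mA dm subring_zero[OF P] show ?thesis by blast
    qed
  qed
qed

section \<open>Extension of characters\<close>

text \<open>\<open>I\<close> is an ideal of the whole ambient ring, but primality is tested only on
  \<open>B\<close>. This fits functions vanishing on a set of points: they absorb arbitrary
  functions, while primality can be expected only among the regular ones.\<close>

definition prime_on :: "'r::comm_ring_1 set \<Rightarrow> 'r set \<Rightarrow> bool" where
  "prime_on B I \<longleftrightarrow> (\<forall>f\<in>I. \<forall>g\<in>I. f + g \<in> I) \<and> (\<forall>f\<in>I. \<forall>r. r * f \<in> I) \<and> 0 \<in> I \<and> 1 \<notin> I \<and>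
    (\<forall>f\<in>B. \<forall>g\<in>B. f * g \<in> I \<longrightarrow> f \<in> I \<or> g \<in> I)"

lemma
  assumes "prime_on B I"
  shows prime_on_add: "f \<in> I \<Longrightarrow> g \<in> I \<Longrightarrow> f + g \<in> I"
    and prime_on_mult: "f \<in> I \<Longrightarrow> r * f \<in> I"
    and prime_on_mult2: "f \<in> I \<Longrightarrow> f * r \<in> I"
    and prime_on_diff: "f \<in> I \<Longrightarrow> g \<in> I \<Longrightarrow> f - g \<in> I"
    and prime_on_zero: "0 \<in> I" and prime_on_one: "1 \<notin> I"
    and prime_on_prime: "f \<in> B \<Longrightarrow> g \<in> B \<Longrightarrow> f * g \<in> I \<Longrightarrow> f \<in> I \<or> g \<in> I"
proof -
  show a: "f \<in> I \<Longrightarrow> g \<in> I \<Longrightarrow> f + g \<in> I" and m: "f \<in> I \<Longrightarrow> r * f \<in> I"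
    and "0 \<in> I" and "1 \<notin> I" and "f \<in> B \<Longrightarrow> g \<in> B \<Longrightarrow> f * g \<in> I \<Longrightarrow> f \<in> I \<or> g \<in> I" for f g r
    using assms by (auto simp: prime_on_def)
  then show "f \<in> I \<Longrightarrow> f * r \<in> I" by (simp add: mult.commute)
  show "f \<in> I \<Longrightarrow> g \<in> I \<Longrightarrow> f - g \<in> I" using a[of f "- 1 * g"] m[of g "- 1"] by simp
qed

lemma prime_on_power:
  assumes "prime_on B I" "unital_subring B" "a \<in> B" "a \<notin> I"
  shows "a ^ k \<notin> I"
proof (induction k)
  case 0
  show ?case using prime_on_one[OF assms(1)] by simp
next
  case (Suc k)
  then show ?case
    using prime_on_prime[OF assms(1), of a "a ^ k"] subring_power[OF assms(2,3)] assms(3,4) by auto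
qed

lemma prime_on_subset: "prime_on B I \<Longrightarrow> B' \<subseteq> B \<Longrightarrow> prime_on B' I"
  unfolding prime_on_def by blast

section \<open>Algebraic elements modulo a prime ideal\<close>

locale prime_adjoin =
  fixes A I :: "'r::comm_ring_1 set" and b :: 'r
  assumes A: "unital_subring A" and prime: "prime_on (adjoin A b) I"
begin

abbreviation "vanishing p \<equiv> p \<in> poly_over I"

lemmas I_intros = prime_on_add[OF prime] prime_on_mult[OF prime] prime_on_mult2[OF prime]
  prime_on_diff[OF prime] prime_on_zero[OF prime]

lemma I_cong: "x - y \<in> I \<Longrightarrow> x \<in> I \<longleftrightarrow> y \<in> I"
  using I_intros(1)[of "x - y" y] I_intros(4)[of x "x - y"] by auto

lemma sum_I: "(\<And>i. i \<in> S \<Longrightarrow> f i \<in> I) \<Longrightarrow> sum f S \<in> I"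
  by (induction S rule: infinite_finite_induct) (auto intro: I_intros)

lemma vanishing_poly: "vanishing p \<Longrightarrow> poly p x \<in> I"
  by (auto simp: poly_altdef poly_over_def intro!: sum_I I_intros)

lemma vanishing_mult: "vanishing p \<Longrightarrow> vanishing (p * q)"
  by (auto simp: poly_over_def coeff_mult intro!: sum_I I_intros)

lemma poly_in_adjoin: "p \<in> poly_over A \<Longrightarrow> poly p b \<in> adjoin A b"
  by (simp add: adjoin_def)

text \<open>An algebraic equation for \<open>b\<close> in the domain \<open>A[b]\<close> modulo
  \<open>I\<close>, without forming the quotient: zero becomes membership in \<open>I\<close>, and a
  nonzero polynomial is one with some coefficient outside \<open>I\<close>.\<close>

definition relation :: "'r poly \<Rightarrow> bool" where
  "relation p \<longleftrightarrow> p \<in> poly_over A \<and> \<not> vanishing p \<and> poly p b \<in> I"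

definition minimal_relation :: "'r poly \<Rightarrow> bool" where
  "minimal_relation p \<longleftrightarrow> relation p \<and> (\<forall>q. relation q \<longrightarrow> degree p \<le> degree q)"

lemma minimal_relation_exists: "relation p \<Longrightarrow> \<exists>p. minimal_relation p"
  unfolding minimal_relation_def by (rule ex_has_least_nat)

text \<open>A leading coefficient in \<open>I\<close> is zero in the quotient domain, yet
  \<open>degree\<close> still counts it. Removing that term changes nothing modulo \<open>I\<close>
  and lowers the degree, which is what arguments by least degree need.\<close>

lemma drop_lead:
  assumes "p \<in> poly_over A" "lead_coeff p \<in> I"
  defines "q \<equiv> p - monom (lead_coeff p) (degree p)"
  shows "q \<in> poly_over A" "poly p b - poly q b \<in> I" "vanishing q \<Longrightarrow> vanishing p"
    "degree p > 0 \<Longrightarrow> degree q < degree p"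
proof -
  let ?m = "monom (lead_coeff p) (degree p)"
  have "vanishing ?m" using assms(2) I_intros(5) by (auto simp: poly_over_def)
  then show "poly p b - poly q b \<in> I" using vanishing_poly[of ?m b] by (simp add: q_def)
  show "q \<in> poly_over A"
    unfolding q_def
    by (intro subring_diff[OF poly_over_subring[OF A]] poly_over_monom[OF A] poly_over_coeff assms(1))
  show "vanishing p" if "vanishing q"
    using \<open>vanishing ?m\<close> that I_intros(1)
    by (auto simp: poly_over_def q_def) (metis diff_add_cancel I_cong assms(2) diff_zero)
  show "degree q < degree p" if "degree p > 0"
  proof -
    have "degree q \<le> degree p" unfolding q_def by (intro degree_diff_le) (auto intro: degree_monom_le)
    moreover have "coeff q (degree p) = 0" by (simp add: q_def)
    ultimately show ?thesis using that
      by (metis degree_0 leading_coeff_0_iff nat_less_le)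
  qed
qed

text \<open>Otherwise dropping the leading term would give a shorter relation. A constant relation
  is excluded because its only coefficient would equal its value at \<open>b\<close>, hence lie in
  \<open>I\<close>.\<close>

lemma minimal_relation_lead:
  assumes "minimal_relation p"
  shows "lead_coeff p \<notin> I" and "degree p > 0"
proof -
  have r: "relation p" and min: "\<And>q. relation q \<Longrightarrow> degree p \<le> degree q"
    using assms by (auto simp: minimal_relation_def)
  then have p: "p \<in> poly_over A" "\<not> vanishing p" "poly p b \<in> I" by (auto simp: relation_def)
  have const: "lead_coeff p \<notin> I" if "degree p = 0"
    using p(2) that I_intros(5) by (auto simp: poly_over_def) (metis coeff_eq_0 gr0I)
  show lead: "lead_coeff p \<notin> I"
  proof
    assume l: "lead_coeff p \<in> I"
    with const have d: "degree p > 0" by blast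
    define q where "q = p - monom (lead_coeff p) (degree p)"
    note q = drop_lead[OF p(1) l, folded q_def]
    have "relation q" unfolding relation_def using q p I_cong by blast
    with min q(4)[OF d] show False by fastforce
  qed
  show "degree p > 0"
  proof (rule ccontr)
    assume "\<not> degree p > 0"
    then have "degree p = 0" by simp
    then have "poly p b = lead_coeff p" by (metis degree_0_id poly_pCons mult_zero_right poly_0 add.right_neutral)
    with p(3) lead show False by simp
  qed
qed

text \<open>The pseudo-remainder of \<open>q\<close> takes a value in \<open>I\<close> at
  \<open>b\<close> and is shorter than \<open>p\<close>, so minimality makes all its coefficients
  zero modulo \<open>I\<close>. Thus \<open>p\<close> acts as a minimal polynomial up to powers of
  its leading coefficient.\<close>

lemma minimal_relation_divides:
  assumes min: "minimal_relation p" and q: "q \<in> poly_over A" "poly q b \<in> I"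
  shows "\<exists>k s r. s \<in> poly_over A \<and> vanishing r \<and> r \<in> poly_over A
     \<and> smult (lead_coeff p ^ k) q = s * p + r"
proof -
  have p: "p \<in> poly_over A" "poly p b \<in> I" using min by (auto simp: minimal_relation_def relation_def)
  obtain k s r where *: "s \<in> poly_over A" "r \<in> poly_over A"
    "smult (lead_coeff p ^ k) q = s * p + r" "r = 0 \<or> degree r < degree p"
    using pseudo_division[OF A p(1) q(1)] by blast
  have "poly r b = lead_coeff p ^ k * poly q b - poly s b * poly p b"
    using arg_cong[OF *(3), of "\<lambda>f. poly f b"] by simp
  then have "poly r b \<in> I" using p(2) q(2) by (auto intro: I_intros)
  then have "vanishing r"
    using *(2,4) min I_intros(5) by (fastforce simp: minimal_relation_def relation_def poly_over_def)
  with * show ?thesis by blast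
qed

text \<open>In a domain algebraic over \<open>A\<close>, every nonzero element divides a nonzero
  element of \<open>A\<close>. Among the polynomials whose values at \<open>b\<close> are nonzero
  multiples of \<open>g\<close> modulo \<open>I\<close>, one of least degree turns out to be
  constant.\<close>

lemma algebraic_divides_base:
  assumes "relation p0" and g: "g \<in> adjoin A b" "g \<notin> I"
  shows "\<exists>v\<in>adjoin A b. \<exists>c\<in>A. c \<notin> I \<and> v * g - c \<in> I"
proof -
  note B = adjoin_subring[OF A, of b]
  obtain p where min: "minimal_relation p" using minimal_relation_exists assms(1) by blast
  note lead_p = minimal_relation_lead[OF min]
  have p: "p \<in> poly_over A" "poly p b \<in> I" using min by (auto simp: minimal_relation_def relation_def)
  define W where "W w \<longleftrightarrow> w \<in> poly_over A \<and> poly w b \<notin> I \<and>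
    (\<exists>v\<in>adjoin A b. v * g - poly w b \<in> I)" for w
  obtain w0 where "w0 \<in> poly_over A" "g = poly w0 b" using g(1) by (auto simp: adjoin_def)
  then have "W w0" unfolding W_def using g(2) I_intros(5) subring_one[OF B] by (auto intro!: bexI[of _ 1])
  then obtain w where w: "W w" and wmin: "\<And>w'. W w' \<Longrightarrow> degree w \<le> degree w'"
    using ex_has_least_nat[of W w0 degree] by blast
  from w obtain v where wv: "w \<in> poly_over A" "poly w b \<notin> I" "v \<in> adjoin A b" "v * g - poly w b \<in> I"
    unfolding W_def by blast
  have "degree w = 0"
  proof (rule ccontr)
    assume "degree w \<noteq> 0"
    then have e: "degree w > 0" by simp
    have lead_w: "lead_coeff w \<notin> I"
    proof
      assume l: "lead_coeff w \<in> I"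
      define q where "q = w - monom (lead_coeff w) (degree w)"
      note q = drop_lead[OF wv(1) l, folded q_def]
      have "v * g - poly q b = (v * g - poly w b) + (poly w b - poly q b)" by simp
      then have "v * g - poly q b \<in> I" using I_intros(1)[OF wv(4) q(2)] by simp
      then have "W q" unfolding W_def using q wv I_cong by blast
      with wmin q(4)[OF e] show False by fastforce
    qed
    \<comment> \<open>A longer \<open>w\<close> could be replaced by its pseudo-remainder modulo
      \<open>p\<close>: since \<open>p\<close> is zero at \<open>b\<close>, that remainder is again
      a nonzero multiple of \<open>g\<close>.\<close>
    have deg: "degree w < degree p"
    proof (rule ccontr)
      assume "\<not> degree w < degree p"
      obtain k s r where *: "s \<in> poly_over A" "r \<in> poly_over A"
        "smult (lead_coeff p ^ k) w = s * p + r" "r = 0 \<or> degree r < degree p"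
        using pseudo_division[OF A p(1) wv(1)] by blast
      let ?a = "lead_coeff p ^ k"
      have a: "?a \<in> A" using p(1) by (intro subring_power[OF A] poly_over_coeff)
      have aI: "?a \<notin> I"
        using lead_p(1) p(1) by (intro prime_on_power[OF prime B] adjoin_base[OF A] poly_over_coeff)
      have r: "?a * poly w b - poly r b \<in> I"
        using arg_cong[OF *(3), of "\<lambda>f. poly f b"] p(2) by (simp add: I_intros)
      moreover have "?a * poly w b \<notin> I"
        using prime_on_prime[OF prime adjoin_base[OF A a] poly_in_adjoin[OF wv(1)]] aI wv(2) by blast
      ultimately have nI: "poly r b \<notin> I" using I_cong by blast
      have "(?a * v) * g - poly r b = ?a * (v * g - poly w b) + (?a * poly w b - poly r b)"
        by (simp add: algebra_simps)
      then have "(?a * v) * g - poly r b \<in> I"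
        by (simp only:) (rule I_intros(1)[OF I_intros(2)[OF wv(4)] r])
      moreover have "?a * v \<in> adjoin A b" by (rule subring_mult[OF B adjoin_base[OF A a] wv(3)])
      ultimately have "W r" unfolding W_def using *(2) nI by blast
      moreover have "r \<noteq> 0" using nI I_intros(5) by auto
      ultimately show False using wmin[of r] *(4) \<open>\<not> degree w < degree p\<close> by auto
    qed
    \<comment> \<open>Now the minimal relation is divided by \<open>w\<close>. The remainder is, up
      to \<open>I\<close>, again a multiple of \<open>g\<close>, so minimality of \<open>w\<close>
      forces its value into \<open>I\<close>.\<close>
    obtain k s r where *: "s \<in> poly_over A" "r \<in> poly_over A"
      "smult (lead_coeff w ^ k) p = s * w + r" "degree s \<le> degree p - degree w"
      "r = 0 \<or> degree r < degree w"
      using pseudo_division[OF A wv(1) p(1)] by blast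
    let ?c = "lead_coeff w ^ k"
    have ev: "?c * poly p b = poly s b * poly w b + poly r b"
      using arg_cong[OF *(3), of "\<lambda>f. poly f b"] by simp
    have "(- poly s b * v) * g - poly r b = - poly s b * (v * g - poly w b) - ?c * poly p b"
      unfolding ev by (simp add: algebra_simps)
    also have "\<dots> \<in> I" by (rule I_intros(4)[OF I_intros(2)[OF wv(4)] I_intros(2)[OF p(2)]])
    finally have "(- poly s b * v) * g - poly r b \<in> I" .
    moreover have "- poly s b * v \<in> adjoin A b"
      by (intro subring_mult[OF B] subring_uminus[OF B] poly_in_adjoin * wv)
    ultimately have "poly r b \<notin> I \<Longrightarrow> W r" unfolding W_def using *(2) by blast
    then have rI: "poly r b \<in> I" using wmin[of r] *(5) e I_intros(5) by fastforce
    have "poly s b * poly w b = ?c * poly p b - poly r b" using ev by simp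
    then have "poly s b * poly w b \<in> I" using rI p(2) by (auto intro: I_intros)
    then have sI: "poly s b \<in> I" using prime_on_prime[OF prime] poly_in_adjoin *(1) wv(1,2) by blast
    \<comment> \<open>Positive degree of \<open>w\<close> makes the quotient shorter than
      \<open>p\<close>, so minimality of \<open>p\<close> kills \<open>s\<close> modulo
      \<open>I\<close>. Then the top coefficient of \<open>?c\<close> times \<open>p\<close> would
      be in \<open>I\<close>.\<close>
    have "degree s < degree p" using *(4) e deg by linarith
    then have "vanishing s" using min sI *(1) by (fastforce simp: minimal_relation_def relation_def)
    then have "vanishing (s * w)" by (rule vanishing_mult)
    moreover have "coeff r (degree p) = 0" using *(5) deg by (auto intro: coeff_eq_0)
    ultimately have "coeff (smult ?c p) (degree p) \<in> I" unfolding *(3) by (simp add: poly_over_def)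
    then have "?c * lead_coeff p \<in> I" by simp
    moreover have "?c \<notin> I"
      using lead_w wv(1) by (intro prime_on_power[OF prime B] adjoin_base[OF A] poly_over_coeff)
    ultimately show False
      using prime_on_prime[OF prime, of ?c "lead_coeff p"] lead_p(1) p(1) wv(1)
      by (meson A adjoin_base poly_over_coeff subring_power)
  qed
  then have "poly w b = lead_coeff w" 
    by (metis degree_0_id poly_pCons mult_zero_right poly_0 add.right_neutral)
  then show ?thesis using wv poly_over_coeff by metis
qed

end

text \<open>A ring homomorphism from \<open>A\<close> modulo \<open>A \<inter> I\<close> to the
  field, with arbitrary values outside \<open>A\<close>. Being the identity on constants makes no
  sense for an abstract ring and is required separately where \<open>A\<close> consists of
  functions.\<close>

definition character :: "'r::comm_ring_1 set \<Rightarrow> 'r set \<Rightarrow> ('r \<Rightarrow> 'k::field) \<Rightarrow> bool" where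
  "character A I \<chi> \<longleftrightarrow> \<chi> 1 = 1 \<and> (\<forall>f\<in>A. \<forall>g\<in>A. \<chi> (f + g) = \<chi> f + \<chi> g \<and> \<chi> (f * g) = \<chi> f * \<chi> g) \<and>
    (\<forall>f\<in>A \<inter> I. \<chi> f = 0)"

lemma
  assumes "character A I \<chi>"
  shows character_one: "\<chi> 1 = 1"
    and character_add: "f \<in> A \<Longrightarrow> g \<in> A \<Longrightarrow> \<chi> (f + g) = \<chi> f + \<chi> g"
    and character_mult: "f \<in> A \<Longrightarrow> g \<in> A \<Longrightarrow> \<chi> (f * g) = \<chi> f * \<chi> g"
    and character_vanish: "f \<in> A \<Longrightarrow> f \<in> I \<Longrightarrow> \<chi> f = 0"
  using assms by (auto simp: character_def)

lemma character_zero: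
  assumes "character A I \<chi>" "unital_subring A"
  shows "\<chi> 0 = 0"
  using character_add[OF assms(1), of 0 0] subring_zero[OF assms(2)] by (metis add.right_neutral add_cancel_right_right)

lemma character_power:
  assumes "character A I \<chi>" "unital_subring A" "f \<in> A"
  shows "\<chi> (f ^ n) = \<chi> f ^ n"
  by (induction n)
    (simp_all add: character_one[OF assms(1)] character_mult[OF assms(1)] subring_power[OF assms(2)] assms(3))

lemma character_sum:
  assumes "character A I \<chi>" "unital_subring A" "\<And>i. i \<in> S \<Longrightarrow> f i \<in> A"
  shows "\<chi> (sum f S) = (\<Sum>i\<in>S. \<chi> (f i))"
  using assms(3)
  by (induction S rule: infinite_finite_induct)
    (simp_all add: character_zero[OF assms(1,2)] character_add[OF assms(1)] subring_sum[OF assms(2)])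

lemma character_diff:
  assumes "character A I \<chi>" "unital_subring A" "f \<in> A" "g \<in> A"
  shows "\<chi> (f - g) = \<chi> f - \<chi> g"
  using character_add[OF assms(1), of "f - g" g] subring_diff[OF assms(2)] assms(3,4) by simp

lemma
  assumes \<chi>: "character A I \<chi>" and A: "unital_subring A" and pq: "p \<in> poly_over A" "q \<in> poly_over A"
  shows map_poly_character_add: "map_poly \<chi> (p + q) = map_poly \<chi> p + map_poly \<chi> q"
    and map_poly_character_diff: "map_poly \<chi> (p - q) = map_poly \<chi> p - map_poly \<chi> q"
    and map_poly_character_mult: "map_poly \<chi> (p * q) = map_poly \<chi> p * map_poly \<chi> q"
  using pq character_zero[OF \<chi> A]
  by (auto simp: poly_eq_iff coeff_map_poly coeff_mult poly_over_def character_add[OF \<chi>]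
      character_diff[OF \<chi> A] character_mult[OF \<chi>] character_sum[OF \<chi> A] subring_mult[OF A])

lemma infinite_UNIV_alg_closed: "infinite (UNIV :: 'k::alg_closed_field set)"
proof
  assume fin: "finite (UNIV :: 'k set)"
  define p where "p = (\<Prod>a::'k\<in>UNIV. [:- a, 1:])"
  have "degree p = card (UNIV :: 'k set)"
    unfolding p_def by (subst degree_prod_eq_sum_degree) auto
  then have "degree (p + 1) > 0"
    using fin by (simp add: degree_add_eq_left card_gt_0_iff)
  then obtain x where "poly (p + 1) x = 0" using alg_closed_imp_poly_has_root by blast
  moreover have "poly p x = 0" using fin by (auto simp: p_def poly_prod)
  ultimately show False by simp
qed

context prime_adjoin
begin

text \<open>The universal property of adjoining \<open>b\<close>: sending \<open>b\<close> to
  \<open>\<beta>\<close> is well defined as soon as every equation satisfied by \<open>b\<close>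
  modulo \<open>I\<close> is satisfied by \<open>\<beta>\<close> after applying
  \<open>\<chi>\<close>.\<close>

lemma character_extend_value:
  fixes \<chi> :: "'r \<Rightarrow> 'k::field"
  assumes \<chi>: "character A I \<chi>"
    and compat: "\<And>q. q \<in> poly_over A \<Longrightarrow> poly q b \<in> I \<Longrightarrow> poly (map_poly \<chi> q) \<beta> = 0"
  shows "\<exists>\<chi>'. character (adjoin A b) I \<chi>' \<and> (\<forall>f\<in>A. \<chi>' f = \<chi> f) \<and>
    (\<forall>q\<in>poly_over A. \<chi>' (poly q b) = poly (map_poly \<chi> q) \<beta>)"
proof -
  note P = poly_over_subring[OF A]
  \<comment> \<open>The polynomial representing an element of \<open>A[b]\<close> is not unique;
    \<open>compat\<close>, applied to the difference of two representatives, makes the choice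
    harmless.\<close>
  define \<chi>' where "\<chi>' f = (let q = SOME q. q \<in> poly_over A \<and> f = poly q b in poly (map_poly \<chi> q) \<beta>)" for f
  have val: "\<chi>' (poly q b) = poly (map_poly \<chi> q) \<beta>" if q: "q \<in> poly_over A" for q
  proof -
    define q' where "q' = (SOME q'. q' \<in> poly_over A \<and> poly q b = poly q' b)"
    have q': "q' \<in> poly_over A" "poly q b = poly q' b"
      unfolding atomize_conj q'_def by (rule someI[of _ q]) (simp add: q)
    have "poly (map_poly \<chi> (q' - q)) \<beta> = 0"
      using q'(2) I_intros(5) by (intro compat subring_diff[OF P] q'(1) q) simp
    then have "poly (map_poly \<chi> q') \<beta> = poly (map_poly \<chi> q) \<beta>"
      by (simp add: map_poly_character_diff[OF \<chi> A q'(1) q])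
    then show ?thesis by (simp add: \<chi>'_def q'_def Let_def)
  qed
  have base: "\<chi>' f = \<chi> f" if "f \<in> A" for f
    using val[OF poly_over_const[OF A that]] character_zero[OF \<chi> A] by (simp add: map_poly_pCons)
  have "character (adjoin A b) I \<chi>'"
    unfolding character_def
  proof (intro conjI ballI)
    show "\<chi>' 1 = 1" using base subring_one[OF A] character_one[OF \<chi>] by simp
    fix f g assume "f \<in> adjoin A b" "g \<in> adjoin A b"
    then obtain p q where pq: "p \<in> poly_over A" "q \<in> poly_over A" "f = poly p b" "g = poly q b"
      by (auto simp: adjoin_def)
    show "\<chi>' (f + g) = \<chi>' f + \<chi>' g"
      using val[OF subring_add[OF P pq(1,2)]] val[OF pq(1)] val[OF pq(2)]
      by (simp add: pq map_poly_character_add[OF \<chi> A pq(1,2)])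
    show "\<chi>' (f * g) = \<chi>' f * \<chi>' g"
      using val[OF subring_mult[OF P pq(1,2)]] val[OF pq(1)] val[OF pq(2)]
      by (simp add: pq map_poly_character_mult[OF \<chi> A pq(1,2)])
  next
    fix f assume "f \<in> adjoin A b \<inter> I"
    then show "\<chi>' f = 0" using val compat by (auto simp: adjoin_def)
  qed
  with base val show ?thesis by blast
qed

text \<open>Without relations every \<open>\<beta>\<close> is an admissible value for
  \<open>b\<close>. Keeping one coefficient of \<open>g\<close> nonzero leaves a nonzero polynomial
  with finitely many roots, and the infinite field offers a value avoiding them.\<close>

lemma character_extend_transcendental:
  assumes "\<nexists>p. relation p" and g: "g \<in> adjoin A b" "g \<notin> I"
  shows "\<exists>a\<in>A. a \<notin> I \<and> (\<forall>\<chi> :: 'r \<Rightarrow> 'k::alg_closed_field. character A I \<chi> \<longrightarrow> \<chi> a \<noteq> 0 \<longrightarrow>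
    (\<exists>\<chi>'. character (adjoin A b) I \<chi>' \<and> (\<forall>f\<in>A. \<chi>' f = \<chi> f) \<and> \<chi>' g \<noteq> 0))"
proof -
  obtain q where q: "q \<in> poly_over A" "g = poly q b" using g(1) by (auto simp: adjoin_def)
  obtain i where i: "coeff q i \<notin> I" using vanishing_poly[of q b] q(2) g(2) by (auto simp: poly_over_def)
  show ?thesis
  proof (intro bexI[of _ "coeff q i"] conjI allI impI i)
    show "coeff q i \<in> A" by (rule poly_over_coeff[OF q(1)])
    fix \<chi> :: "'r \<Rightarrow> 'k" assume \<chi>: "character A I \<chi>" "\<chi> (coeff q i) \<noteq> 0"
    have "map_poly \<chi> q \<noteq> 0" using \<chi>(2) character_zero[OF \<chi>(1) A]
      by (auto simp: poly_eq_iff coeff_map_poly)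
    then have "finite {\<beta>. poly (map_poly \<chi> q) \<beta> = 0}" by (rule poly_roots_finite)
    then obtain \<beta> where \<beta>: "poly (map_poly \<chi> q) \<beta> \<noteq> 0"
      using ex_new_if_finite[OF infinite_UNIV_alg_closed] by blast
    have "poly (map_poly \<chi> p) \<beta> = 0" if "p \<in> poly_over A" "poly p b \<in> I" for p
    proof -
      have "vanishing p" using that assms(1) by (auto simp: relation_def)
      then have "map_poly \<chi> p = 0"
        using character_vanish[OF \<chi>(1)] that(1) character_zero[OF \<chi>(1) A]
        by (auto simp: poly_eq_iff coeff_map_poly poly_over_def)
      then show ?thesis by simp
    qed
    from character_extend_value[OF \<chi>(1) this] q \<beta>
    show "\<exists>\<chi>'. character (adjoin A b) I \<chi>' \<and> (\<forall>f\<in>A. \<chi>' f = \<chi> f) \<and> \<chi>' g \<noteq> 0" by metis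
  qed
qed

text \<open>The witness is a product of two obstructions. The leading coefficient of a minimal
  relation must survive so that the specialised relation still has a root \<open>\<beta>\<close>; a
  multiple \<open>c\<close> of \<open>g\<close> in \<open>A\<close> must survive so that
  \<open>g\<close> is not sent to zero.\<close>

lemma character_extend_algebraic:
  assumes "relation p0" and g: "g \<in> adjoin A b" "g \<notin> I"
  shows "\<exists>a\<in>A. a \<notin> I \<and> (\<forall>\<chi> :: 'r \<Rightarrow> 'k::alg_closed_field. character A I \<chi> \<longrightarrow> \<chi> a \<noteq> 0 \<longrightarrow>
    (\<exists>\<chi>'. character (adjoin A b) I \<chi>' \<and> (\<forall>f\<in>A. \<chi>' f = \<chi> f) \<and> \<chi>' g \<noteq> 0))"
proof -
  note B = adjoin_subring[OF A, of b]
  obtain p where min: "minimal_relation p" using minimal_relation_exists assms(1) by blast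
  note lead = minimal_relation_lead[OF min]
  have p: "p \<in> poly_over A" using min by (auto simp: minimal_relation_def relation_def)
  obtain v c where v: "v \<in> adjoin A b" and c: "c \<in> A" "c \<notin> I" "v * g - c \<in> I"
    using algebraic_divides_base[OF assms] by blast
  let ?a = "lead_coeff p"
  have a: "?a \<in> A" by (rule poly_over_coeff[OF p])
  show ?thesis
  proof (intro bexI[of _ "?a * c"] conjI allI impI)
    show "?a * c \<in> A" by (rule subring_mult[OF A a c(1)])
    show "?a * c \<notin> I"
      using prime_on_prime[OF prime adjoin_base[OF A a] adjoin_base[OF A c(1)]] lead(1) c(2) by blast
    fix \<chi> :: "'r \<Rightarrow> 'k" assume \<chi>: "character A I \<chi>" "\<chi> (?a * c) \<noteq> 0"
    then have nz: "\<chi> ?a \<noteq> 0" "\<chi> c \<noteq> 0" by (auto simp: character_mult[OF \<chi>(1) a c(1)])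
    note z = character_zero[OF \<chi>(1) A]
    have "degree (map_poly \<chi> p) > 0"
      using le_degree[of "map_poly \<chi> p" "degree p"] lead(2) nz(1) z by (simp add: coeff_map_poly)
    then obtain \<beta> where \<beta>: "poly (map_poly \<chi> p) \<beta> = 0"
      using alg_closed_imp_poly_has_root by blast
    \<comment> \<open>Up to a power of the leading coefficient, which \<open>\<chi>\<close> does not
      kill, \<open>q\<close> is a multiple of \<open>p\<close> modulo \<open>I\<close>, and
      \<open>p\<close> specialises to zero at \<open>\<beta>\<close>.\<close>
    have "poly (map_poly \<chi> q) \<beta> = 0" if q: "q \<in> poly_over A" "poly q b \<in> I" for q
    proof -
      obtain k s r where *: "s \<in> poly_over A" "vanishing r" "r \<in> poly_over A"
        "smult (?a ^ k) q = s * p + r"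
        using minimal_relation_divides[OF min q] by blast
      have "map_poly \<chi> r = 0"
        using character_vanish[OF \<chi>(1)] *(2,3) z by (auto simp: poly_eq_iff coeff_map_poly poly_over_def)
      moreover have "map_poly \<chi> (smult (?a ^ k) q) = smult (\<chi> ?a ^ k) (map_poly \<chi> q)"
        using z q(1) a
        by (simp add: poly_eq_iff coeff_map_poly poly_over_def character_mult[OF \<chi>(1)]
            subring_power[OF A] character_power[OF \<chi>(1) A])
      moreover have "map_poly \<chi> (s * p + r) = map_poly \<chi> s * map_poly \<chi> p + map_poly \<chi> r"
        by (simp add: map_poly_character_add[OF \<chi>(1) A] map_poly_character_mult[OF \<chi>(1) A]
            subring_mult[OF poly_over_subring[OF A]] * p)
      ultimately have "smult (\<chi> ?a ^ k) (map_poly \<chi> q) = map_poly \<chi> s * map_poly \<chi> p"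
        using *(4) by simp
      then have "\<chi> ?a ^ k * poly (map_poly \<chi> q) \<beta> = 0"
        using \<beta> by (metis mult_zero_right poly_mult poly_smult)
      then show ?thesis using nz(1) by simp
    qed
    from character_extend_value[OF \<chi>(1) this] obtain \<chi>'
      where \<chi>': "character (adjoin A b) I \<chi>'" "\<forall>f\<in>A. \<chi>' f = \<chi> f" by metis
    have "\<chi>' (v * g - c) = 0"
      using c(3) by (intro character_vanish[OF \<chi>'(1)] subring_diff[OF B] subring_mult[OF B] v g(1) adjoin_base[OF A c(1)])
    then have "\<chi>' v * \<chi>' g = \<chi> c"
      using \<chi>'(2) c v g(1)
      by (simp add: character_diff[OF \<chi>'(1) B] character_mult[OF \<chi>'(1)] subring_mult[OF B] adjoin_base[OF A])
    with nz(2) \<chi>' show "\<exists>\<chi>'. character (adjoin A b) I \<chi>' \<and> (\<forall>f\<in>A. \<chi>' f = \<chi> f) \<and> \<chi>' g \<noteq> 0" by auto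
  qed
qed

end

lemma character_extend_adjoin:
  assumes "unital_subring A" "prime_on (adjoin A b) I" "g \<in> adjoin A b" "g \<notin> I"
  shows "\<exists>a\<in>A. a \<notin> I \<and> (\<forall>\<chi> :: 'r::comm_ring_1 \<Rightarrow> 'k::alg_closed_field. character A I \<chi> \<longrightarrow> \<chi> a \<noteq> 0 \<longrightarrow>
    (\<exists>\<chi>'. character (adjoin A b) I \<chi>' \<and> (\<forall>f\<in>A. \<chi>' f = \<chi> f) \<and> \<chi>' g \<noteq> 0))"
proof -
  interpret prime_adjoin A I b by unfold_locales (use assms in auto)
  show ?thesis
    using character_extend_transcendental[OF _ assms(3,4)] character_extend_algebraic[OF _ assms(3,4)]
    by (cases "\<exists>p. relation p") blast+
qed

text \<open>Generators are adjoined one at a time, and the condition that \<open>g\<close> survives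
  is passed down through the tower to a single element of \<open>A\<close>. The ambient
  \<open>C\<close> guarantees that \<open>I\<close> stays prime on every intermediate ring.\<close>

lemma character_extend:
  assumes "finite F" and A: "unital_subring A" and C: "unital_subring C" "A \<subseteq> C" "F \<subseteq> C" "prime_on C I"
  shows "\<exists>B. unital_subring B \<and> A \<subseteq> B \<and> F \<subseteq> B \<and> B \<subseteq> C \<and> (\<forall>g\<in>B. g \<notin> I \<longrightarrow>
    (\<exists>a\<in>A. a \<notin> I \<and> (\<forall>\<chi> :: 'r::comm_ring_1 \<Rightarrow> 'k::alg_closed_field. character A I \<chi> \<longrightarrow> \<chi> a \<noteq> 0 \<longrightarrow>
      (\<exists>\<chi>'. character B I \<chi>' \<and> (\<forall>f\<in>A. \<chi>' f = \<chi> f) \<and> \<chi>' g \<noteq> 0))))"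
  using assms(1,5)
proof (induction F)
  case empty
  show ?case using A C by (intro exI[of _ A]) auto
next
  case (insert b F)
  then obtain B where B: "unital_subring B" "A \<subseteq> B" "F \<subseteq> B" "B \<subseteq> C"
    and ext: "\<And>g. g \<in> B \<Longrightarrow> g \<notin> I \<Longrightarrow>
    (\<exists>a\<in>A. a \<notin> I \<and> (\<forall>\<chi> :: 'r \<Rightarrow> 'k. character A I \<chi> \<longrightarrow> \<chi> a \<noteq> 0 \<longrightarrow>
      (\<exists>\<chi>'. character B I \<chi>' \<and> (\<forall>f\<in>A. \<chi>' f = \<chi> f) \<and> \<chi>' g \<noteq> 0)))" by auto
  let ?B = "adjoin B b"
  have BC: "?B \<subseteq> C" using adjoin_subset[OF C(1) B(4)] insert.prems by auto
  show ?case
  proof (intro exI[of _ ?B] conjI ballI impI)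
    show "unital_subring ?B" by (rule adjoin_subring[OF B(1)])
    show "A \<subseteq> ?B" "insert b F \<subseteq> ?B" using adjoin_base[OF B(1)] adjoin_gen[OF B(1)] B(2,3) by auto
    show "?B \<subseteq> C" by (rule BC)
    fix g assume g: "g \<in> ?B" "g \<notin> I"
    obtain g' where g': "g' \<in> B" "g' \<notin> I" and 1: "\<And>\<chi> :: 'r \<Rightarrow> 'k. character B I \<chi> \<Longrightarrow> \<chi> g' \<noteq> 0 \<Longrightarrow>
        (\<exists>\<chi>'. character ?B I \<chi>' \<and> (\<forall>f\<in>B. \<chi>' f = \<chi> f) \<and> \<chi>' g \<noteq> 0)"
      using character_extend_adjoin[OF B(1) prime_on_subset[OF C(4) BC] g, where 'k = 'k] by blast
    obtain a where a: "a \<in> A" "a \<notin> I" and 2: "\<And>\<chi> :: 'r \<Rightarrow> 'k. character A I \<chi> \<Longrightarrow> \<chi> a \<noteq> 0 \<Longrightarrow>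
        (\<exists>\<chi>'. character B I \<chi>' \<and> (\<forall>f\<in>A. \<chi>' f = \<chi> f) \<and> \<chi>' g' \<noteq> 0)"
      using ext[OF g'] by blast
    show "\<exists>a\<in>A. a \<notin> I \<and> (\<forall>\<chi> :: 'r \<Rightarrow> 'k. character A I \<chi> \<longrightarrow> \<chi> a \<noteq> 0 \<longrightarrow>
      (\<exists>\<chi>'. character ?B I \<chi>' \<and> (\<forall>f\<in>A. \<chi>' f = \<chi> f) \<and> \<chi>' g \<noteq> 0))"
    proof (intro bexI[of _ a] conjI allI impI a)
      fix \<chi> :: "'r \<Rightarrow> 'k" assume "character A I \<chi>" "\<chi> a \<noteq> 0"
      then obtain \<chi>1 where \<chi>1: "character B I \<chi>1" "\<forall>f\<in>A. \<chi>1 f = \<chi> f" "\<chi>1 g' \<noteq> 0" using 2 by blast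
      then obtain \<chi>2 where \<chi>2: "character ?B I \<chi>2" "\<forall>f\<in>B. \<chi>2 f = \<chi>1 f" "\<chi>2 g \<noteq> 0" using 1 by blast
      show "\<exists>\<chi>'. character ?B I \<chi>' \<and> (\<forall>f\<in>A. \<chi>' f = \<chi> f) \<and> \<chi>' g \<noteq> 0"
        using \<chi>1(2) \<chi>2 B(2) by (intro exI[of _ \<chi>2]) (auto simp: subset_iff)
    qed
  qed
qed

section \<open>The Hilbert basis theorem\<close>

inductive_set ideal_span :: "'r::comm_ring_1 set \<Rightarrow> 'r set \<Rightarrow> 'r set" for A E where
  span_zero: "0 \<in> ideal_span A E"
| span_step: "e \<in> E \<Longrightarrow> c \<in> A \<Longrightarrow> y \<in> ideal_span A E \<Longrightarrow> c * e + y \<in> ideal_span A E"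

text \<open>Stated for arbitrary subsets instead of ideals, so that the finitely many generators can
  be selected from \<open>J\<close> itself; for the range of a sequence this singles out finitely
  many indices.\<close>

definition noetherian :: "'r::comm_ring_1 set \<Rightarrow> bool" where
  "noetherian A \<longleftrightarrow> (\<forall>J\<subseteq>A. \<exists>E\<subseteq>J. finite E \<and> J \<subseteq> ideal_span A E)"

lemma ideal_span_add: "x \<in> ideal_span A E \<Longrightarrow> y \<in> ideal_span A E \<Longrightarrow> x + y \<in> ideal_span A E"
  by (induction rule: ideal_span.induct) (auto simp: add.assoc intro: ideal_span.intros)

lemma ideal_span_mult:
  assumes "unital_subring A" "a \<in> A" "x \<in> ideal_span A E"
  shows "a * x \<in> ideal_span A E"
  using assms(3)
proof (induction rule: ideal_span.induct)
  case span_zero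
  show ?case by (simp add: ideal_span.span_zero)
next
  case (span_step e c y)
  have "a * (c * e + y) = (a * c) * e + a * y" by (simp add: algebra_simps)
  also have "\<dots> \<in> ideal_span A E"
    using span_step assms(1,2) by (auto intro: ideal_span.span_step subring_mult)
  finally show ?case .
qed

lemma ideal_span_gen: "unital_subring A \<Longrightarrow> x \<in> E \<Longrightarrow> x \<in> ideal_span A E"
  using span_step[of x E 1 A 0] span_zero subring_one by auto

lemma ideal_span_diff:
  assumes "unital_subring A" "x \<in> ideal_span A E" "y \<in> ideal_span A E"
  shows "x - y \<in> ideal_span A E"
  using ideal_span_add[OF assms(2) ideal_span_mult[OF assms(1) subring_uminus[OF assms(1) subring_one] assms(3)]]
    assms(1) by simp

lemma ideal_span_trans:
  assumes "unital_subring A" "E \<subseteq> ideal_span A E'" "x \<in> ideal_span A E"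
  shows "x \<in> ideal_span A E'"
  using assms(3)
  by (induction rule: ideal_span.induct)
    (use assms(1,2) in \<open>auto intro: span_zero ideal_span_add ideal_span_mult\<close>)

lemma ideal_span_mono: "E \<subseteq> E' \<Longrightarrow> x \<in> ideal_span A E \<Longrightarrow> x \<in> ideal_span A E'"
  by (rotate_tac, induction rule: ideal_span.induct) (auto intro: ideal_span.intros)

lemma ideal_span_finite_witness:
  "x \<in> ideal_span A J \<Longrightarrow> \<exists>E\<subseteq>J. finite E \<and> x \<in> ideal_span A E"
proof (induction rule: ideal_span.induct)
  case span_zero
  show ?case by (intro exI[of _ "{}"]) (auto intro: ideal_span.span_zero)
next
  case (span_step e c y)
  then obtain E where E: "E \<subseteq> J" "finite E" "y \<in> ideal_span A E" by blast
  then have "c * e + y \<in> ideal_span A (insert e E)"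
    using span_step.hyps(2) ideal_span_mono[of E "insert e E"] by (auto intro: ideal_span.span_step)
  then show ?case using E span_step.hyps(1) by (intro exI[of _ "insert e E"]) auto
qed

lemma ideal_span_finite_subset:
  assumes "finite X" "X \<subseteq> ideal_span A J"
  shows "\<exists>E\<subseteq>J. finite E \<and> X \<subseteq> ideal_span A E"
  using assms
proof (induction X)
  case empty
  show ?case by (intro exI[of _ "{}"]) simp
next
  case (insert x X)
  then obtain E where E: "E \<subseteq> J" "finite E" "X \<subseteq> ideal_span A E" by auto
  from insert.prems obtain E' where E': "E' \<subseteq> J" "finite E'" "x \<in> ideal_span A E'"
    using ideal_span_finite_witness[of x A J] by auto
  show ?case
    using E E' ideal_span_mono[of E "E \<union> E'"] ideal_span_mono[of E' "E \<union> E'"]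
    by (intro exI[of _ "E \<union> E'"]) auto
qed

text \<open>Hilbert's argument: choose successively a polynomial of least degree whose value is not
  yet generated. The leading coefficients are finitely generated over \<open>A\<close>, so
  eventually a leading term can be cancelled by earlier choices, contradicting least degree.\<close>

lemma hilbert_basis:
  assumes A: "unital_subring A" and noeth: "noetherian A"
  shows "noetherian (adjoin A b)"
  unfolding noetherian_def
proof (intro allI impI, rule ccontr)
  note B = adjoin_subring[OF A, of b]
  note P = poly_over_subring[OF A]
  let ?B = "adjoin A b" and ?ev = "\<lambda>q. poly q b"
  fix J assume J: "J \<subseteq> ?B" and bad: "\<not> (\<exists>E\<subseteq>J. finite E \<and> J \<subseteq> ideal_span ?B E)"
  let ?J = "ideal_span ?B J"
  \<comment> \<open>Degrees belong to representing polynomials, since \<open>b\<close> may satisfy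
    equations over \<open>A\<close> and an element of \<open>A[b]\<close> has no degree of its
    own.\<close>
  define cand where "cand Q q \<longleftrightarrow> q \<in> poly_over A \<and> ?ev q \<in> ?J \<and> ?ev q \<notin> ideal_span ?B (?ev ` Q)" for Q q
  have cand_ex: "\<exists>q. cand Q q" if Q: "finite Q" "?ev ` Q \<subseteq> ?J" for Q
  proof -
    obtain E where E: "E \<subseteq> J" "finite E" "?ev ` Q \<subseteq> ideal_span ?B E"
      using ideal_span_finite_subset[of "?ev ` Q" ?B J] Q by auto
    with bad obtain j where j: "j \<in> J" "j \<notin> ideal_span ?B E" by blast
    from j(1) J obtain q where q: "q \<in> poly_over A" "j = ?ev q" by (auto simp: adjoin_def)
    have "cand Q q" unfolding cand_def
      using q j ideal_span_gen[OF B j(1)] ideal_span_trans[OF B E(3)] by auto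
    then show ?thesis ..
  qed
  define pick where "pick Q = (ARG_MIN degree q. cand Q q)" for Q
  define Ps where "Ps = rec_nat {} (\<lambda>_ Q. insert (pick Q) Q)"
  define p where "p n = pick (Ps n)" for n
  have Ps: "Ps 0 = {}" "Ps (Suc n) = insert (p n) (Ps n)" for n by (simp_all add: Ps_def p_def)
  have Ps_image: "Ps n = p ` {..<n}" for n by (induction n) (simp_all add: Ps lessThan_Suc)
  have inv: "finite (Ps n) \<and> ?ev ` Ps n \<subseteq> ?J" for n
  proof (induction n)
    case (Suc n)
    then have "cand (Ps n) (p n)"
      unfolding p_def pick_def using cand_ex by (metis arg_min_natI)
    then show ?case using Suc by (simp add: Ps cand_def)
  qed (simp add: Ps)
  have p: "cand (Ps n) (p n)" and pmin: "cand (Ps n) q \<Longrightarrow> degree (p n) \<le> degree q" for n q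
    using inv[of n] cand_ex unfolding p_def pick_def by (metis arg_min_natI, metis arg_min_nat_le)
  have pA: "p n \<in> poly_over A" for n using p[of n] by (simp add: cand_def)
  have mono: "degree (p m) \<le> degree (p n)" if "m \<le> n" for m n
  proof (rule pmin)
    have "?ev ` Ps m \<subseteq> ?ev ` Ps n" using that by (auto simp: Ps_image)
    then show "cand (Ps m) (p n)"
      using p[of n] ideal_span_mono unfolding cand_def by blast
  qed
  let ?a = "\<lambda>n. lead_coeff (p n)"
  have "range ?a \<subseteq> A" using pA poly_over_coeff by blast
  then obtain E where E: "E \<subseteq> range ?a" "finite E" "range ?a \<subseteq> ideal_span A E"
    using noeth unfolding noetherian_def by metis
  then obtain S where S: "finite S" "E = ?a ` S" using finite_subset_image[of E ?a UNIV] by auto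
  \<comment> \<open>\<open>N\<close> exceeds all indices in a finite generating set of leading
    coefficients, so the leading coefficient of \<open>p N\<close> is a combination of earlier
    ones.\<close>
  obtain N where N: "S \<subseteq> {..<N}" using S(1) finite_nat_iff_bounded by blast
  let ?d = "degree (p N)"
  have "?a N \<in> ideal_span A (?a ` {..<N})"
    using E(3) S(2) N ideal_span_mono[of E "?a ` {..<N}"] by blast
  moreover have "\<exists>q\<in>poly_over A. degree q \<le> ?d \<and> coeff q ?d = a \<and> ?ev q \<in> ideal_span ?B (?ev ` Ps N)"
    if "a \<in> ideal_span A (?a ` {..<N})" for a
    using that
  proof (induction rule: ideal_span.induct)
    case span_zero
    show ?case by (rule bexI[of _ 0]) (auto intro: ideal_span.span_zero subring_zero[OF P])
  next
    case (span_step e c y)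
    then obtain i where i: "i < N" "e = ?a i" by auto
    obtain q where q: "q \<in> poly_over A" "degree q \<le> ?d" "coeff q ?d = y"
      "?ev q \<in> ideal_span ?B (?ev ` Ps N)" using span_step.IH by blast
    let ?m = "monom c (?d - degree (p i))"
    \<comment> \<open>Because least degrees never decrease, each earlier \<open>p i\<close> can be
      shifted by a monomial up to the degree of \<open>p N\<close>.\<close>
    have d: "degree (p i) \<le> ?d" using mono i(1) by simp
    have mA: "?m \<in> poly_over A" by (rule poly_over_monom[OF A span_step.hyps(2)])
    show ?case
    proof (intro bexI[of _ "?m * p i + q"] conjI)
      show "?m * p i + q \<in> poly_over A" by (intro subring_add[OF P] subring_mult[OF P] mA pA q)
      have "degree (?m * p i) \<le> ?d"
        using degree_mult_le[of ?m "p i"] degree_monom_le[of c "?d - degree (p i)"] d by linarith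
      then show "degree (?m * p i + q) \<le> ?d" using q(2) by (rule degree_add_le)
      show "coeff (?m * p i + q) ?d = c * e + y"
        using d q(3) i(2) by (simp add: coeff_monom_mult)
      have "?ev ?m \<in> ?B" using mA by (simp add: adjoin_def del: poly_monom)
      moreover have "?ev (p i) \<in> ?ev ` Ps N" using i(1) by (auto simp: Ps_image)
      ultimately have "?ev ?m * ?ev (p i) + ?ev q \<in> ideal_span ?B (?ev ` Ps N)"
        using q(4) by (intro ideal_span.span_step)
      then show "?ev (?m * p i + q) \<in> ideal_span ?B (?ev ` Ps N)" by simp
    qed
  qed
  ultimately obtain q where q: "q \<in> poly_over A" "degree q \<le> ?d" "coeff q ?d = ?a N"
      "?ev q \<in> ideal_span ?B (?ev ` Ps N)" by blast
  \<comment> \<open>The difference is again a candidate, but its coefficient in the least possible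
    degree vanishes. Hence it is zero, and zero is already generated.\<close>
  define r where "r = p N - q"
  have pN: "?ev (p N) \<in> ?J" "?ev (p N) \<notin> ideal_span ?B (?ev ` Ps N)"
    using p[of N] by (auto simp: cand_def)
  have qJ: "?ev q \<in> ?J" using ideal_span_trans[OF B _ q(4)] inv[of N] by blast
  have rI: "?ev r \<notin> ideal_span ?B (?ev ` Ps N)"
    using ideal_span_add[OF _ q(4), of "?ev r"] pN(2) by (auto simp: r_def)
  have "cand (Ps N) r"
    unfolding cand_def using rI ideal_span_diff[OF B pN(1) qJ] subring_diff[OF P pA q(1)]
    by (auto simp: r_def)
  then have "?d \<le> degree r" by (rule pmin)
  moreover have "degree r \<le> ?d" unfolding r_def using q(2) by (intro degree_diff_le) auto
  moreover have "coeff r ?d = 0" using q(3) by (simp add: r_def)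
  ultimately have "r = 0" by (metis le_antisym leading_coeff_0_iff)
  with rI show False by (simp add: ideal_span.span_zero)
qed

section \<open>Algebras of functions and irreducible sets\<close>

text \<open>Its members are functions on the whole type of points. Identities that hold only on a
  variety are expressed modulo the functions vanishing there.\<close>

inductive_set function_algebra :: "('p \<Rightarrow> 'k::field) set \<Rightarrow> ('p \<Rightarrow> 'k) set" for F where
  const: "(\<lambda>_. c) \<in> function_algebra F"
| gen: "f \<in> F \<Longrightarrow> f \<in> function_algebra F"
| add: "f \<in> function_algebra F \<Longrightarrow> g \<in> function_algebra F \<Longrightarrow> (\<lambda>x. f x + g x) \<in> function_algebra F"
| mult: "f \<in> function_algebra F \<Longrightarrow> g \<in> function_algebra F \<Longrightarrow> (\<lambda>x. f x * g x) \<in> function_algebra F"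

lemma function_algebra_diff:
  assumes "f \<in> function_algebra F" "g \<in> function_algebra F"
  shows "(\<lambda>x. f x - g x) \<in> function_algebra F"
  using function_algebra.add[OF assms(1) function_algebra.mult[OF function_algebra.const[of "-1"] assms(2)]]
  by simp

lemma function_algebra_sum:
  "(\<And>i. i \<in> S \<Longrightarrow> f i \<in> function_algebra F) \<Longrightarrow> (\<lambda>x. \<Sum>i\<in>S. f i x) \<in> function_algebra F"
  by (induction S rule: infinite_finite_induct) (auto intro: function_algebra.intros)

lemma function_algebra_subring: "unital_subring (function_algebra F)"
  unfolding unital_subring_def one_fun_def fun_diff_def times_fun_def
  by (auto intro: function_algebra.intros function_algebra_diff)

lemma function_algebra_minimal:
  assumes "unital_subring B" "\<And>c. (\<lambda>_. c) \<in> B" "F \<subseteq> B"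
  shows "function_algebra F \<subseteq> B"
proof
  fix f assume "f \<in> function_algebra F"
  then show "f \<in> B"
    by (induction rule: function_algebra.induct)
      (use assms subring_add[OF assms(1)] subring_mult[OF assms(1)] in
        \<open>auto simp: plus_fun_def times_fun_def\<close>)
qed

lemma function_algebra_mono: "F \<subseteq> F' \<Longrightarrow> function_algebra F \<subseteq> function_algebra F'"
  by (intro function_algebra_minimal function_algebra_subring) (auto intro: function_algebra.intros)

lemma function_algebra_insert: "function_algebra (insert b F) = adjoin (function_algebra F) b"
proof
  note A = function_algebra_subring[of F]
  show "function_algebra (insert b F) \<subseteq> adjoin (function_algebra F) b"
    by (intro function_algebra_minimal adjoin_subring A)
      (auto intro: adjoin_base[OF A] adjoin_gen[OF A] function_algebra.intros)
  show "adjoin (function_algebra F) b \<subseteq> function_algebra (insert b F)"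
    using function_algebra_mono[of F "insert b F"]
    by (intro adjoin_subset function_algebra_subring) (auto intro: function_algebra.intros)
qed

lemma function_algebra_empty: "f \<in> function_algebra {} \<Longrightarrow> \<exists>c. f = (\<lambda>_. c)"
  by (induction rule: function_algebra.induct) auto

lemma function_algebra_noetherian: "finite F \<Longrightarrow> noetherian (function_algebra F)"
proof (induction F rule: finite_induct)
  case empty
  show ?case unfolding noetherian_def
  proof (intro allI impI)
    fix J :: "('a \<Rightarrow> 'b) set" assume J: "J \<subseteq> function_algebra {}"
    note A = function_algebra_subring[of "{}"]
    show "\<exists>E\<subseteq>J. finite E \<and> J \<subseteq> ideal_span (function_algebra {}) E"
    proof (cases "J \<subseteq> {0}")
      case True
      then show ?thesis by (intro exI[of _ "{}"]) (auto intro: ideal_span.span_zero)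
    next
      case False
      then obtain j where j: "j \<in> J" "j \<noteq> 0" by blast
      with J obtain c where c: "j = (\<lambda>_. c)" using function_algebra_empty by blast
      have "c \<noteq> 0" using j(2) c by (auto simp: zero_fun_def)
      have "f \<in> ideal_span (function_algebra {}) {j}" if "f \<in> J" for f
      proof -
        obtain d where "f = (\<lambda>_. d)" using \<open>f \<in> J\<close> J function_algebra_empty by blast
        then have "f = (\<lambda>_. d / c) * j" using c \<open>c \<noteq> 0\<close> by (simp add: times_fun_def)
        then show ?thesis
          using ideal_span_mult[OF A function_algebra.const[of "d / c"] ideal_span_gen[OF A, of j "{j}"]] by simp
      qed
      then show ?thesis using j(1) by (intro exI[of _ "{j}"]) auto
    qed
  qed
next
  case (insert b F)
  then show ?case unfolding function_algebra_insert
    by (intro hilbert_basis function_algebra_subring)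
qed

section \<open>Vanishing ideals, irreducible sets and their chains\<close>

definition vanishing_ideal :: "'p set \<Rightarrow> ('p \<Rightarrow> 'k::field) set" where
  "vanishing_ideal X = {f. \<forall>x\<in>X. f x = 0}"

text \<open>Irreducibility in the Zariski topology given by \<open>F\<close>, for sets that need not
  be closed: images and products then qualify before any closure is taken.\<close>

definition irreducible_set :: "('p \<Rightarrow> 'k::field) set \<Rightarrow> 'p set \<Rightarrow> bool" where
  "irreducible_set F X \<longleftrightarrow> X \<noteq> {} \<and> (\<forall>f\<in>function_algebra F. \<forall>g\<in>function_algebra F.
    (\<forall>x\<in>X. f x * g x = 0) \<longrightarrow> (\<forall>x\<in>X. f x = 0) \<or> (\<forall>x\<in>X. g x = 0))"

lemma irreducible_setD:
  assumes "irreducible_set F X" "f \<in> function_algebra F" "g \<in> function_algebra F"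
    and "x \<in> X" "f x \<noteq> 0" "y \<in> X" "g y \<noteq> 0"
  shows "\<exists>z\<in>X. f z \<noteq> 0 \<and> g z \<noteq> 0"
proof (rule ccontr)
  assume "\<not> ?thesis"
  then have "\<forall>z\<in>X. f z * g z = 0" by auto
  with assms(1-3) have "(\<forall>x\<in>X. f x = 0) \<or> (\<forall>x\<in>X. g x = 0)" unfolding irreducible_set_def by blast
  with assms(4-7) show False by blast
qed

lemma irreducible_setI:
  assumes "X \<noteq> {}" "\<And>f g x y. f \<in> function_algebra F \<Longrightarrow> g \<in> function_algebra F \<Longrightarrow>
    x \<in> X \<Longrightarrow> f x \<noteq> 0 \<Longrightarrow> y \<in> X \<Longrightarrow> g y \<noteq> 0 \<Longrightarrow> \<exists>z\<in>X. f z \<noteq> 0 \<and> g z \<noteq> 0"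
  shows "irreducible_set F X"
  unfolding irreducible_set_def
proof (intro conjI ballI impI assms(1))
  fix f g assume fg: "f \<in> function_algebra F" "g \<in> function_algebra F" "\<forall>x\<in>X. f x * g x = 0"
  show "(\<forall>x\<in>X. f x = 0) \<or> (\<forall>x\<in>X. g x = 0)"
  proof (rule ccontr)
    assume "\<not> ?thesis"
    then obtain x y where "x \<in> X" "f x \<noteq> 0" "y \<in> X" "g y \<noteq> 0" by blast
    with assms(2)[OF fg(1,2)] fg(3) show False by auto
  qed
qed

lemma irreducible_set_mono: "irreducible_set F' X \<Longrightarrow> F \<subseteq> F' \<Longrightarrow> irreducible_set F X"
  using function_algebra_mono[of F F'] unfolding irreducible_set_def by blast

text \<open>\<open>C\<close> may contain functions that only agree with regular ones on
  \<open>X\<close>. Pullbacks along maps that are regular just on \<open>X\<close> are of this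
  kind.\<close>

lemma irreducible_set_prime:
  assumes "irreducible_set F X" "\<And>f. f \<in> C \<Longrightarrow> \<exists>f'\<in>function_algebra F. \<forall>x\<in>X. f x = f' x"
  shows "prime_on C (vanishing_ideal X)"
  unfolding prime_on_def
proof (intro conjI ballI impI)
  show "1 \<notin> vanishing_ideal X" using assms(1) by (auto simp: vanishing_ideal_def irreducible_set_def)
  fix f g assume fg: "f \<in> C" "g \<in> C" "f * g \<in> vanishing_ideal X"
  obtain f' where f': "f' \<in> function_algebra F" "\<forall>x\<in>X. f x = f' x" using assms(2)[OF fg(1)] by blast
  obtain g' where g': "g' \<in> function_algebra F" "\<forall>x\<in>X. g x = g' x" using assms(2)[OF fg(2)] by blast
  have "\<forall>x\<in>X. f' x * g' x = 0" using fg(3) f'(2) g'(2) by (auto simp: vanishing_ideal_def)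
  then have "(\<forall>x\<in>X. f' x = 0) \<or> (\<forall>x\<in>X. g' x = 0)"
    using assms(1) f'(1) g'(1) unfolding irreducible_set_def by blast
  then show "f \<in> vanishing_ideal X \<or> g \<in> vanishing_ideal X"
    using f'(2) g'(2) by (auto simp: vanishing_ideal_def)
qed (auto simp: vanishing_ideal_def)

text \<open>Noetherian induction: a set that is not irreducible is the union of two proper subsets,
  each cut out by one factor of a product vanishing on it.\<close>

lemma finite_irreducible_decomposition:
  fixes F :: "('p \<Rightarrow> 'k::field) set"
  assumes "finite F"
  shows "\<exists>\<C>. finite \<C> \<and> \<Union>\<C> = X \<and> (\<forall>C\<in>\<C>. irreducible_set F C)"
proof -
  let ?R = "function_algebra F"
  \<comment> \<open>Only cutting by one regular function counts as a descent, so the noetherian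
    property yields well-foundedness for arbitrary sets of points, closed or not.\<close>
  define rel where "rel = {(Y, X :: 'p set). Y \<noteq> X \<and> (\<exists>f\<in>?R. Y = {x \<in> X. f x = 0})}"
  have "wf rel"
  proof (rule ccontr)
    assume "\<not> wf rel"
    then obtain X where "\<And>i. (X (Suc i), X i) \<in> rel" using wf_iff_no_infinite_down_chain by blast
    then have ne: "\<And>i. X (Suc i) \<noteq> X i" and ex: "\<And>i. \<exists>f\<in>?R. X (Suc i) = {x \<in> X i. f x = 0}"
      by (auto simp: rel_def)
    from ex have "\<forall>i. \<exists>f. f \<in> ?R \<and> X (Suc i) = {x \<in> X i. f x = 0}" by blast
    from choice[OF this] obtain f where
      f_all: "\<forall>i. f i \<in> ?R \<and> X (Suc i) = {x \<in> X i. f i x = 0}" ..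
    have f: "f i \<in> ?R" "X (Suc i) = {x \<in> X i. f i x = 0}" for i using spec[OF f_all, of i] by (rule conjunct1, rule conjunct2)
    have anti: "X j \<subseteq> X i" if "i \<le> j" for i j
      using that by (induction rule: dec_induct) (auto simp: f(2))
    have "range f \<subseteq> ?R" using f(1) by blast
    then obtain E where E: "E \<subseteq> range f" "finite E" "range f \<subseteq> ideal_span ?R E"
      using function_algebra_noetherian[OF assms] unfolding noetherian_def by metis
    then obtain S where S: "finite S" "E = f ` S" using finite_subset_image[of E f UNIV] by auto
    \<comment> \<open>All functions of the sequence are combinations of those with index below
      \<open>N\<close>, and these vanish on \<open>X N\<close>; the next cut therefore removes
      nothing.\<close>
    obtain N where N: "S \<subseteq> {..<N}" using S(1) finite_nat_iff_bounded by blast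
    have "g x = 0" if "g \<in> ideal_span ?R E" "x \<in> X N" for g x
      using that
    proof (induction rule: ideal_span.induct)
      case (span_step e c y)
      then obtain i where i: "i < N" "e = f i" using S(2) N by auto
      then have "x \<in> X (Suc i)" using anti[of "Suc i" N] span_step.prems by auto
      then have "e x = 0" using f(2) i(2) by auto
      then show ?case using span_step by simp
    qed simp
    from this[of "f N"] have "\<forall>x\<in>X N. f N x = 0" using subsetD[OF E(3) rangeI] by blast
    then have "X (Suc N) = X N" unfolding f(2)[of N] by blast
    with ne show False by blast
  qed
  then show ?thesis
  proof (induction X rule: wf_induct_rule)
    case (less X)
    show ?case
    proof (cases "X = {} \<or> irreducible_set F X")
      case True
      then show ?thesis
      proof
        assume "X = {}"
        then show ?thesis by (intro exI[of _ "{}"]) simp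
      next
        assume "irreducible_set F X"
        then show ?thesis by (intro exI[of _ "{X}"]) simp
      qed
    next
      case False
      then obtain f g where fg: "f \<in> ?R" "g \<in> ?R" "\<forall>x\<in>X. f x * g x = 0"
        "\<not> (\<forall>x\<in>X. f x = 0)" "\<not> (\<forall>x\<in>X. g x = 0)" unfolding irreducible_set_def by blast
      let ?Y = "{x \<in> X. f x = 0}" and ?Z = "{x \<in> X. g x = 0}"
      have "?Y \<noteq> X" "?Z \<noteq> X" using fg(4,5) by blast+
      then have "(?Y, X) \<in> rel" "(?Z, X) \<in> rel" using fg(1,2) unfolding rel_def by blast+
      then obtain \<C> \<D> where "finite \<C> \<and> \<Union>\<C> = ?Y \<and> (\<forall>C\<in>\<C>. irreducible_set F C)"
        "finite \<D> \<and> \<Union>\<D> = ?Z \<and> (\<forall>C\<in>\<D>. irreducible_set F C)" using less.IH by meson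
      moreover have "?Y \<union> ?Z = X" using fg(3) by auto
      ultimately show ?thesis by (intro exI[of _ "\<C> \<union> \<D>"]) auto
    qed
  qed
qed

text \<open>The bound is crude (the true one is the transcendence degree) but needs no dimension theory:
  at most two members of a chain of prime ideals of \<open>A[b]\<close> lie over the same prime ideal of \<open>A\<close>.\<close>

lemma irreducible_chain_length:
  fixes F :: "('p \<Rightarrow> 'k::field) set"
  assumes "finite F" and "\<And>i. i \<le> r \<Longrightarrow> irreducible_set F (X i)"
    and "\<And>i. i < r \<Longrightarrow> X i \<subseteq> X (Suc i)"
    and "\<And>i. i < r \<Longrightarrow> \<exists>g\<in>function_algebra F. (\<forall>x\<in>X i. g x = 0) \<and> (\<exists>x\<in>X (Suc i). g x \<noteq> 0)"
  shows "r < 2 ^ card F"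
  using assms
proof (induction F arbitrary: r X rule: finite_induct)
  case empty
  have False if r: "0 < r"
  proof -
    obtain g :: "'p \<Rightarrow> 'k" where g: "g \<in> function_algebra {}"
      "\<forall>x\<in>X 0. g x = 0" "\<exists>x\<in>X (Suc 0). g x \<noteq> 0" using empty.prems(3)[OF r] by blast
    moreover have "X 0 \<noteq> {}" using empty.prems(1)[of 0] by (simp add: irreducible_set_def)
    moreover obtain c where "g = (\<lambda>_. c)" using function_algebra_empty[OF g(1)] ..
    ultimately show False by auto
  qed
  then show ?case by auto
next
  case (insert b F)
  let ?A = "function_algebra F" and ?B = "function_algebra (insert b F)"
  show ?case
  proof (rule ccontr)
    assume "\<not> r < 2 ^ card (insert b F)"
    with insert.hyps have r: "2 * 2 ^ card F \<le> r" by simp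
    have AB: "?A \<subseteq> ?B" by (rule function_algebra_mono) auto
    \<comment> \<open>Every second member of a chain that is too long gives a chain too long for
      \<open>F\<close>. So some \<open>X0\<close>, \<open>X1\<close>, \<open>X2\<close> impose the
      same conditions on functions from \<open>?A\<close>.\<close>
    let ?Y = "\<lambda>i. X (2 * i)"
    have "irreducible_set F (?Y i)" if "i \<le> 2 ^ card F" for i
      using irreducible_set_mono[OF insert.prems(1)[of "2 * i"]] that r by auto
    moreover have "?Y i \<subseteq> ?Y (Suc i)" if "i < 2 ^ card F" for i
      using insert.prems(2)[of "2 * i"] insert.prems(2)[of "Suc (2 * i)"] that r by auto
    ultimately obtain i where i: "i < 2 ^ card F"
      and same: "\<And>g. g \<in> ?A \<Longrightarrow> (\<forall>x\<in>?Y i. g x = 0) \<Longrightarrow> (\<forall>x\<in>?Y (Suc i). g x = 0)"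
      using insert.IH[of "2 ^ card F" ?Y] by blast
    define X0 X1 X2 where "X0 = X (2 * i)" and "X1 = X (Suc (2 * i))" and "X2 = X (Suc (Suc (2 * i)))"
    have sub: "X0 \<subseteq> X1" "X1 \<subseteq> X2"
      using insert.prems(2)[of "2 * i"] insert.prems(2)[of "Suc (2 * i)"] i r by (auto simp: X0_def X1_def X2_def)
    have same': "\<forall>x\<in>X2. g x = 0" if "g \<in> ?A" "\<forall>x\<in>X0. g x = 0" for g
      using same[of g] that by (simp add: X0_def X2_def)
    have irr: "irreducible_set (insert b F) X1" "irreducible_set (insert b F) X2"
      using insert.prems(1)[of "Suc (2 * i)"] insert.prems(1)[of "Suc (Suc (2 * i))"] i r
      by (auto simp: X1_def X2_def)
    have "2 * i < r" using i r by simp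
    from insert.prems(3)[OF this, folded X0_def X1_def X2_def]
    obtain g1 where g1_B: "g1 \<in> ?B" and "(\<forall>x\<in>X0. g1 x = 0) \<and> (\<exists>x\<in>X1. g1 x \<noteq> 0)"
      by (rule bexE)
    then have g1: "g1 \<in> ?B" "\<forall>x\<in>X0. g1 x = 0" "\<exists>x\<in>X1. g1 x \<noteq> 0" by simp_all
    have "Suc (2 * i) < r" using i r by simp
    from insert.prems(3)[OF this, folded X0_def X1_def X2_def]
    obtain g2 where g2_B: "g2 \<in> ?B" and "(\<forall>x\<in>X1. g2 x = 0) \<and> (\<exists>x\<in>X2. g2 x \<noteq> 0)"
      by (rule bexE)
    then have g2: "g2 \<in> ?B" "\<forall>x\<in>X1. g2 x = 0" "\<exists>x\<in>X2. g2 x \<noteq> 0" by simp_all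
    interpret I1: prime_adjoin ?A "vanishing_ideal X1 :: ('p \<Rightarrow> 'k) set" b
    proof
      show "prime_on (adjoin ?A b) (vanishing_ideal X1)"
        unfolding function_algebra_insert[symmetric] by (rule irreducible_set_prime[OF irr(1)]) blast
    qed (rule function_algebra_subring)
    interpret I2: prime_adjoin ?A "vanishing_ideal X2 :: ('p \<Rightarrow> 'k) set" b
    proof
      show "prime_on (adjoin ?A b) (vanishing_ideal X2)"
        unfolding function_algebra_insert[symmetric] by (rule irreducible_set_prime[OF irr(2)]) blast
    qed (rule function_algebra_subring)
    \<comment> \<open>\<open>g2\<close> provides an algebraic equation for \<open>b\<close> modulo
      the ideal of \<open>X1\<close>: if all coefficients vanished on \<open>X1\<close>, they would
      vanish on \<open>X2\<close> too, and so would \<open>g2\<close>.\<close>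
    obtain q where q: "q \<in> poly_over ?A" "g2 = poly q b"
      using g2(1) by (auto simp: function_algebra_insert adjoin_def)
    have "q \<notin> poly_over (vanishing_ideal X1)"
    proof
      assume "q \<in> poly_over (vanishing_ideal X1)"
      then have "\<forall>x\<in>X0. coeff q n x = 0" for n using sub(1) by (auto simp: poly_over_def vanishing_ideal_def)
      then have "q \<in> poly_over (vanishing_ideal X2)"
        using same' poly_over_coeff[OF q(1)] by (simp add: poly_over_def vanishing_ideal_def)
      then have "g2 \<in> vanishing_ideal X2" unfolding q(2) by (rule I2.vanishing_poly)
      with g2(3) show False by (simp add: vanishing_ideal_def)
    qed
    then have "I1.relation q"
      unfolding I1.relation_def using q g2(2) by (simp add: vanishing_ideal_def)
    moreover have "g1 \<in> adjoin ?A b" "g1 \<notin> vanishing_ideal X1"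
      using g1 by (auto simp: function_algebra_insert vanishing_ideal_def)
    \<comment> \<open>Being nonzero on \<open>X1\<close>, \<open>g1\<close> divides some
      \<open>c\<close> in \<open>?A\<close> that is nonzero there. But \<open>c\<close> vanishes on
      \<open>X0\<close> together with \<open>g1\<close>, hence on all of \<open>X2\<close>.\<close>
    ultimately obtain v c where c: "c \<in> ?A" "c \<notin> vanishing_ideal X1" "v * g1 - c \<in> vanishing_ideal X1"
      using I1.algebraic_divides_base by blast
    from c(3) g1(2) sub(1) have "\<forall>x\<in>X0. c x = 0" by (fastforce simp: vanishing_ideal_def)
    then have "\<forall>x\<in>X2. c x = 0" using same' c(1) by blast
    with c(2) sub(2) show False by (auto simp: vanishing_ideal_def)
  qed
qed

section \<open>Regular maps, products and images\<close>

definition regular_map :: "('p \<Rightarrow> 'k::field) set \<Rightarrow> 'p set \<Rightarrow> ('q \<Rightarrow> 'k) set \<Rightarrow> ('p \<Rightarrow> 'q) \<Rightarrow> bool" where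
  "regular_map F X F' \<phi> \<longleftrightarrow> (\<forall>f\<in>F'. \<exists>f'\<in>function_algebra F. \<forall>x\<in>X. f (\<phi> x) = f' x)"

lemma regular_map_pullback:
  assumes "regular_map F X F' \<phi>" and "f \<in> function_algebra F'"
  shows "\<exists>f'\<in>function_algebra F. \<forall>x\<in>X. f (\<phi> x) = f' x"
  using assms(2)
proof (induction rule: function_algebra.induct)
  case (const c)
  show ?case by (rule bexI[OF _ function_algebra.const[of c]]) simp
next
  case (gen f)
  then show ?case using assms(1) by (simp add: regular_map_def)
next
  case (add f g)
  then obtain f' g' where *: "f' \<in> function_algebra F" "g' \<in> function_algebra F"
    "\<forall>x\<in>X. f (\<phi> x) = f' x" "\<forall>x\<in>X. g (\<phi> x) = g' x" by blast
  show ?case by (rule bexI[OF _ function_algebra.add[OF *(1,2)]]) (simp add: *)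
next
  case (mult f g)
  then obtain f' g' where *: "f' \<in> function_algebra F" "g' \<in> function_algebra F"
    "\<forall>x\<in>X. f (\<phi> x) = f' x" "\<forall>x\<in>X. g (\<phi> x) = g' x" by blast
  show ?case by (rule bexI[OF _ function_algebra.mult[OF *(1,2)]]) (simp add: *)
qed

lemma regular_map_comp:
  assumes "regular_map F X F' \<phi>" "regular_map F' Y F'' \<psi>" "\<phi> ` X \<subseteq> Y"
  shows "regular_map F X F'' (\<lambda>x. \<psi> (\<phi> x))"
  unfolding regular_map_def
proof
  fix f assume f: "f \<in> F''"
  obtain g where g: "g \<in> function_algebra F'" "\<forall>y\<in>Y. f (\<psi> y) = g y"
    using regular_map_pullback[OF assms(2) function_algebra.gen[OF f]] by (rule bexE)
  obtain f' where f': "f' \<in> function_algebra F" "\<forall>x\<in>X. g (\<phi> x) = f' x"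
    using regular_map_pullback[OF assms(1) g(1)] by (rule bexE)
  have "\<forall>x\<in>X. f (\<psi> (\<phi> x)) = f' x" using g(2) f'(2) assms(3) by auto
  then show "\<exists>f'\<in>function_algebra F. \<forall>x\<in>X. f (\<psi> (\<phi> x)) = f' x" by (rule bexI[OF _ f'(1)])
qed

lemma regular_map_subset: "regular_map F X F' \<phi> \<Longrightarrow> X' \<subseteq> X \<Longrightarrow> regular_map F X' F' \<phi>"
  unfolding regular_map_def by (meson subset_iff)

lemma regular_map_id: "regular_map F X F (\<lambda>x. x)"
  unfolding regular_map_def by (auto intro: function_algebra.gen)

lemma regular_map_const: "regular_map F X F' (\<lambda>_. a)"
  unfolding regular_map_def by (intro ballI bexI[OF _ function_algebra.const]) simp

lemma irreducible_set_image:
  assumes "irreducible_set F X" "regular_map F X F' \<phi>"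
  shows "irreducible_set F' (\<phi> ` X)"
proof (rule irreducible_setI)
  show "\<phi> ` X \<noteq> {}" using assms(1) by (simp add: irreducible_set_def)
  fix f g x y assume f: "f \<in> function_algebra F'" and g: "g \<in> function_algebra F'"
    and xy: "x \<in> \<phi> ` X" "f x \<noteq> 0" "y \<in> \<phi> ` X" "g y \<noteq> 0"
  obtain f' where f': "f' \<in> function_algebra F" "\<forall>x\<in>X. f (\<phi> x) = f' x"
    using regular_map_pullback[OF assms(2) f] by (rule bexE)
  obtain g' where g': "g' \<in> function_algebra F" "\<forall>x\<in>X. g (\<phi> x) = g' x"
    using regular_map_pullback[OF assms(2) g] by (rule bexE)
  from xy obtain x' y' where "x' \<in> X" "x = \<phi> x'" "y' \<in> X" "y = \<phi> y'" by blast
  then have "\<exists>z\<in>X. f' z \<noteq> 0 \<and> g' z \<noteq> 0"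
    using irreducible_setD[OF assms(1) f'(1) g'(1), of x' y'] f'(2) g'(2) xy by simp
  then show "\<exists>z\<in>\<phi> ` X. f z \<noteq> 0 \<and> g z \<noteq> 0" using f'(2) g'(2) by auto
qed

definition product_gens :: "('p \<Rightarrow> 'k) set \<Rightarrow> ('q \<Rightarrow> 'k) set \<Rightarrow> ('p \<times> 'q \<Rightarrow> 'k) set" where
  "product_gens F F' = (\<lambda>f p. f (fst p)) ` F \<union> (\<lambda>f p. f (snd p)) ` F'"

lemma finite_product_gens: "finite F \<Longrightarrow> finite F' \<Longrightarrow> finite (product_gens F F')"
  by (simp add: product_gens_def)

lemma regular_map_pair:
  assumes "regular_map F X F1 \<phi>" "regular_map F X F2 \<psi>"
  shows "regular_map F X (product_gens F1 F2) (\<lambda>x. (\<phi> x, \<psi> x))"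
  using assms unfolding regular_map_def product_gens_def by auto

lemma regular_map_fst: "regular_map (product_gens F F') X F fst"
  unfolding regular_map_def product_gens_def
  by (intro ballI bexI[OF _ function_algebra.gen]) (rule refl, blast)

lemma regular_map_snd: "regular_map (product_gens F F') X F' snd"
  unfolding regular_map_def product_gens_def
  by (intro ballI bexI[OF _ function_algebra.gen]) (rule refl, blast)

text \<open>Two functions are made nonzero at a common point one coordinate at a time: first along
  the slices over \<open>x1\<close> and \<open>x2\<close>, which share a suitable \<open>y\<close>,
  then along the slice at that \<open>y\<close>.\<close>

lemma irreducible_set_product:
  assumes X: "irreducible_set F X" and Y: "irreducible_set F' Y"
  shows "irreducible_set (product_gens F F') (X \<times> Y)"
proof (rule irreducible_setI)
  show "X \<times> Y \<noteq> {}" using assms by (simp add: irreducible_set_def)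
  fix f g p q
  assume f: "f \<in> function_algebra (product_gens F F')" and g: "g \<in> function_algebra (product_gens F F')"
    and pq: "p \<in> X \<times> Y" "f p \<noteq> 0" "q \<in> X \<times> Y" "g q \<noteq> 0"
  obtain x1 y1 x2 y2 where p: "p = (x1, y1)" and q: "q = (x2, y2)" by fastforce
  have vert: "\<exists>f'\<in>function_algebra F'. \<forall>y\<in>Y. f (x, y) = f' y"
    if "f \<in> function_algebra (product_gens F F')" for f x
    by (rule regular_map_pullback[OF regular_map_pair[OF regular_map_const regular_map_id] that])
  have horiz: "\<exists>f'\<in>function_algebra F. \<forall>x\<in>X. f (x, y) = f' x"
    if "f \<in> function_algebra (product_gens F F')" for f y
    by (rule regular_map_pullback[OF regular_map_pair[OF regular_map_id regular_map_const] that])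
  obtain f' where f': "f' \<in> function_algebra F'" "\<forall>y\<in>Y. f (x1, y) = f' y" using vert[OF f] by (rule bexE)
  obtain g' where g': "g' \<in> function_algebra F'" "\<forall>y\<in>Y. g (x2, y) = g' y" using vert[OF g] by (rule bexE)
  obtain y where y: "y \<in> Y" "f (x1, y) \<noteq> 0" "g (x2, y) \<noteq> 0"
    using irreducible_setD[OF Y f'(1) g'(1), of y1 y2] pq f'(2) g'(2) by (auto simp: p q)
  obtain f'' where f'': "f'' \<in> function_algebra F" "\<forall>x\<in>X. f (x, y) = f'' x" using horiz[OF f] by (rule bexE)
  obtain g'' where g'': "g'' \<in> function_algebra F" "\<forall>x\<in>X. g (x, y) = g'' x" using horiz[OF g] by (rule bexE)
  obtain x where "x \<in> X" "f (x, y) \<noteq> 0" "g (x, y) \<noteq> 0"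
    using irreducible_setD[OF X f''(1) g''(1), of x1 x2] pq f''(2) g''(2) y by (auto simp: p q)
  with y(1) show "\<exists>z\<in>X \<times> Y. f z \<noteq> 0 \<and> g z \<noteq> 0" by blast
qed

section \<open>Closures and points obtained from characters\<close>

definition closure_in :: "('p \<Rightarrow> 'k::field) set \<Rightarrow> 'p set \<Rightarrow> 'p set \<Rightarrow> 'p set" where
  "closure_in F U Z = {x \<in> U. \<forall>f\<in>function_algebra F. (\<forall>z\<in>Z. f z = 0) \<longrightarrow> f x = 0}"

lemma closure_in_subset: "closure_in F U Z \<subseteq> U"
  by (auto simp: closure_in_def)

lemma subset_closure_in: "Z \<subseteq> U \<Longrightarrow> Z \<subseteq> closure_in F U Z"
  by (auto simp: closure_in_def)

lemma closure_in_vanish: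
  "f \<in> function_algebra F \<Longrightarrow> \<forall>z\<in>Z. f z = 0 \<Longrightarrow> x \<in> closure_in F U Z \<Longrightarrow> f x = 0"
  by (auto simp: closure_in_def)

lemma irreducible_closure_in:
  assumes "irreducible_set F Z" "Z \<subseteq> U"
  shows "irreducible_set F (closure_in F U Z)"
proof (rule irreducible_setI)
  show "closure_in F U Z \<noteq> {}"
    using assms subset_closure_in[OF assms(2), of F] by (auto simp: irreducible_set_def)
  fix f g x y assume fg: "f \<in> function_algebra F" "g \<in> function_algebra F"
    "x \<in> closure_in F U Z" "f x \<noteq> 0" "y \<in> closure_in F U Z" "g y \<noteq> 0"
  have "\<exists>x'\<in>Z. f x' \<noteq> 0" "\<exists>y'\<in>Z. g y' \<noteq> 0"
    using closure_in_vanish[OF fg(1) _ fg(3)] closure_in_vanish[OF fg(2) _ fg(5)] fg(4,6) by blast+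
  then show "\<exists>z\<in>closure_in F U Z. f z \<noteq> 0 \<and> g z \<noteq> 0"
    using irreducible_setD[OF assms(1) fg(1,2)] subset_closure_in[OF assms(2), of F] by blast
qed

text \<open>The Nullstellensatz property: every point of the spectrum comes from a point of \<open>X\<close>.\<close>

definition affine_set :: "('p \<Rightarrow> 'k::field) set \<Rightarrow> 'p set \<Rightarrow> bool" where
  "affine_set F X \<longleftrightarrow> (\<forall>\<chi>. character (function_algebra F) (vanishing_ideal X) \<chi> \<longrightarrow>
    (\<forall>c. \<chi> (\<lambda>_. c) = c) \<longrightarrow> (\<exists>x\<in>X. \<forall>f\<in>function_algebra F. \<chi> f = f x))"

lemma character_pullback:
  assumes \<chi>: "character (function_algebra F') (vanishing_ideal Y) \<chi>"
    and pb: "\<And>f. f \<in> function_algebra F \<Longrightarrow> (\<lambda>y. f (\<phi> y)) \<in> function_algebra F'" and "\<phi> ` Y \<subseteq> X"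
  shows "character (function_algebra F) (vanishing_ideal X) (\<lambda>f. \<chi> (\<lambda>y. f (\<phi> y)))"
  unfolding character_def
proof (intro conjI ballI)
  show "\<chi> (\<lambda>y. 1 (\<phi> y)) = 1" using character_one[OF \<chi>] by (simp add: one_fun_def)
  fix f g assume fg: "f \<in> function_algebra F" "g \<in> function_algebra F"
  show "\<chi> (\<lambda>y. (f + g) (\<phi> y)) = \<chi> (\<lambda>y. f (\<phi> y)) + \<chi> (\<lambda>y. g (\<phi> y))"
    using character_add[OF \<chi> pb[OF fg(1)] pb[OF fg(2)]] by (simp add: plus_fun_def)
  show "\<chi> (\<lambda>y. (f * g) (\<phi> y)) = \<chi> (\<lambda>y. f (\<phi> y)) * \<chi> (\<lambda>y. g (\<phi> y))"
    using character_mult[OF \<chi> pb[OF fg(1)] pb[OF fg(2)]] by (simp add: times_fun_def)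
next
  fix f assume "f \<in> function_algebra F \<inter> vanishing_ideal X"
  then show "\<chi> (\<lambda>y. f (\<phi> y)) = 0"
    using assms(3) by (intro character_vanish[OF \<chi>] pb) (auto simp: vanishing_ideal_def)
qed

lemma character_eq_eval:
  assumes \<chi>: "character (function_algebra F) I \<chi>" "\<And>c. \<chi> (\<lambda>_. c) = c"
    and gen: "\<And>f. f \<in> F \<Longrightarrow> \<chi> f = f x" and "f \<in> function_algebra F"
  shows "\<chi> f = f x"
  using assms(4)
proof (induction rule: function_algebra.induct)
  case (add f g)
  then show ?case using character_add[OF \<chi>(1), of f g] by (simp add: plus_fun_def)
next
  case (mult f g)
  then show ?case using character_mult[OF \<chi>(1), of f g] by (simp add: times_fun_def)
qed (simp_all add: \<chi>(2) gen)

text \<open>The point of \<open>U\<close> belonging to the character satisfies every equation of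
  \<open>Z\<close>, because the character kills all functions vanishing on the closure.\<close>

lemma affine_closure_in:
  assumes "affine_set F U"
  shows "affine_set F (closure_in F U Z)"
  unfolding affine_set_def
proof (intro allI impI)
  fix \<chi> assume \<chi>: "character (function_algebra F) (vanishing_ideal (closure_in F U Z)) \<chi>"
    and c: "\<forall>c. \<chi> (\<lambda>_. c) = c"
  have "character (function_algebra F) (vanishing_ideal U) \<chi>"
    using \<chi> closure_in_subset[of F U Z] by (auto simp: character_def vanishing_ideal_def subset_iff)
  then obtain x where x: "x \<in> U" "\<forall>f\<in>function_algebra F. \<chi> f = f x"
    using assms c unfolding affine_set_def by blast
  have "x \<in> closure_in F U Z"
    unfolding closure_in_def
  proof (intro CollectI conjI ballI impI x(1))
    fix f assume f: "f \<in> function_algebra F" "\<forall>z\<in>Z. f z = 0"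
    then have "f \<in> vanishing_ideal (closure_in F U Z)"
      using closure_in_vanish by (auto simp: vanishing_ideal_def)
    then show "f x = 0" using character_vanish[OF \<chi> f(1)] bspec[OF x(2) f(1)] by simp
  qed
  with x(2) show "\<exists>x\<in>closure_in F U Z. \<forall>f\<in>function_algebra F. \<chi> f = f x" by blast
qed

text \<open>Restricting a character to functions of one coordinate gives the two components of the
  point; agreement on generators then suffices.\<close>

lemma affine_product:
  assumes X: "affine_set F X" and Y: "affine_set F' Y"
  shows "affine_set (product_gens F F') (X \<times> Y)"
  unfolding affine_set_def
proof (intro allI impI)
  let ?R = "function_algebra (product_gens F F')"
  fix \<chi> assume \<chi>: "character ?R (vanishing_ideal (X \<times> Y)) \<chi>" and c: "\<forall>c. \<chi> (\<lambda>_. c) = c"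
  have p1: "(\<lambda>p. f (fst p)) \<in> ?R" if "f \<in> function_algebra F" for f
    using that by (induction rule: function_algebra.induct)
      (auto intro: function_algebra.intros simp: product_gens_def)
  have p2: "(\<lambda>p. f (snd p)) \<in> ?R" if "f \<in> function_algebra F'" for f
    using that by (induction rule: function_algebra.induct)
      (auto intro: function_algebra.intros simp: product_gens_def)
  have "character (function_algebra F) (vanishing_ideal X) (\<lambda>f. \<chi> (\<lambda>p. f (fst p)))"
    by (rule character_pullback[OF \<chi> p1]) auto
  then obtain x where x: "x \<in> X" "\<forall>f\<in>function_algebra F. \<chi> (\<lambda>p. f (fst p)) = f x"
    using X c unfolding affine_set_def by fastforce
  have "character (function_algebra F') (vanishing_ideal Y) (\<lambda>f. \<chi> (\<lambda>p. f (snd p)))"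
    by (rule character_pullback[OF \<chi> p2]) auto
  then obtain y where y: "y \<in> Y" "\<forall>f\<in>function_algebra F'. \<chi> (\<lambda>p. f (snd p)) = f y"
    using Y c unfolding affine_set_def by fastforce
  have "\<chi> f = f (x, y)" if "f \<in> product_gens F F'" for f
    using that x(2) y(2) by (auto simp: product_gens_def intro: function_algebra.gen)
  then have "\<forall>f\<in>?R. \<chi> f = f (x, y)" using character_eq_eval[OF \<chi>] c by blast
  with x(1) y(1) show "\<exists>x\<in>X \<times> Y. \<forall>f\<in>?R. \<chi> f = f x" by blast
qed

text \<open>A weak form of Chevalley's theorem: the image of a nonempty principal open subset contains
  a nonempty principal open subset of its closure.\<close>

lemma image_contains_open:
  fixes F :: "('p \<Rightarrow> 'k::alg_closed_field) set" and F' :: "('q \<Rightarrow> 'k) set"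
  assumes "finite F" and irr: "irreducible_set F V" and aff: "affine_set F V"
    and reg: "regular_map F V F' \<phi>" and b: "b \<in> function_algebra F" "v0 \<in> V" "b v0 \<noteq> 0"
  shows "\<exists>e\<in>function_algebra F'. (\<exists>v\<in>V. e (\<phi> v) \<noteq> 0) \<and>
    (\<forall>w. (\<forall>f\<in>function_algebra F'. (\<forall>v\<in>V. f (\<phi> v) = 0) \<longrightarrow> f w = 0) \<longrightarrow> e w \<noteq> 0 \<longrightarrow>
      (\<exists>v\<in>V. b v \<noteq> 0 \<and> (\<forall>f\<in>function_algebra F'. f (\<phi> v) = f w)))"
proof -
  let ?R = "function_algebra F" and ?R' = "function_algebra F'" and ?I = "vanishing_ideal V"
  \<comment> \<open>Pullbacks of regular functions agree with members of \<open>?R\<close> only on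
    \<open>V\<close>. The larger ring \<open>C\<close> contains both kinds, and the vanishing ideal
    of \<open>V\<close> is still prime on it.\<close>
  define C where "C = {f. \<exists>f'\<in>?R. \<forall>v\<in>V. f v = f' v}"
  define A where "A = (\<lambda>e v. e (\<phi> v)) ` ?R'"
  have C: "unital_subring C"
    unfolding unital_subring_def
  proof (intro conjI ballI)
    show "1 \<in> C" unfolding C_def by (intro CollectI bexI[OF _ function_algebra.const[of 1]]) simp
    fix f g assume "f \<in> C" "g \<in> C"
    then obtain f' g' where *: "f' \<in> ?R" "g' \<in> ?R" "\<forall>v\<in>V. f v = f' v" "\<forall>v\<in>V. g v = g' v"
      unfolding C_def by blast
    show "f - g \<in> C" unfolding C_def
      by (intro CollectI bexI[OF _ function_algebra_diff[OF *(1,2)]]) (simp add: *)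
    show "f * g \<in> C" unfolding C_def
      by (intro CollectI bexI[OF _ function_algebra.mult[OF *(1,2)]]) (simp add: *)
  qed
  have prime: "prime_on C ?I" by (rule irreducible_set_prime[OF irr]) (simp add: C_def)
  have A: "unital_subring A"
    unfolding unital_subring_def
  proof (intro conjI ballI)
    show "1 \<in> A" unfolding A_def by (rule image_eqI[OF _ function_algebra.const[of 1]]) (simp add: one_fun_def)
    fix f g assume "f \<in> A" "g \<in> A"
    then obtain f' g' where *: "f' \<in> ?R'" "g' \<in> ?R'" "f = (\<lambda>v. f' (\<phi> v))" "g = (\<lambda>v. g' (\<phi> v))"
      by (auto simp: A_def)
    show "f - g \<in> A" unfolding A_def 
      by (rule image_eqI[OF _ function_algebra_diff[OF *(1,2)]]) (simp add: * fun_diff_def)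
    show "f * g \<in> A" unfolding A_def 
      by (rule image_eqI[OF _ function_algebra.mult[OF *(1,2)]]) (simp add: * times_fun_def)
  qed
  have AC: "A \<subseteq> C" unfolding A_def C_def using regular_map_pullback[OF reg] by blast
  have FC: "F \<subseteq> C" unfolding C_def by (auto intro: function_algebra.gen)
  obtain B where B: "unital_subring B" "A \<subseteq> B" "F \<subseteq> B" "B \<subseteq> C" and ext: "\<forall>g\<in>B. g \<notin> ?I \<longrightarrow>
    (\<exists>a\<in>A. a \<notin> ?I \<and> (\<forall>\<chi> :: ('p \<Rightarrow> 'k) \<Rightarrow> 'k. character A ?I \<chi> \<longrightarrow> \<chi> a \<noteq> 0 \<longrightarrow>
      (\<exists>\<chi>'. character B ?I \<chi>' \<and> (\<forall>f\<in>A. \<chi>' f = \<chi> f) \<and> \<chi>' g \<noteq> 0)))"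
    using character_extend[OF assms(1) A C AC FC prime, where 'k = 'k] by (elim exE conjE) (rule that)
  have constA: "(\<lambda>_. c) \<in> A" for c unfolding A_def by (rule image_eqI[OF _ function_algebra.const]) simp
  have RB: "?R \<subseteq> B" using function_algebra_minimal[OF B(1) _ B(3)] constA B(2) by blast
  have "b \<in> B" "b \<notin> ?I" using b RB by (auto simp: vanishing_ideal_def)
  from ext[rule_format, OF this] obtain a where a: "a \<in> A" "a \<notin> ?I" and exta: "\<forall>\<chi> :: ('p \<Rightarrow> 'k) \<Rightarrow> 'k. character A ?I \<chi> \<longrightarrow> \<chi> a \<noteq> 0 \<longrightarrow>
      (\<exists>\<chi>'. character B ?I \<chi>' \<and> (\<forall>f\<in>A. \<chi>' f = \<chi> f) \<and> \<chi>' b \<noteq> 0)"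
    by (elim bexE conjE) (rule that)
  from a(1) obtain e where e: "e \<in> ?R'" "a = (\<lambda>v. e (\<phi> v))" by (auto simp: A_def)
  show ?thesis
  proof (intro bexI[OF _ e(1)] conjI allI impI)
    show "\<exists>v\<in>V. e (\<phi> v) \<noteq> 0" using a(2) by (auto simp: e(2) vanishing_ideal_def)
    fix w assume w: "\<forall>f\<in>?R'. (\<forall>v\<in>V. f (\<phi> v) = 0) \<longrightarrow> f w = 0" "e w \<noteq> 0"
    define \<chi> :: "('p \<Rightarrow> 'k) \<Rightarrow> 'k" where "\<chi> h = (SOME f. f \<in> ?R' \<and> h = (\<lambda>v. f (\<phi> v))) w" for h
    \<comment> \<open>Since \<open>w\<close> satisfies every equation of the image, evaluation at
      \<open>w\<close> depends only on the pullback of a function. This makes the character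
      \<open>\<chi>\<close> on \<open>A\<close> well defined.\<close>
    have eq: "f w = g w" if "f \<in> ?R'" "g \<in> ?R'" "\<forall>v\<in>V. f (\<phi> v) = g (\<phi> v)" for f g
      using w(1) function_algebra_diff[OF that(1,2)] that(3) by fastforce
    have \<chi>: "\<chi> (\<lambda>v. f (\<phi> v)) = f w" if f: "f \<in> ?R'" for f
    proof -
      let ?f = "SOME f'. f' \<in> ?R' \<and> (\<lambda>v. f (\<phi> v)) = (\<lambda>v. f' (\<phi> v))"
      have "?f \<in> ?R' \<and> (\<lambda>v. f (\<phi> v)) = (\<lambda>v. ?f (\<phi> v))" by (rule someI[of _ f]) (simp add: f)
      then have "?f w = f w" using eq[of ?f f] f by metis
      then show ?thesis by (simp add: \<chi>_def)
    qed
    have "character A ?I \<chi>"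
      unfolding character_def
    proof (intro conjI ballI)
      show "\<chi> 1 = 1" using \<chi>[OF function_algebra.const[of 1]] by (simp add: one_fun_def)
      fix f g assume "f \<in> A" "g \<in> A"
      then obtain f' g' where *: "f' \<in> ?R'" "g' \<in> ?R'" "f = (\<lambda>v. f' (\<phi> v))" "g = (\<lambda>v. g' (\<phi> v))"
        by (auto simp: A_def)
      show "\<chi> (f + g) = \<chi> f + \<chi> g"
        using \<chi>[OF function_algebra.add[OF *(1,2)]] \<chi>[OF *(1)] \<chi>[OF *(2)] by (simp add: * plus_fun_def)
      show "\<chi> (f * g) = \<chi> f * \<chi> g"
        using \<chi>[OF function_algebra.mult[OF *(1,2)]] \<chi>[OF *(1)] \<chi>[OF *(2)] by (simp add: * times_fun_def)
    next
      fix f assume "f \<in> A \<inter> ?I"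
      then show "\<chi> f = 0" using \<chi> w(1) by (auto simp: A_def vanishing_ideal_def)
    qed
    moreover have "\<chi> a \<noteq> 0" using \<chi>[OF e(1)] w(2) e(2) by simp
    ultimately obtain \<chi>' where \<chi>': "character B ?I \<chi>'" "\<forall>f\<in>A. \<chi>' f = \<chi> f" "\<chi>' b \<noteq> 0"
      using exta by blast
    have "\<chi>' (\<lambda>_. c) = c" for c
      using \<chi>'(2) constA \<chi>[OF function_algebra.const[of c]] by simp
    moreover have "character ?R ?I \<chi>'" using \<chi>'(1) RB unfolding character_def by blast
    ultimately obtain v where v: "v \<in> V" "\<forall>f\<in>?R. \<chi>' f = f v"
      using aff unfolding affine_set_def by blast
    \<comment> \<open>The point \<open>v\<close> evaluates members of \<open>?R\<close> only, so the
      pullback is first replaced by \<open>f'\<close>, which differs from it by a function vanishing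
      on \<open>V\<close>.\<close>
    have "f (\<phi> v) = f w" if f: "f \<in> ?R'" for f
    proof -
      obtain f' where f': "f' \<in> ?R" "\<forall>v\<in>V. f (\<phi> v) = f' v" using regular_map_pullback[OF reg f] by blast
      have hA: "(\<lambda>v. f (\<phi> v)) \<in> A" using f by (auto simp: A_def)
      have "\<chi>' ((\<lambda>v. f (\<phi> v)) - f') = 0"
        using f'(2) by (intro character_vanish[OF \<chi>'(1)] subring_diff[OF B(1)])
          (use hA B(2) RB f'(1) in \<open>auto simp: vanishing_ideal_def\<close>)
      then have "\<chi>' (\<lambda>v. f (\<phi> v)) = \<chi>' f'"
        using character_diff[OF \<chi>'(1) B(1), of "\<lambda>v. f (\<phi> v)" f'] hA B(2) RB f'(1) by auto
      then show ?thesis using \<chi>'(2) hA \<chi>[OF f] v f' by simp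
    qed
    with v \<chi>'(3) b(1) show "\<exists>v\<in>V. b v \<noteq> 0 \<and> (\<forall>f\<in>?R'. f (\<phi> v) = f w)" by auto
  qed
qed

section \<open>Words in groups and Schur's theorem\<close>

context group
begin

lemma inv_cancel_left: "x \<in> carrier G \<Longrightarrow> y \<in> carrier G \<Longrightarrow> inv x \<otimes> (x \<otimes> y) = y"
  by (simp add: m_assoc[symmetric])

lemma cancel_inv_left: "x \<in> carrier G \<Longrightarrow> y \<in> carrier G \<Longrightarrow> x \<otimes> (inv x \<otimes> y) = y"
  by (simp add: m_assoc[symmetric])

lemmas group_word_simps = m_assoc inv_mult_group inv_cancel_left cancel_inv_left

abbreviation list_mult :: "'a list \<Rightarrow> 'a" where
  "list_mult xs \<equiv> foldr (\<otimes>) xs \<one>"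

lemma list_mult_closed: "set xs \<subseteq> carrier G \<Longrightarrow> list_mult xs \<in> carrier G"
  by (induction xs) auto

lemma list_mult_append:
  "set xs \<subseteq> carrier G \<Longrightarrow> set ys \<subseteq> carrier G \<Longrightarrow> list_mult (xs @ ys) = list_mult xs \<otimes> list_mult ys"
  by (induction xs) (auto simp: m_assoc list_mult_closed)

text \<open>The length is exact, as in \<open>is_product_of_conjugates\<close>;
  \<open>conj_norm\<close> is an infimum, so any one exact length already bounds it.\<close>

definition words :: "'a set \<Rightarrow> nat \<Rightarrow> 'a set" where
  "words U k = {list_mult xs | xs. length xs = k \<and> set xs \<subseteq> U}"

lemma wordsI: "set xs \<subseteq> U \<Longrightarrow> length xs = k \<Longrightarrow> list_mult xs \<in> words U k"
  by (auto simp: words_def)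

lemma wordsE:
  assumes "a \<in> words U k"
  obtains xs where "a = list_mult xs" "length xs = k" "set xs \<subseteq> U"
  using assms by (auto simp: words_def)

lemma words_closed: "U \<subseteq> carrier G \<Longrightarrow> words U k \<subseteq> carrier G"
  by (auto simp: words_def intro!: list_mult_closed)

lemma words_mono: "U \<subseteq> V \<Longrightarrow> words U k \<subseteq> words V k"
  by (auto simp: words_def)

lemma one_words: "\<one> \<in> words U 0"
  using wordsI[of "[]" U 0] by simp

lemma words_one: "U \<subseteq> carrier G \<Longrightarrow> u \<in> U \<Longrightarrow> u \<in> words U 1"
  using wordsI[of "[u]" U 1] by auto

lemma words_mult:
  assumes "U \<subseteq> carrier G" "a \<in> words U i" "b \<in> words U j"
  shows "a \<otimes> b \<in> words U (i + j)"
proof -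
  from assms(2) obtain xs where xs: "a = list_mult xs" "length xs = i" "set xs \<subseteq> U" by (rule wordsE)
  from assms(3) obtain ys where ys: "b = list_mult ys" "length ys = j" "set ys \<subseteq> U" by (rule wordsE)
  have "a \<otimes> b = list_mult (xs @ ys)"
    using list_mult_append[of xs ys] xs ys assms(1) by auto
  then show ?thesis using wordsI[of "xs @ ys" U "i + j"] xs ys by simp
qed

lemma words_Suc:
  assumes "a \<in> words U (Suc k)"
  obtains u b where "a = u \<otimes> b" "u \<in> U" "b \<in> words U k"
proof -
  from assms obtain xs where xs: "a = list_mult xs" "length xs = Suc k" "set xs \<subseteq> U" by (rule wordsE)
  then obtain y ys where "xs = y # ys" by (cases xs) auto
  then show thesis using xs by (intro that[of y "list_mult ys"]) (auto intro: wordsI)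
qed

lemma words_inv:
  assumes U: "U \<subseteq> carrier G" "\<And>u. u \<in> U \<Longrightarrow> inv u \<in> U" and "a \<in> words U k"
  shows "inv a \<in> words U k"
  using assms(3)
proof (induction k arbitrary: a)
  case 0
  then show ?case using one_words by (auto simp: words_def)
next
  case (Suc k)
  then obtain u b where ub: "a = u \<otimes> b" "u \<in> U" "b \<in> words U k" by (elim words_Suc)
  then have "inv a = inv b \<otimes> inv u" using U(1) subsetD[OF words_closed[OF U(1)] ub(3)] by (auto simp: inv_mult_group)
  then show ?case
    using words_mult[OF U(1) Suc.IH[OF ub(3)] words_one[OF U(1) U(2)[OF ub(2)]]] by simp
qed

lemma words_subst:
  assumes U: "U \<subseteq> carrier G" and V: "\<And>v. v \<in> V \<Longrightarrow> v \<in> words U c" and "a \<in> words V k"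
  shows "a \<in> words U (k * c)"
  using assms(3)
proof (induction k arbitrary: a)
  case 0
  then show ?case using one_words by (auto simp: words_def)
next
  case (Suc k)
  then obtain u b where ub: "a = u \<otimes> b" "u \<in> V" "b \<in> words V k" by (elim words_Suc)
  then show ?case using words_mult[OF U V[OF ub(2)] Suc.IH[OF ub(3)]] by simp
qed

lemma words_generate: "U \<subseteq> carrier G \<Longrightarrow> words U k \<subseteq> generate G U"
proof (induction k)
  case 0
  show ?case by (auto simp: words_def generate.one)
next
  case (Suc k)
  then show ?case by (auto elim!: words_Suc intro: generate.eng generate.incl)
qed

lemma generate_words:
  assumes U: "U \<subseteq> carrier G" "\<And>u. u \<in> U \<Longrightarrow> inv u \<in> U" and "a \<in> generate G U"
  shows "\<exists>k. a \<in> words U k"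
  using assms(3)
proof (induction rule: generate.induct)
  case one
  show ?case using one_words by blast
next
  case (incl h)
  then show ?case using words_one[OF U(1)] by blast
next
  case (inv h)
  then show ?case using words_one[OF U(1)] U(2) by blast
next
  case (eng h1 h2)
  then show ?case using words_mult[OF U(1)] by blast
qed

text \<open>Copies of \<open>c\<close> move to the front past other letters, which get conjugated by
  powers of \<open>c\<close> and stay in \<open>D\<close>. The number of letters does not
  change.\<close>

lemma collect_letter:
  assumes D: "D \<subseteq> carrier G" "\<And>g d. g \<in> carrier G \<Longrightarrow> d \<in> D \<Longrightarrow> g \<otimes> d \<otimes> inv g \<in> D"
    and "set xs \<subseteq> D" "k \<le> count_list xs c" "c \<in> D"
  shows "\<exists>b\<in>words D (length xs - k). list_mult xs = c [^] k \<otimes> b"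
  using assms(3,4)
proof (induction xs arbitrary: k)
  case Nil
  then show ?case using one_words by (intro bexI[of _ \<one>]) auto
next
  case (Cons x xs)
  have c: "c \<in> carrier G" and x: "x \<in> D" "x \<in> carrier G" using assms(5) D(1) Cons.prems by auto
  show ?case
  proof (cases "x = c \<and> k \<noteq> 0")
    case True
    then obtain k' where k: "k = Suc k'" "x = c" by (cases k) auto
    then obtain b where b: "b \<in> words D (length xs - k')" "list_mult xs = c [^] k' \<otimes> b"
      using Cons.IH[of k'] Cons.prems by auto
    have "list_mult (x # xs) = c [^] k \<otimes> b"
      using b k c subsetD[OF words_closed[OF D(1)] b(1)] nat_pow_Suc2[OF c, of k']
      by (simp add: m_assoc[symmetric])
    then show ?thesis using b k by auto
  next
    case False
    then have "k \<le> count_list xs c" using Cons.prems(2) by (auto split: if_splits)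
    then obtain b where b: "b \<in> words D (length xs - k)" "list_mult xs = c [^] k \<otimes> b"
      using Cons.IH Cons.prems by auto
    let ?p = "c [^] k"
    have p: "?p \<in> carrier G" "b \<in> carrier G" using c b(1) words_closed[OF D(1)] by auto
    have "list_mult (x # xs) = ?p \<otimes> ((inv ?p \<otimes> x \<otimes> inv (inv ?p)) \<otimes> b)"
      using b(2) p x by (simp add: group_word_simps)
    moreover have "inv ?p \<otimes> x \<otimes> inv (inv ?p) \<in> D" using D(2)[of "inv ?p" x] p x by simp
    then have "(inv ?p \<otimes> x \<otimes> inv (inv ?p)) \<otimes> b \<in> words D (1 + (length xs - k))"
      using words_mult[OF D(1) words_one[OF D(1)] b(1)] by blast
    moreover have "1 + (length xs - k) = length (x # xs) - k"
      using \<open>k \<le> count_list xs c\<close> count_le_length[of xs c] by auto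
    ultimately show ?thesis by metis
  qed
qed

text \<open>If \<open>c = [a, b]\<close> and \<open>c\<^bsup>n\<^esup>\<close> is central, then \<open>c\<^bsup>n+1\<^esup> = [a, b\<^bsup>2\<^esup>] (b c b\<^bsup>-1\<^esup>)\<^bsup>n-1\<^esup>\<close>, so a word with
  more than \<open>n |D|\<close> letters from the finite set \<open>D\<close> of commutators can be shortened.\<close>

lemma derived_finite:
  assumes T: "finite T" "T \<subseteq> carrier G" and Z: "Z \<subseteq> carrier G"
    and central: "\<And>z g. z \<in> Z \<Longrightarrow> g \<in> carrier G \<Longrightarrow> z \<otimes> g = g \<otimes> z"
    and cover: "carrier G \<subseteq> T <#> Z" and pow: "n > 0" "\<And>g. g \<in> carrier G \<Longrightarrow> g [^] (n::nat) \<in> Z"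
  shows "finite (derived G (carrier G))"
proof -
  define D where "D = derived_set G (carrier G)"
  define cm where "cm a b = a \<otimes> b \<otimes> inv a \<otimes> inv b" for a b
  have D: "D \<subseteq> carrier G" by (auto simp: D_def)
  have cmD: "cm a b \<in> D" if "a \<in> carrier G" "b \<in> carrier G" for a b
    using that by (auto simp: D_def cm_def)
  have DE: "\<exists>a\<in>carrier G. \<exists>b\<in>carrier G. d = cm a b" if "d \<in> D" for d
    using that by (auto simp: D_def cm_def)
  have conj_cm: "g \<otimes> cm a b \<otimes> inv g = cm (g \<otimes> a \<otimes> inv g) (g \<otimes> b \<otimes> inv g)"
    if "a \<in> carrier G" "b \<in> carrier G" "g \<in> carrier G" for a b g
    using that by (simp add: cm_def group_word_simps)
  have Dconj: "g \<otimes> d \<otimes> inv g \<in> D" if "g \<in> carrier G" "d \<in> D" for g d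
    using DE[OF that(2)] conj_cm[OF _ _ that(1)] cmD that(1) by auto
  have Dinv: "inv d \<in> D" if "d \<in> D" for d
  proof -
    from DE[OF that] obtain a b where ab: "a \<in> carrier G" "b \<in> carrier G" "d = cm a b" by blast
    then have "inv d = cm b a" by (simp add: cm_def group_word_simps)
    then show ?thesis using cmD ab by simp
  qed
  \<comment> \<open>Central factors cancel in a commutator, so commutators of the finitely many
    representatives already exhaust \<open>D\<close>.\<close>
  have "D \<subseteq> (\<lambda>(s, t). cm s t) ` (T \<times> T)"
  proof
    fix d assume "d \<in> D"
    then obtain a b where ab: "a \<in> carrier G" "b \<in> carrier G" "d = cm a b" using DE by blast
    obtain s y where s: "s \<in> T" "y \<in> Z" "a = s \<otimes> y" using ab(1) cover by (auto simp: set_mult_def)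
    obtain t z where t: "t \<in> T" "z \<in> Z" "b = t \<otimes> z" using ab(2) cover by (auto simp: set_mult_def)
    have [simp]: "s \<in> carrier G" "y \<in> carrier G" "t \<in> carrier G" "z \<in> carrier G" using s t T Z by auto
    have "cm a b = s \<otimes> (y \<otimes> (t \<otimes> z)) \<otimes> inv y \<otimes> inv s \<otimes> inv z \<otimes> inv t"
      by (simp add: cm_def s t group_word_simps)
    also have "y \<otimes> (t \<otimes> z) = t \<otimes> z \<otimes> y" by (rule central[OF s(2)]) simp
    also have "s \<otimes> (t \<otimes> z \<otimes> y) \<otimes> inv y \<otimes> inv s \<otimes> inv z \<otimes> inv t = s \<otimes> t \<otimes> (z \<otimes> inv s) \<otimes> inv z \<otimes> inv t"
      by (simp add: group_word_simps)
    also have "z \<otimes> inv s = inv s \<otimes> z" by (rule central[OF t(2)]) simp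
    also have "s \<otimes> t \<otimes> (inv s \<otimes> z) \<otimes> inv z \<otimes> inv t = cm s t"
      by (simp add: cm_def group_word_simps)
    finally show "d \<in> (\<lambda>(s, t). cm s t) ` (T \<times> T)" using s t ab(3) by auto
  qed
  then have finD: "finite D" using T(1) finite_subset by blast
  have power_word: "c [^] Suc n \<in> words D n" if c: "c \<in> D" for c
  proof -
    obtain a b where ab[simp]: "a \<in> carrier G" "b \<in> carrier G" and c_eq: "c = cm a b" using DE[OF c] by blast
    have cc[simp]: "c \<in> carrier G" using c D by blast
    obtain m where m: "n = Suc m" using pow(1) by (cases n) auto
    \<comment> \<open>Two of the \<open>n + 1\<close> factors of \<open>c\<close> fuse into
      \<open>cm a (b \<otimes> b)\<close>; the other \<open>m = n - 1\<close> survive as conjugates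
      by \<open>b\<close>, so one letter is saved.\<close>
    let ?e = "b \<otimes> c \<otimes> inv b"
    have e_pow: "?e [^] k = b \<otimes> c [^] k \<otimes> inv b" for k :: nat
      by (induction k) (simp_all add: group_word_simps)
    have "c [^] Suc n = c [^] n \<otimes> c" by simp
    also have "\<dots> = c \<otimes> c [^] n" by (rule central) (simp_all add: pow(2))
    also have "\<dots> = a \<otimes> b \<otimes> inv a \<otimes> (inv b \<otimes> c [^] n)" by (simp add: c_eq cm_def group_word_simps)
    also have "inv b \<otimes> c [^] n = c [^] n \<otimes> inv b" using central[OF pow(2)[OF cc], of "inv b"] by simp
    also have "c [^] n = c \<otimes> c [^] m" unfolding m using nat_pow_Suc2[OF cc] by simp
    also have "a \<otimes> b \<otimes> inv a \<otimes> (c \<otimes> c [^] m \<otimes> inv b) = cm a (b \<otimes> b) \<otimes> (b \<otimes> c [^] m \<otimes> inv b)"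
      by (simp add: c_eq cm_def group_word_simps)
    also have "b \<otimes> c [^] m \<otimes> inv b = ?e [^] m" by (simp add: e_pow)
    finally have eq: "c [^] Suc n = cm a (b \<otimes> b) \<otimes> ?e [^] m" .
    have "?e [^] k \<in> words D k" for k :: nat
    proof (induction k)
      case 0
      show ?case using one_words by simp
    next
      case (Suc k)
      then show ?case using words_mult[OF D Suc.IH words_one[OF D Dconj[OF ab(2) c]]] by simp
    qed
    then have "cm a (b \<otimes> b) \<otimes> ?e [^] m \<in> words D (1 + m)"
      by (intro words_mult[OF D] words_one[OF D] cmD) simp_all
    then show ?thesis unfolding eq using m by simp
  qed
  have "derived G (carrier G) \<subseteq> list_mult ` {xs. set xs \<subseteq> D \<and> length xs \<le> card D * n}"
  proof
    fix g assume "g \<in> derived G (carrier G)"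
    then have "\<exists>k. g \<in> words D k" unfolding derived_def D_def[symmetric]
      using generate_words[OF D Dinv] by blast
    then obtain k where k: "g \<in> words D k" and least: "\<And>j. g \<in> words D j \<Longrightarrow> k \<le> j"
      using exists_least_iff[of "\<lambda>k. g \<in> words D k"] by (metis not_le_imp_less)
    from k obtain xs where xs: "g = list_mult xs" "length xs = k" "set xs \<subseteq> D" by (rule wordsE)
    have "k \<le> card D * n"
    proof (rule ccontr)
      assume "\<not> k \<le> card D * n"
      then have "card D * n < (\<Sum>c\<in>D. count_list xs c)"
        using sum_count_set[OF xs(3) finD] xs(2) by simp
      moreover have "(\<Sum>c\<in>D. count_list xs c) \<le> card D * n" if "\<forall>c\<in>D. count_list xs c \<le> n"
        using sum_bounded_above[of D "count_list xs" n] that by simp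
      ultimately obtain c where c: "c \<in> D" "n < count_list xs c" by (meson not_le)
      then obtain b where b: "b \<in> words D (length xs - Suc n)" "g = c [^] Suc n \<otimes> b"
        using collect_letter[OF D Dconj xs(3), of "Suc n" c] xs(1) by auto
      have "g \<in> words D (n + (length xs - Suc n))"
        unfolding b(2) by (rule words_mult[OF D power_word[OF c(1)] b(1)])
      moreover have "Suc n \<le> length xs" using c(2) count_le_length[of xs c] by linarith
      ultimately show False using least[of "n + (length xs - Suc n)"] xs(2) by linarith
    qed
    then show "g \<in> list_mult ` {xs. set xs \<subseteq> D \<and> length xs \<le> card D * n}" using xs by blast
  qed
  then show ?thesis using finite_lists_length_le[OF finD] finite_subset by blast
qed

text \<open>In a shortest word representing the coset of \<open>g\<close>, the prefixes lie in
  distinct cosets: a repetition would allow the segment between two prefixes to be cut out.\<close>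

lemma words_rcosets:
  assumes H: "subgroup H G" and fin: "finite (rcosets H)"
    and U: "U \<subseteq> carrier G" and g: "g \<in> words U k"
  shows "\<exists>j < card (rcosets H). \<exists>b\<in>words U j. \<exists>h\<in>H. g = h \<otimes> b"
proof -
  note Hc = subgroup.subset[OF H]
  define P where "P j \<longleftrightarrow> (\<exists>b\<in>words U j. \<exists>h\<in>H. g = h \<otimes> b)" for j
  have gc: "g \<in> carrier G" using g words_closed[OF U] by blast
  have "P k" unfolding P_def
    using g gc subgroup.one_closed[OF H] by (intro bexI[of _ g] bexI[of _ \<one>]) auto
  then obtain j where j: "P j" and least: "\<And>i. P i \<Longrightarrow> j \<le> i"
    using exists_least_iff[of P] by (metis not_le_imp_less)
  from j obtain b h where b: "b \<in> words U j" and h: "h \<in> H" "g = h \<otimes> b" by (auto simp: P_def)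
  from b obtain xs where xs: "b = list_mult xs" "length xs = j" "set xs \<subseteq> U" by (rule wordsE)
  have xc: "set xs \<subseteq> carrier G" "set (take i xs) \<subseteq> carrier G" "set (drop i xs) \<subseteq> carrier G" for i
    using xs(3) U set_take_subset[of i xs] set_drop_subset[of i xs] by auto
  let ?p = "\<lambda>i. list_mult (take i xs)" and ?q = "\<lambda>i. list_mult (drop i xs)"
  have pq[simp]: "?p i \<in> carrier G" "?q i \<in> carrier G" for i by (auto intro!: list_mult_closed xc)
  have split: "b = ?p i \<otimes> ?q i" for i
    using list_mult_append[OF xc(2,3), of i i] xs(1) by simp
  have inj: "inj_on (\<lambda>i. H #> ?p i) {..j}"
  proof (rule linorder_inj_onI)
    fix i l assume il: "i < l" "i \<in> {..j}" "l \<in> {..j}"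
    show "H #> ?p i \<noteq> H #> ?p l"
    proof
      assume "H #> ?p i = H #> ?p l"
      then have "?p l \<in> H #> ?p i" using rcos_self[OF _ H] pq by metis
      then obtain h' where h': "h' \<in> H" "?p l = h' \<otimes> ?p i" by (auto simp: r_coset_def)
      have hc: "h \<in> carrier G" "h' \<in> carrier G" using h(1) h'(1) Hc by auto
      have "b = h' \<otimes> (?p i \<otimes> ?q l)" using split[of l] h'(2) hc by (simp add: m_assoc)
      then have "g = (h \<otimes> h') \<otimes> (?p i \<otimes> ?q l)" using h(2) hc by (simp add: m_assoc)
      moreover have "?p i \<otimes> ?q l \<in> words U (i + (j - l))"
        using il xs set_take_subset[of i xs] set_drop_subset[of l xs]
        by (intro words_mult[OF U] wordsI) auto
      ultimately have "P (i + (j - l))"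
        unfolding P_def using subgroup.m_closed[OF H h(1) h'(1)] by blast
      with least[of "i + (j - l)"] il show False by auto
    qed
  qed auto
  have "(\<lambda>i. H #> ?p i) ` {..j} \<subseteq> rcosets H"
    using rcosetsI[OF Hc pq(1)] by (rule image_subsetI)
  \<comment> \<open>A word of length \<open>j\<close> has \<open>j + 1\<close> prefixes including
    the empty one, whence the strict bound.\<close>
  then have "card {..j} \<le> card (rcosets H)" using card_inj_on_le[OF inj _ fin] by blast
  then have "j < card (rcosets H)" by simp
  with b h show ?thesis by blast
qed

section \<open>Finite index and central quotients\<close>

lemma rcosets_representatives:
  assumes H: "subgroup H G" and fin: "finite (rcosets H)"
  shows "\<exists>T\<subseteq>carrier G. finite T \<and> (\<forall>g\<in>carrier G. \<exists>h\<in>H. \<exists>t\<in>T. g = h \<otimes> t)"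
proof -
  define rep where "rep C = (SOME g. g \<in> carrier G \<and> C = H #> g)" for C
  have rep: "rep C \<in> carrier G \<and> C = H #> rep C" if "C \<in> rcosets H" for C
    unfolding rep_def by (rule someI_ex) (use that in \<open>auto simp: RCOSETS_def\<close>)
  have "\<exists>h\<in>H. \<exists>t\<in>rep ` (rcosets H). g = h \<otimes> t" if g: "g \<in> carrier G" for g
  proof -
    have C: "H #> g \<in> rcosets H" by (rule rcosetsI[OF subgroup.subset[OF H] g])
    have "g \<in> H #> rep (H #> g)" using rcos_self[OF g H] rep[OF C] by simp
    then show ?thesis using C by (auto simp: r_coset_def)
  qed
  then show ?thesis using rep fin by (intro exI[of _ "rep ` (rcosets H)"]) auto
qed

lemma finite_rcosets_if_cover:
  assumes H: "subgroup H G" and T: "finite T" "T \<subseteq> carrier G"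
    and cover: "\<And>g. g \<in> carrier G \<Longrightarrow> \<exists>h\<in>H. \<exists>t\<in>T. g = h \<otimes> t"
  shows "finite (rcosets H)"
proof (rule finite_subset)
  show "rcosets H \<subseteq> (\<lambda>t. H #> t) ` T"
  proof
    fix C assume "C \<in> rcosets H"
    then obtain g where g: "g \<in> carrier G" "C = H #> g" by (auto simp: RCOSETS_def)
    obtain h t where ht: "h \<in> H" "t \<in> T" "g = h \<otimes> t" using cover[OF g(1)] by blast
    then have "g \<in> H #> t" by (auto simp: r_coset_def)
    then have "C = H #> t" using repr_independence[OF _ _ H, of g t] ht(2) T(2) g(2) by auto
    then show "C \<in> (\<lambda>t. H #> t) ` T" using ht(2) by blast
  qed
qed (use T in simp)

text \<open>In \<open>G Mod N\<close> the image of \<open>H\<close> is central of finite index, so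
  the derived subgroup of the quotient is finite by Schur's theorem. It also has finite index,
  inherited from the derived subgroup of \<open>G\<close>.\<close>

lemma finite_rcosets_central_quotient:
  assumes N: "N \<lhd> G" and H: "H \<lhd> G" and fin: "finite (rcosets H)"
    and fin_derived: "finite (rcosets (derived G (carrier G)))"
    and central: "\<And>g h. g \<in> carrier G \<Longrightarrow> h \<in> H \<Longrightarrow> inv g \<otimes> h \<otimes> g \<otimes> inv h \<in> N"
  shows "finite (rcosets N)"
proof -
  interpret N: normal N G by (rule N)
  interpret H: normal H G by (rule H)
  let ?Q = "G Mod N" and ?\<pi> = "\<lambda>g. N #> g"
  interpret Q: group ?Q by (rule N.factorgroup_is_group)
  interpret GH: group "G Mod H" by (rule H.factorgroup_is_group)
  interpret \<pi>: group_hom G ?Q ?\<pi>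
    by unfold_locales (rule N.r_coset_hom_Mod)
  interpret \<pi>H: group_hom G "G Mod H" "\<lambda>g. H #> g"
    by unfold_locales (rule H.r_coset_hom_Mod)
  note Hs = H.subgroup_axioms and Ns = N.subgroup_axioms
  have carrier_Q: "carrier ?Q = ?\<pi> ` carrier G" by (auto simp: FactGroup_def RCOSETS_def)
  obtain T where T: "T \<subseteq> carrier G" "finite T" "\<And>g. g \<in> carrier G \<Longrightarrow> \<exists>h\<in>H. \<exists>t\<in>T. g = h \<otimes> t"
    using rcosets_representatives[OF Hs fin] by blast
  have comm: "?\<pi> h \<otimes>\<^bsub>?Q\<^esub> ?\<pi> g = ?\<pi> g \<otimes>\<^bsub>?Q\<^esub> ?\<pi> h" if h: "h \<in> H" and g: "g \<in> carrier G" for h g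
  proof -
    have hc: "h \<in> carrier G" using h H.subset by blast
    have "inv (inv g) \<otimes> h \<otimes> inv g \<otimes> inv h \<in> N" using central[OF inv_closed[OF g] h] .
    then have n: "g \<otimes> h \<otimes> inv g \<otimes> inv h \<in> N" using g by simp
    have "g \<otimes> h = (g \<otimes> h \<otimes> inv g \<otimes> inv h) \<otimes> (h \<otimes> g)" using g hc by (simp add: group_word_simps)
    with n have "g \<otimes> h \<in> N #> (h \<otimes> g)" by (auto simp: r_coset_def)
    then have "?\<pi> (h \<otimes> g) = ?\<pi> (g \<otimes> h)" using repr_independence[OF _ _ Ns] g hc by blast
    then show ?thesis using \<pi>.hom_mult[OF g hc] \<pi>.hom_mult[OF hc g] by (simp only:)
  qed
  have "finite (derived ?Q (carrier ?Q))"
  proof (rule Q.derived_finite[of "?\<pi> ` T" "?\<pi> ` H" "card (rcosets H)"])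
    show "finite (?\<pi> ` T)" using T by simp
    show "?\<pi> ` T \<subseteq> carrier ?Q" "?\<pi> ` H \<subseteq> carrier ?Q" using T(1) H.subset carrier_Q by auto
    show "z \<otimes>\<^bsub>?Q\<^esub> q = q \<otimes>\<^bsub>?Q\<^esub> z" if z: "z \<in> ?\<pi> ` H" and q: "q \<in> carrier ?Q" for z q
    proof -
      from z obtain h where h: "h \<in> H" "z = ?\<pi> h" by blast
      from q obtain g where g: "g \<in> carrier G" "q = ?\<pi> g" unfolding carrier_Q by blast
      show ?thesis unfolding h(2) g(2) by (rule comm[OF h(1) g(1)])
    qed
    show "carrier ?Q \<subseteq> ?\<pi> ` T <#>\<^bsub>?Q\<^esub> ?\<pi> ` H"
    proof
      fix q assume "q \<in> carrier ?Q"
      then obtain g where g: "g \<in> carrier G" "q = ?\<pi> g" unfolding carrier_Q by blast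
      obtain h t where ht: "h \<in> H" "t \<in> T" "g = h \<otimes> t" using T(3)[OF g(1)] by blast
      then have c: "h \<in> carrier G" "t \<in> carrier G" using T(1) H.subset by auto
      have "q = ?\<pi> h \<otimes>\<^bsub>?Q\<^esub> ?\<pi> t" unfolding g(2) ht(3) by (rule \<pi>.hom_mult[OF c])
      also have "\<dots> = ?\<pi> t \<otimes>\<^bsub>?Q\<^esub> ?\<pi> h" by (rule comm[OF ht(1) c(2)])
      finally have "q = ?\<pi> t \<otimes>\<^bsub>?Q\<^esub> ?\<pi> h" .
      then show "q \<in> ?\<pi> ` T <#>\<^bsub>?Q\<^esub> ?\<pi> ` H" unfolding set_mult_def using ht by blast
    qed
    \<comment> \<open>The order of \<open>G Mod H\<close> serves as the exponent that sends the
      quotient into the central image of \<open>H\<close>.\<close>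
    have "rcosets H \<noteq> {}" using rcosetsI[OF H.subset one_closed] by blast
    then show "card (rcosets H) > 0" using fin by (simp add: card_gt_0_iff)
    show "q [^]\<^bsub>?Q\<^esub> card (rcosets H) \<in> ?\<pi> ` H" if "q \<in> carrier ?Q" for q
    proof -
      from that obtain g where g: "g \<in> carrier G" "q = ?\<pi> g" unfolding carrier_Q by blast
      have gH: "H #> g \<in> carrier (G Mod H)" using g(1) by (rule \<pi>H.hom_closed)
      have "(H #> g) [^]\<^bsub>G Mod H\<^esub> Coset.order (G Mod H) = \<one>\<^bsub>G Mod H\<^esub>" by (rule GH.pow_order_eq_1[OF gH])
      moreover have "Coset.order (G Mod H) = card (rcosets H)" by (simp add: Coset.order_def FactGroup_def)
      moreover have "\<one>\<^bsub>G Mod H\<^esub> = H" by (simp add: FactGroup_def)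
      ultimately have "H #> (g [^] card (rcosets H)) = H"
        by (metis \<pi>H.hom_nat_pow[OF g(1)])
      then have "g [^] card (rcosets H) \<in> H" using coset_join1[OF _ _ Hs] g(1) by simp
      moreover have "q [^]\<^bsub>?Q\<^esub> card (rcosets H) = ?\<pi> (g [^] card (rcosets H))"
        unfolding g(2) by (rule \<pi>.hom_nat_pow[OF g(1), symmetric])
      ultimately show ?thesis by (simp only: imageI)
    qed
  qed
  moreover have "derived ?Q (carrier ?Q) = ?\<pi> ` derived G (carrier G)"
    unfolding carrier_Q by (rule \<pi>.derived_img) simp
  ultimately have fin_img: "finite (?\<pi> ` derived G (carrier G))" by simp
  \<comment> \<open>Finitely many translates of the finite image of the derived subgroup cover the
    quotient.\<close>
  obtain A where A: "A \<subseteq> carrier G" "finite A"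
    "\<And>g. g \<in> carrier G \<Longrightarrow> \<exists>d\<in>derived G (carrier G). \<exists>a\<in>A. g = d \<otimes> a"
    using rcosets_representatives[OF derived_is_subgroup fin_derived] by auto
  have "carrier ?Q \<subseteq> (\<lambda>(x, a). x \<otimes>\<^bsub>?Q\<^esub> ?\<pi> a) ` (?\<pi> ` derived G (carrier G) \<times> A)"
  proof
    fix q assume "q \<in> carrier ?Q"
    then obtain g where g: "g \<in> carrier G" "q = ?\<pi> g" unfolding carrier_Q by blast
    obtain d a where da: "d \<in> derived G (carrier G)" "a \<in> A" "g = d \<otimes> a" using A(3)[OF g(1)] by blast
    have "d \<in> carrier G" using da(1) derived_in_carrier[of "carrier G"] by blast
    moreover have "a \<in> carrier G" using da(2) A(1) by blast
    ultimately have "q = ?\<pi> d \<otimes>\<^bsub>?Q\<^esub> ?\<pi> a" unfolding g(2) da(3) by (rule \<pi>.hom_mult)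
    then show "q \<in> (\<lambda>(x, a). x \<otimes>\<^bsub>?Q\<^esub> ?\<pi> a) ` (?\<pi> ` derived G (carrier G) \<times> A)"
      using da(1,2) by blast
  qed
  then have "finite (carrier ?Q)" using fin_img A(2) by (meson finite_SigmaI finite_imageI finite_subset)
  then show ?thesis by (simp add: FactGroup_def)
qed

end

section \<open>Affine algebraic groups\<close>

text \<open>Coordinates on an abstract group, with no matrices in sight. \<open>separates\<close>
  turns equality of coordinates into equality of points, and \<open>affine\<close> supplies points
  from characters; together they make closures and images of regular maps tractable.\<close>

locale affine_algebraic_group = group G for G (structure) +
  fixes F :: "('a \<Rightarrow> 'k::alg_closed_field) set"
  assumes finite_gens: "finite F"
    and separates: "x \<in> carrier G \<Longrightarrow> y \<in> carrier G \<Longrightarrow> (\<And>f. f \<in> F \<Longrightarrow> f x = f y) \<Longrightarrow> x = y"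
    and affine: "affine_set F (carrier G)"
    and mult_regular: "regular_map (product_gens F F) (carrier G \<times> carrier G) F (\<lambda>p. fst p \<otimes> snd p)"
    and inv_regular: "regular_map F (carrier G) F (\<lambda>x. inv x)"
begin

abbreviation "cl \<equiv> closure_in F (carrier G)"

lemma regular_mult:
  assumes "regular_map F' X F \<phi>" "regular_map F' X F \<psi>" "\<phi> ` X \<subseteq> carrier G" "\<psi> ` X \<subseteq> carrier G"
  shows "regular_map F' X F (\<lambda>x. \<phi> x \<otimes> \<psi> x)"
  using regular_map_comp[OF regular_map_pair[OF assms(1,2)] mult_regular] assms(3,4) by auto

lemma regular_inv:
  assumes "regular_map F' X F \<phi>" "\<phi> ` X \<subseteq> carrier G"
  shows "regular_map F' X F (\<lambda>x. inv (\<phi> x))"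
  using regular_map_comp[OF assms(1) inv_regular assms(2)] .

lemma regular_conj:
  "a \<in> carrier G \<Longrightarrow> regular_map F (carrier G) F (\<lambda>x. a \<otimes> x \<otimes> inv a)"
  by (intro regular_mult regular_map_const regular_map_id) auto

lemma regular_commutator:
  "t \<in> carrier G \<Longrightarrow> regular_map F (carrier G) F (\<lambda>x. inv t \<otimes> x \<otimes> t \<otimes> inv x)"
  by (intro regular_mult regular_inv regular_map_const regular_map_id) auto

lemma regular_left: "a \<in> carrier G \<Longrightarrow> regular_map F (carrier G) F (\<lambda>x. a \<otimes> x)"
  by (intro regular_mult regular_map_const regular_map_id) auto

lemma regular_right: "a \<in> carrier G \<Longrightarrow> regular_map F (carrier G) F (\<lambda>x. x \<otimes> a)"
  by (intro regular_mult regular_map_const regular_map_id) auto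

text \<open>Continuity of regular maps, in pointwise form: an equation of \<open>Y\<close> pulls
  back to an equation of \<open>Z\<close>.\<close>

lemma closure_image:
  assumes reg: "regular_map F (carrier G) F \<phi>" and "w \<in> cl Z" "\<phi> w \<in> carrier G" "Z \<subseteq> carrier G"
    and sub: "\<phi> ` Z \<subseteq> cl Y"
  shows "\<phi> w \<in> cl Y"
  unfolding closure_in_def
proof (intro CollectI conjI ballI impI assms(3))
  fix f assume f: "f \<in> function_algebra F" "\<forall>z\<in>Y. f z = 0"
  obtain f' where f': "f' \<in> function_algebra F" "\<forall>x\<in>carrier G. f (\<phi> x) = f' x"
    using regular_map_pullback[OF reg f(1)] by (rule bexE)
  have "f' z = 0" if "z \<in> Z" for z
  proof -
    have "f (\<phi> z) = 0" using closure_in_vanish[OF f] sub that by blast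
    then show ?thesis using f'(2) that assms(4) by auto
  qed
  then have "f' w = 0" using closure_in_vanish[OF f'(1)] assms(2) by blast
  then show "f (\<phi> w) = 0" using f'(2) assms(2) closure_in_subset[of F "carrier G" Z] by auto
qed

lemma irreducible_translate_image:
  assumes "irreducible_set F A" "A \<subseteq> carrier G" "regular_map F (carrier G) F \<phi>"
  shows "irreducible_set F (\<phi> ` A)"
  by (rule irreducible_set_image[OF assms(1) regular_map_subset[OF assms(3,2)]])

lemma irreducible_set_mult:
  assumes "irreducible_set F A" "irreducible_set F B" "A \<subseteq> carrier G" "B \<subseteq> carrier G"
  shows "irreducible_set F (A <#> B)"
proof -
  have "A <#> B = (\<lambda>p. fst p \<otimes> snd p) ` (A \<times> B)" unfolding set_mult_def by force
  moreover have "regular_map (product_gens F F) (A \<times> B) F (\<lambda>p. fst p \<otimes> snd p)"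
    using assms(3,4) by (intro regular_map_subset[OF mult_regular]) auto
  ultimately show ?thesis
    using irreducible_set_image[OF irreducible_set_product[OF assms(1,2)]] by simp
qed

section \<open>The identity component\<close>

lemma irreducible_singleton: "irreducible_set F {a}"
  by (rule irreducible_setI) auto

text \<open>The union runs over all irreducible sets through the identity, closed or not. Any
  regular map of the group fixing the identity then visibly preserves it.\<close>

definition identity_component :: "'a set" where
  "identity_component = \<Union>{A. A \<subseteq> carrier G \<and> irreducible_set F A \<and> \<one> \<in> A}"

abbreviation (input) "G0 \<equiv> identity_component"

lemma identity_component_carrier: "G0 \<subseteq> carrier G"
  by (auto simp: identity_component_def)

lemma irreducible_subset_G0:
  "A \<subseteq> carrier G \<Longrightarrow> irreducible_set F A \<Longrightarrow> \<one> \<in> A \<Longrightarrow> A \<subseteq> G0"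
  by (auto simp: identity_component_def)

lemma one_G0: "\<one> \<in> G0"
  using irreducible_subset_G0[OF _ irreducible_singleton, of \<one>] by auto

text \<open>Two irreducible sets through the identity both lie in their product set. That product is
  irreducible as an image of a product of irreducible sets, and it again contains the
  identity.\<close>

lemma irreducible_G0: "irreducible_set F G0"
proof (rule irreducible_setI)
  show "G0 \<noteq> {}" using one_G0 by auto
  fix f g x y
  assume fg: "f \<in> function_algebra F" "g \<in> function_algebra F" and xy: "x \<in> G0" "f x \<noteq> 0" "y \<in> G0" "g y \<noteq> 0"
  obtain A where A: "A \<subseteq> carrier G" "irreducible_set F A" "\<one> \<in> A" "x \<in> A"
    using xy(1) by (auto simp: identity_component_def)
  obtain B where B: "B \<subseteq> carrier G" "irreducible_set F B" "\<one> \<in> B" "y \<in> B"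
    using xy(3) by (auto simp: identity_component_def)
  have irr: "irreducible_set F (A <#> B)" by (rule irreducible_set_mult[OF A(2) B(2) A(1) B(1)])
  have "x \<otimes> \<one> \<in> A <#> B" "\<one> \<otimes> y \<in> A <#> B" "\<one> \<otimes> \<one> \<in> A <#> B"
    using A B unfolding set_mult_def by blast+
  then have "x \<in> A <#> B" "y \<in> A <#> B" "\<one> \<in> A <#> B" using A(1,4) B(1,4) by auto
  moreover have "A <#> B \<subseteq> G0"
    using calculation(3) set_mult_closed[OF A(1) B(1)] by (intro irreducible_subset_G0 irr)
  ultimately show "\<exists>z\<in>G0. f z \<noteq> 0 \<and> g z \<noteq> 0"
    using irreducible_setD[OF irr fg] xy(2,4) by blast
qed

lemma image_G0:
  assumes "regular_map F (carrier G) F \<phi>" "\<phi> ` carrier G \<subseteq> carrier G" "\<phi> \<one> = \<one>"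
  shows "\<phi> ` G0 \<subseteq> G0"
proof (rule irreducible_subset_G0)
  show "\<phi> ` G0 \<subseteq> carrier G" using assms(2) identity_component_carrier by blast
  show "irreducible_set F (\<phi> ` G0)"
    by (rule irreducible_translate_image[OF irreducible_G0 identity_component_carrier assms(1)])
  show "\<one> \<in> \<phi> ` G0" using one_G0 assms(3) by (metis imageI)
qed

lemma subgroup_G0: "subgroup G0 G"
proof (rule subgroupI)
  show "G0 \<subseteq> carrier G" "G0 \<noteq> {}" using identity_component_carrier one_G0 by auto
  show "inv a \<in> G0" if "a \<in> G0" for a
    using image_G0[OF inv_regular] that by auto
  show "a \<otimes> b \<in> G0" if "a \<in> G0" "b \<in> G0" for a b
  proof -
    have "\<one> \<otimes> \<one> \<in> G0 <#> G0" unfolding set_mult_def using one_G0 by blast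
    then have "G0 <#> G0 \<subseteq> G0"
      using irreducible_set_mult[OF irreducible_G0 irreducible_G0] identity_component_carrier
      by (intro irreducible_subset_G0 set_mult_closed) auto
    then show ?thesis unfolding set_mult_def using that by blast
  qed
qed

lemma conj_G0: "g \<in> carrier G \<Longrightarrow> x \<in> G0 \<Longrightarrow> g \<otimes> x \<otimes> inv g \<in> G0"
  using image_G0[OF regular_conj[of g]] by auto

lemma normal_G0: "G0 \<lhd> G"
  by (rule normal_invI[OF subgroup_G0 conj_G0])

lemma closed_G0: "cl G0 = G0"
proof
  show "G0 \<subseteq> cl G0" by (rule subset_closure_in[OF identity_component_carrier])
  with one_G0 show "cl G0 \<subseteq> G0"
    by (intro irreducible_subset_G0 closure_in_subset irreducible_closure_in irreducible_G0
        identity_component_carrier) auto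
qed

text \<open>Translating an irreducible piece of \<open>carrier G\<close> by the inverse of one of
  its points moves it into \<open>G0\<close>. Finitely many pieces thus give finitely many
  cosets.\<close>

lemma finite_index_G0: "finite (rcosets G0)"
proof -
  obtain \<C> where \<C>: "finite \<C>" "\<Union>\<C> = carrier G" "\<And>C. C \<in> \<C> \<Longrightarrow> irreducible_set F C"
    using finite_irreducible_decomposition[OF finite_gens, of "carrier G"] by metis
  define rep where "rep C = (SOME c. c \<in> C)" for C :: "'a set"
  have rep: "rep C \<in> C" if "C \<in> \<C>" for C
    unfolding rep_def using \<C>(3)[OF that] by (auto simp: irreducible_set_def intro: some_in_eq[THEN iffD2])
  show ?thesis
  proof (rule finite_rcosets_if_cover[OF subgroup_G0, of "rep ` \<C>"])
    show "finite (rep ` \<C>)" using \<C>(1) by simp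
    show "rep ` \<C> \<subseteq> carrier G" using rep \<C>(2) by auto
    fix g assume g: "g \<in> carrier G"
    then obtain C where C: "C \<in> \<C>" "g \<in> C" using \<C>(2) by blast
    have c: "rep C \<in> carrier G" "C \<subseteq> carrier G" using rep[OF C(1)] C(1) \<C>(2) by auto
    let ?\<phi> = "\<lambda>x. x \<otimes> inv (rep C)"
    have "?\<phi> ` C \<subseteq> G0"
    proof (rule irreducible_subset_G0)
      show "?\<phi> ` C \<subseteq> carrier G" using c by auto
      show "irreducible_set F (?\<phi> ` C)"
        by (rule irreducible_translate_image[OF \<C>(3)[OF C(1)] c(2)]) (simp add: regular_right c(1))
      show "\<one> \<in> ?\<phi> ` C" using rep[OF C(1)] c(1) by (metis image_eqI r_inv)
    qed
    then have "g \<otimes> inv (rep C) \<in> G0" using C(2) by blast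
    moreover have "g = (g \<otimes> inv (rep C)) \<otimes> rep C" using g c(1) by (simp add: m_assoc)
    ultimately show "\<exists>h\<in>G0. \<exists>t\<in>rep ` \<C>. g = h \<otimes> t" using C(1) by blast
  qed
qed

section \<open>Products of images of irreducible sets\<close>

text \<open>What remains of constructibility: an irreducible set containing a nonempty principal
  open subset of its closure.\<close>

definition good :: "'a set \<Rightarrow> bool" where
  "good Z \<longleftrightarrow> Z \<subseteq> carrier G \<and> irreducible_set F Z \<and>
    (\<exists>e\<in>function_algebra F. (\<exists>z\<in>Z. e z \<noteq> 0) \<and> (\<forall>w\<in>cl Z. e w \<noteq> 0 \<longrightarrow> w \<in> Z))"

lemma goodE:
  assumes "good Z"
  obtains e where "e \<in> function_algebra F" "\<exists>z\<in>Z. e z \<noteq> 0" "\<forall>w\<in>cl Z. e w \<noteq> 0 \<longrightarrow> w \<in> Z"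
  using assms unfolding good_def by blast

text \<open>\<open>Z\<close> lies between the image of the open set where \<open>b\<close> is
  nonzero and the image of all of \<open>V\<close>. The lower inclusion gives an open part of the
  closure, the upper one bounds the closure.\<close>

lemma good_imageI:
  fixes F' :: "('p \<Rightarrow> 'k) set"
  assumes F': "finite F'" and V: "irreducible_set F' V" "affine_set F' V"
    and reg: "regular_map F' V F \<phi>" and \<phi>: "\<phi> ` V \<subseteq> carrier G"
    and b: "b \<in> function_algebra F'" "v0 \<in> V" "b v0 \<noteq> 0"
    and Z: "Z \<subseteq> \<phi> ` V" "\<And>v. v \<in> V \<Longrightarrow> b v \<noteq> 0 \<Longrightarrow> \<phi> v \<in> Z" "irreducible_set F Z"
  shows "good Z"
proof -
  obtain e where e0: "e \<in> function_algebra F" and ex: "(\<exists>v\<in>V. e (\<phi> v) \<noteq> 0) \<and> (\<forall>w. (\<forall>f\<in>function_algebra F. (\<forall>v\<in>V. f (\<phi> v) = 0) \<longrightarrow> f w = 0) \<longrightarrow> e w \<noteq> 0 \<longrightarrow>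
      (\<exists>v\<in>V. b v \<noteq> 0 \<and> (\<forall>f\<in>function_algebra F. f (\<phi> v) = f w)))"
    using image_contains_open[OF F' V reg b] by (rule bexE)
  have e: "\<exists>v\<in>V. e (\<phi> v) \<noteq> 0"
    and open_all: "\<forall>w. (\<forall>f\<in>function_algebra F. (\<forall>v\<in>V. f (\<phi> v) = 0) \<longrightarrow> f w = 0) \<longrightarrow> e w \<noteq> 0 \<longrightarrow>
      (\<exists>v\<in>V. b v \<noteq> 0 \<and> (\<forall>f\<in>function_algebra F. f (\<phi> v) = f w))"
    by (rule conjunct1[OF ex], rule conjunct2[OF ex])
  note open_e = mp[OF mp[OF spec[OF open_all]]]
  obtain e' where e': "e' \<in> function_algebra F'" "\<forall>v\<in>V. e (\<phi> v) = e' v"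
    using regular_map_pullback[OF reg e0] by (rule bexE)
  from e obtain v1 where "v1 \<in> V" "e (\<phi> v1) \<noteq> 0" by (rule bexE)
  then have v1: "v1 \<in> V" "e' v1 \<noteq> 0" using e'(2) by simp_all
  \<comment> \<open>The point where \<open>e\<close> is known to be nonzero might come from a zero
    of \<open>b\<close>; irreducibility of \<open>V\<close> provides one avoiding both zero sets, so
    that \<open>e\<close> is nonzero somewhere on \<open>Z\<close>.\<close>
  obtain v where v: "v \<in> V" "b v \<noteq> 0" "e' v \<noteq> 0"
    using irreducible_setD[OF V(1) b(1) e'(1) b(2,3) v1] by (elim bexE conjE)
  have "e (\<phi> v) \<noteq> 0" using v(1,3) e'(2) by simp
  then have "\<exists>z\<in>Z. e z \<noteq> 0" using Z(2)[OF v(1,2)] by (rule bexI)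
  moreover have "w \<in> Z" if w: "w \<in> cl Z" "e w \<noteq> 0" for w
  proof -
    have "f w = 0" if f: "f \<in> function_algebra F" "\<forall>v\<in>V. f (\<phi> v) = 0" for f
    proof (rule closure_in_vanish[OF f(1) _ w(1)])
      show "\<forall>z\<in>Z. f z = 0" using f(2) Z(1) by auto
    qed
    then have "\<exists>v\<in>V. b v \<noteq> 0 \<and> (\<forall>f\<in>function_algebra F. f (\<phi> v) = f w)"
      using w(2) by (intro open_e ballI impI)
    then obtain u where u: "u \<in> V" "b u \<noteq> 0" "\<forall>f\<in>function_algebra F. f (\<phi> u) = f w"
      by (elim bexE conjE)
    have "\<phi> u = w"
    proof (rule separates)
      show "\<phi> u \<in> carrier G" using \<phi> u(1) by blast
      show "w \<in> carrier G" by (rule subsetD[OF closure_in_subset w(1)])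
      show "f (\<phi> u) = f w" if "f \<in> F" for f by (rule bspec[OF u(3) function_algebra.gen[OF that]])
    qed
    then show ?thesis using Z(2)[OF u(1,2)] by simp
  qed
  moreover have "Z \<subseteq> carrier G" using Z(1) \<phi> by blast
  ultimately show ?thesis unfolding good_def
    by (intro conjI bexI[OF _ e0] ballI impI Z(3))
qed

lemma good_singleton: "a \<in> carrier G \<Longrightarrow> good {a}"
proof -
  assume a: "a \<in> carrier G"
  have "w = a" if w: "w \<in> cl {a}" for w
  proof (rule separates)
    show "w \<in> carrier G" by (rule subsetD[OF closure_in_subset w])
    fix f assume "f \<in> F"
    then have "(\<lambda>x. f x - f a) \<in> function_algebra F"
      by (intro function_algebra_diff function_algebra.gen function_algebra.const)
    from closure_in_vanish[OF this _ w] show "f w = f a" by simp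
  qed (rule a)
  then show ?thesis unfolding good_def using a irreducible_singleton
    by (intro conjI bexI[OF _ function_algebra.const[of 1]]) auto
qed

text \<open>Multiplication is studied on the product of the closures, which is affine even when
  \<open>A \<times> B\<close> is not known to be. The product of the functions for \<open>A\<close>
  and \<open>B\<close> marks an open part lying inside \<open>A \<times> B\<close>.\<close>

lemma good_mult:
  assumes A: "good A" and B: "good B"
  shows "good (A <#> B)"
proof -
  obtain e where e: "e \<in> function_algebra F" "\<exists>z\<in>A. e z \<noteq> 0" "\<forall>w\<in>cl A. e w \<noteq> 0 \<longrightarrow> w \<in> A"
    by (rule goodE[OF A])
  obtain d where d: "d \<in> function_algebra F" "\<exists>z\<in>B. d z \<noteq> 0" "\<forall>w\<in>cl B. d w \<noteq> 0 \<longrightarrow> w \<in> B"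
    by (rule goodE[OF B])
  have A': "A \<subseteq> carrier G" "irreducible_set F A" and B': "B \<subseteq> carrier G" "irreducible_set F B"
    using A B by (auto simp: good_def)
  let ?V = "cl A \<times> cl B" and ?F = "product_gens F F" and ?m = "\<lambda>p. fst p \<otimes> snd p"
  have sub: "A \<subseteq> cl A" "B \<subseteq> cl B" using subset_closure_in A'(1) B'(1) by auto
  have V: "?V \<subseteq> carrier G \<times> carrier G" by (intro Sigma_mono closure_in_subset)
  obtain e' where e': "e' \<in> function_algebra ?F" "\<forall>p\<in>UNIV. e (fst p) = e' p"
    using regular_map_pullback[OF regular_map_fst e(1)] by (rule bexE)
  obtain d' where d': "d' \<in> function_algebra ?F" "\<forall>p\<in>UNIV. d (snd p) = d' p"
    using regular_map_pullback[OF regular_map_snd d(1)] by (rule bexE)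
  from e(2) d(2) obtain x y where xy: "x \<in> A" "e x \<noteq> 0" "y \<in> B" "d y \<noteq> 0" by blast
  show ?thesis
  proof (rule good_imageI[where F' = ?F and V = ?V and \<phi> = ?m and b = "\<lambda>p. e' p * d' p" and ?v0.0 = "(x, y)"])
    show "finite ?F" by (intro finite_product_gens finite_gens)
    show "irreducible_set ?F ?V"
      by (intro irreducible_set_product irreducible_closure_in A' B')
    show "affine_set ?F ?V" by (intro affine_product affine_closure_in affine)
    show "regular_map ?F ?V F ?m" by (rule regular_map_subset[OF mult_regular V])
    show "?m ` ?V \<subseteq> carrier G" using V by auto
    show "(\<lambda>p. e' p * d' p) \<in> function_algebra ?F" by (rule function_algebra.mult[OF e'(1) d'(1)])
    show "(x, y) \<in> ?V" using xy sub by auto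
    have ed: "e' p = e (fst p)" "d' p = d (snd p)" for p
      using bspec[OF e'(2) UNIV_I, of p] bspec[OF d'(2) UNIV_I, of p] by simp_all
    show "e' (x, y) * d' (x, y) \<noteq> 0" using xy by (simp add: ed)
    show "A <#> B \<subseteq> ?m ` ?V"
    proof
      fix z assume "z \<in> A <#> B"
      then obtain a b where "a \<in> A" "b \<in> B" "z = a \<otimes> b" unfolding set_mult_def by blast
      then show "z \<in> ?m ` ?V" using sub by (intro image_eqI[of _ _ "(a, b)"]) auto
    qed
    show "?m v \<in> A <#> B" if "v \<in> ?V" "e' v * d' v \<noteq> 0" for v
    proof -
      have "fst v \<in> A" "snd v \<in> B" using e(3) d(3) that by (auto simp: ed)
      then show ?thesis unfolding set_mult_def by blast
    qed
    show "irreducible_set F (A <#> B)" by (rule irreducible_set_mult[OF A'(2) B'(2) A'(1) B'(1)])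
  qed
qed

section \<open>Commutator sets and products of maximal closure\<close>

definition commutators :: "'a \<Rightarrow> 'a set" where
  "commutators t = (\<lambda>x. inv t \<otimes> x \<otimes> t \<otimes> inv x) ` G0"

lemma good_commutators:
  assumes t: "t \<in> carrier G"
  shows "good (commutators t)"
proof (rule good_imageI[where F' = F and V = G0 and b = "\<lambda>_. 1" and ?v0.0 = \<one>
      and \<phi> = "\<lambda>x. inv t \<otimes> x \<otimes> t \<otimes> inv x"])
  show "affine_set F G0" using affine_closure_in[OF affine, of G0] closed_G0 by simp
  show "regular_map F G0 F (\<lambda>x. inv t \<otimes> x \<otimes> t \<otimes> inv x)"
    by (rule regular_map_subset[OF regular_commutator[OF t] identity_component_carrier])
  show "irreducible_set F (commutators t)" unfolding commutators_def
    by (rule irreducible_translate_image[OF irreducible_G0 identity_component_carrier regular_commutator[OF t]])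
  show "(\<lambda>x. inv t \<otimes> x \<otimes> t \<otimes> inv x) ` G0 \<subseteq> carrier G" using t identity_component_carrier by auto
qed (auto simp: commutators_def finite_gens irreducible_G0 one_G0 intro: function_algebra.const)

lemma one_commutators: "t \<in> carrier G \<Longrightarrow> \<one> \<in> commutators t"
  unfolding commutators_def using one_G0 by (intro image_eqI[of _ _ \<one>]) auto
text \<open>A factor is multiplied on only if it leads out of the current closure. Each such step
  enlarges an irreducible closed set strictly, so the longest sequence of steps is bounded and its
  last product absorbs every factor up to closure. The finite family of factors is recorded for
  finite normal generation.\<close>

lemma maximal_product:
  assumes \<X>: "\<And>X. X \<in> \<X> \<Longrightarrow> good X \<and> \<one> \<in> X"
  shows "\<exists>n Z \<Y>. n < 2 ^ card F \<and> good Z \<and> \<one> \<in> Z \<and> finite \<Y> \<and> \<Y> \<subseteq> \<X> \<and>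
    Z \<subseteq> words (\<Union>\<Y>) n \<and> (\<forall>X\<in>\<X>. Z <#> X \<subseteq> cl Z)"
proof -
  define chain where "chain Y n \<longleftrightarrow> Y 0 = {\<one>} \<and>
    (\<forall>i<n. \<exists>X\<in>\<X>. Y (Suc i) = Y i <#> X \<and> \<not> Y (Suc i) \<subseteq> cl (Y i))" for Y :: "nat \<Rightarrow> 'a set" and n
  have inv: "good (Y i) \<and> \<one> \<in> Y i \<and> (\<exists>\<Y>. finite \<Y> \<and> \<Y> \<subseteq> \<X> \<and> Y i \<subseteq> words (\<Union>\<Y>) i)"
    if "chain Y n" "i \<le> n" for Y n i
    using that(2)
  proof (induction i)
    case 0
    have "Y 0 = {\<one>}" using that(1) by (simp add: chain_def)
    then show ?case using good_singleton[OF one_closed] one_words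
      by (auto intro!: exI[of _ "{}"])
  next
    case (Suc i)
    then obtain \<Y> where IH: "good (Y i)" "\<one> \<in> Y i" "finite \<Y>" "\<Y> \<subseteq> \<X>" "Y i \<subseteq> words (\<Union>\<Y>) i" by auto
    from Suc.prems have "i < n" by simp
    with that(1) obtain X where X: "X \<in> \<X>" "Y (Suc i) = Y i <#> X" unfolding chain_def by blast
    have gX: "good X" "\<one> \<in> X" using \<X>[OF X(1)] by auto
    have "\<one> \<otimes> \<one> \<in> Y (Suc i)" unfolding X(2) set_mult_def using IH(2) gX(2) by blast
    moreover have "Y (Suc i) \<subseteq> words (\<Union>(insert X \<Y>)) (Suc i)"
    proof
      fix z assume "z \<in> Y (Suc i)"
      then obtain a x where ax: "a \<in> Y i" "x \<in> X" "z = a \<otimes> x" unfolding X(2) set_mult_def by blast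
      have U: "\<Union>(insert X \<Y>) \<subseteq> carrier G" using \<X> IH(4) X(1) unfolding good_def by blast
      have "a \<in> words (\<Union>(insert X \<Y>)) i" using ax(1) IH(5) words_mono[of "\<Union>\<Y>" "\<Union>(insert X \<Y>)" i] by auto
      then show "z \<in> words (\<Union>(insert X \<Y>)) (Suc i)"
        using words_mult[OF U _ words_one[OF U, of x]] ax(2,3) by simp
    qed
    ultimately show ?case using good_mult[OF IH(1) gX(1)] X IH(3,4)
      by (intro conjI exI[of _ "insert X \<Y>"]) auto
  qed
  have bound: "n < 2 ^ card F" if ch: "chain Y n" for Y n
  proof (rule irreducible_chain_length[OF finite_gens, of n Y])
    show "irreducible_set F (Y i)" if "i \<le> n" for i using inv[OF ch that] by (simp add: good_def)
    fix i assume i: "i < n"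
    then obtain X where X: "X \<in> \<X>" "Y (Suc i) = Y i <#> X" "\<not> Y (Suc i) \<subseteq> cl (Y i)"
      using ch unfolding chain_def by blast
    have c: "Y i \<subseteq> carrier G" "Y (Suc i) \<subseteq> carrier G"
      using inv[OF ch, of i] inv[OF ch, of "Suc i"] i by (auto simp: good_def)
    show "Y i \<subseteq> Y (Suc i)"
    proof
      fix a assume a: "a \<in> Y i"
      then have "a \<otimes> \<one> \<in> Y (Suc i)" unfolding X(2) set_mult_def using \<X>[OF X(1)] by blast
      then show "a \<in> Y (Suc i)" using a c(1) by auto
    qed
    \<comment> \<open>Leaving the closure means that some regular function vanishes on the old
      product but not on the new one, as the chain bound demands.\<close>
    from X(3) obtain w where w: "w \<in> Y (Suc i)" "w \<notin> cl (Y i)" by blast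
    have "w \<in> carrier G" by (rule subsetD[OF c(2) w(1)])
    with w(2) obtain g where g: "g \<in> function_algebra F" "\<forall>x\<in>Y i. g x = 0" "g w \<noteq> 0"
      unfolding closure_in_def mem_Collect_eq by blast
    show "\<exists>g\<in>function_algebra F. (\<forall>x\<in>Y i. g x = 0) \<and> (\<exists>x\<in>Y (Suc i). g x \<noteq> 0)"
      by (intro bexI[OF _ g(1)] conjI g(2) bexI[OF _ w(1)] g(3))
  qed
  have "chain (\<lambda>_. {\<one>}) 0" by (simp add: chain_def)
  then have ex: "\<exists>Y. chain Y 0" by (rule exI[of "\<lambda>Y. chain Y 0"])
  have le: "m \<le> 2 ^ card F" if "\<exists>Y. chain Y m" for m
    using that bound by (auto intro: less_imp_le)
  define n where "n = (GREATEST n. \<exists>Y. chain Y n)"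
  have n1: "\<exists>Y. chain Y n"
    unfolding n_def by (rule GreatestI_nat[where P = "\<lambda>n. \<exists>Y. chain Y n", OF ex]) (rule le)
  have n2: "m \<le> n" if "\<exists>Y. chain Y m" for m
    unfolding n_def by (rule Greatest_le_nat[where P = "\<lambda>n. \<exists>Y. chain Y n", OF that]) (rule le)
  from n1 obtain Y where Y: "chain Y n" ..
  have "Y n <#> X \<subseteq> cl (Y n)" if X: "X \<in> \<X>" for X
  proof (rule ccontr)
    assume "\<not> ?thesis"
    then have "chain (Y(Suc n := Y n <#> X)) (Suc n)"
      using Y X unfolding chain_def by (auto simp: less_Suc_eq)
    then have "Suc n \<le> n" by (intro n2) (rule exI[of "\<lambda>Y. chain Y (Suc n)"])
    then show False by simp
  qed
  with inv[OF Y, of n] bound[OF Y] show ?thesis by blast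
qed

text \<open>By continuity, right multiplication by \<open>u\<close> maps the whole closure of
  \<open>Z\<close> into itself, since it does so on \<open>Z\<close>. The closure is therefore
  stable under the generated subgroup and contains its orbit of the identity.\<close>

lemma generate_subset_closure:
  assumes Z: "Z \<subseteq> carrier G" "\<one> \<in> Z" and U: "U \<subseteq> carrier G" "\<And>u. u \<in> U \<Longrightarrow> inv u \<in> U"
    and right: "\<And>z u. z \<in> Z \<Longrightarrow> u \<in> U \<Longrightarrow> z \<otimes> u \<in> cl Z"
  shows "generate G U \<subseteq> cl Z"
proof -
  have step: "w \<otimes> u \<in> cl Z" if "w \<in> cl Z" "u \<in> U" for w u
    using that right U(1) closure_in_subset[of F "carrier G" Z] Z(1)
    by (intro closure_image[OF regular_right[of u], of w Z Z]) auto
  have "w \<otimes> g \<in> cl Z" if "g \<in> generate G U" "w \<in> cl Z" for g w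
    using that
  proof (induction arbitrary: w rule: generate.induct)
    case one
    then show ?case using closure_in_subset[of F "carrier G" Z] by auto
  next
    case (eng h1 h2)
    have "h1 \<in> carrier G" "h2 \<in> carrier G" "w \<in> carrier G"
      using eng.hyps eng.prems generate_in_carrier[OF U(1)] closure_in_subset[of F "carrier G" Z] by auto
    then show ?case using eng.IH(2)[OF eng.IH(1)[OF eng.prems]] by (simp add: m_assoc)
  qed (auto intro: step U(2))
  from this[of _ \<one>] show ?thesis
    using subset_closure_in[OF Z(1), of F] Z(2) generate_in_carrier[OF U(1)] by auto
qed

text \<open>In the irreducible closure of \<open>Z\<close>, the open part of \<open>Z\<close> meets
  its translate by the inverse of \<open>g\<close>. A common point \<open>u\<close> has both
  \<open>u\<close> and \<open>g \<otimes> u\<close> in \<open>Z\<close>, and \<open>g\<close> is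
  their quotient.\<close>

lemma good_difference:
  assumes Z: "good Z" and M: "subgroup M G" "Z \<subseteq> M" "M \<subseteq> cl Z" and g: "g \<in> M"
  shows "\<exists>a\<in>Z. \<exists>b\<in>Z. g = a \<otimes> inv b"
proof -
  note Mc = subgroup.subset[OF M(1)]
  obtain e where e: "e \<in> function_algebra F" "\<exists>z\<in>Z. e z \<noteq> 0" "\<forall>w\<in>cl Z. e w \<noteq> 0 \<longrightarrow> w \<in> Z"
    by (rule goodE[OF Z])
  have Z': "Z \<subseteq> carrier G" "irreducible_set F Z" using Z by (auto simp: good_def)
  have gc: "g \<in> carrier G" using g Mc by blast
  obtain e' where e': "e' \<in> function_algebra F" "\<forall>x\<in>carrier G. e (g \<otimes> x) = e' x"
    using regular_map_pullback[OF regular_left[OF gc] e(1)] by (rule bexE)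
  from e(2) obtain z where z: "z \<in> Z" "e z \<noteq> 0" by blast
  have zc: "z \<in> carrier G" using z Z' by blast
  \<comment> \<open>The translated function must not vanish identically on the closure; this point
    is a witness because \<open>M\<close> is a group inside the closure.\<close>
  have "inv g \<otimes> z \<in> cl Z"
    using M z g subgroup.m_closed[OF M(1) subgroup.m_inv_closed[OF M(1) g], of z] by blast
  moreover have "e' (inv g \<otimes> z) \<noteq> 0"
    using e'(2) z gc zc by (metis cancel_inv_left inv_closed m_closed)
  moreover have "z \<in> cl Z" using z subset_closure_in[OF Z'(1), of F] by blast
  ultimately obtain u where u: "u \<in> cl Z" "e u \<noteq> 0" "e' u \<noteq> 0"
    using irreducible_setD[OF irreducible_closure_in[OF Z'(2,1)] e(1) e'(1), of z "inv g \<otimes> z"] z(2) by blast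
  have uc: "u \<in> carrier G" by (rule subsetD[OF closure_in_subset u(1)])
  have "g \<otimes> u \<in> cl Z"
  proof (rule closure_image[OF regular_left[OF gc] u(1)])
    show "(\<lambda>x. g \<otimes> x) ` Z \<subseteq> cl Z" using M(2,3) subgroup.m_closed[OF M(1) g] by blast
  qed (use gc uc Z' in auto)
  then have "g \<otimes> u \<in> Z" using e(3) u(3) e'(2) uc by simp
  moreover have "u \<in> Z" using e(3) u by blast
  moreover have "g = (g \<otimes> u) \<otimes> inv u" using gc uc by (simp add: m_assoc)
  ultimately show ?thesis by blast
qed

text \<open>If no single function vanished on \<open>X\<close>, irreducibility would give a point
  where their product is nonzero, while every point kills one of the factors.\<close>

lemma irreducible_finite_cover:
  assumes "finite T" "irreducible_set F X" "\<And>t. t \<in> T \<Longrightarrow> f t \<in> function_algebra F"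
    and "\<And>x. x \<in> X \<Longrightarrow> \<exists>t\<in>T. f t x = 0"
  shows "\<exists>t\<in>T. \<forall>x\<in>X. f t x = 0"
proof (rule ccontr)
  assume "\<not> ?thesis"
  then have nz: "\<exists>x\<in>X. f t x \<noteq> 0" if "t \<in> T" for t using that by blast
  have "(\<lambda>x. \<Prod>t\<in>S. f t x) \<in> function_algebra F \<and> (\<exists>x\<in>X. (\<Prod>t\<in>S. f t x) \<noteq> 0)" if "S \<subseteq> T" for S
    using finite_subset[OF that assms(1)] that
  proof (induction S rule: finite_induct)
    case empty
    then show ?case using assms(2) function_algebra.const[of 1 F] by (auto simp: irreducible_set_def)
  next
    case (insert s S)
    then have IH: "(\<lambda>x. \<Prod>t\<in>S. f t x) \<in> function_algebra F" "\<exists>x\<in>X. (\<Prod>t\<in>S. f t x) \<noteq> 0" by auto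
    have s: "f s \<in> function_algebra F" "\<exists>x\<in>X. f s x \<noteq> 0" using insert.prems assms(3) nz by auto
    from IH(2) s(2) obtain x y where xy: "x \<in> X" "f s x \<noteq> 0" "y \<in> X" "(\<Prod>t\<in>S. f t y) \<noteq> 0" by blast
    have "\<exists>z\<in>X. f s z \<noteq> 0 \<and> (\<Prod>t\<in>S. f t z) \<noteq> 0"
      using irreducible_setD[OF assms(2) s(1) IH(1) xy] .
    then show ?case using insert.hyps function_algebra.mult[OF s(1) IH(1)] by auto
  qed
  from this[of T] obtain x where "x \<in> X" "(\<Prod>t\<in>T. f t x) \<noteq> 0" by blast
  then show False using assms(1,4) by (metis prod_zero_iff)
qed

text \<open>\<open>G0\<close> is covered by finitely many cosets of \<open>N\<close>. An equation of
  \<open>Z\<close> holds on \<open>N\<close>, so its translates hold on these cosets; by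
  irreducibility one translate holds on all of \<open>G0\<close>, and translating back within
  \<open>G0\<close> recovers the original equation.\<close>

lemma G0_subset_closure:
  assumes N: "subgroup N G" "N \<subseteq> G0" "N \<subseteq> cl Z" and Z: "Z \<subseteq> carrier G" and fin: "finite (rcosets N)"
  shows "G0 \<subseteq> cl Z"
proof
  fix g assume g: "g \<in> G0"
  show "g \<in> cl Z" unfolding closure_in_def
  proof (intro CollectI conjI ballI impI)
    show "g \<in> carrier G" using g identity_component_carrier by blast
    fix f assume f: "f \<in> function_algebra F" "\<forall>z\<in>Z. f z = 0"
    obtain T where T: "T \<subseteq> carrier G" "finite T" "\<And>g. g \<in> carrier G \<Longrightarrow> \<exists>h\<in>N. \<exists>t\<in>T. g = h \<otimes> t"
      using rcosets_representatives[OF N(1) fin] by blast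
    have "\<exists>f'\<in>function_algebra F. \<forall>x\<in>carrier G. f (x \<otimes> inv t) = f' x" if "t \<in> T \<inter> G0" for t
      by (rule regular_map_pullback[OF regular_right f(1)]) (use that T(1) in auto)
    then obtain f' where f': "\<And>t. t \<in> T \<inter> G0 \<Longrightarrow> f' t \<in> function_algebra F"
      "\<And>t x. t \<in> T \<inter> G0 \<Longrightarrow> x \<in> carrier G \<Longrightarrow> f (x \<otimes> inv t) = f' t x" by metis
    have "\<exists>t\<in>T \<inter> G0. f' t x = 0" if x: "x \<in> G0" for x
    proof -
      have xc: "x \<in> carrier G" using x identity_component_carrier by blast
      then obtain h t where ht: "h \<in> N" "t \<in> T" "x = h \<otimes> t" using T(3) by blast
      have c: "h \<in> carrier G" "t \<in> carrier G" using ht N(1) T(1) subgroup.subset by auto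
      \<comment> \<open>Representatives of cosets meeting \<open>G0\<close> lie in \<open>G0\<close>
        because \<open>N\<close> does; translation by them therefore preserves
        \<open>G0\<close>.\<close>
      have "inv h \<otimes> x \<in> G0"
        using ht(1) N(2) x by (intro subgroup.m_closed subgroup.m_inv_closed subgroup_G0) auto
      then have t: "t \<in> T \<inter> G0" using ht c by (simp add: inv_cancel_left)
      have "x \<otimes> inv t = h" using ht c by (simp add: m_assoc)
      then have "f (x \<otimes> inv t) = 0" using closure_in_vanish[OF f] ht(1) N(3) by auto
      then show ?thesis using f'(2)[OF t xc] t by auto
    qed
    then obtain t where t: "t \<in> T \<inter> G0" "\<forall>x\<in>G0. f' t x = 0"
      using irreducible_finite_cover[of "T \<inter> G0" G0 f'] T(2) irreducible_G0 f'(1) by blast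
    have tc: "t \<in> carrier G" "g \<in> carrier G" using t T g identity_component_carrier by auto
    have "g \<otimes> t \<in> G0" using subgroup.m_closed[OF subgroup_G0 g] t by blast
    then have "f (g \<otimes> t \<otimes> inv t) = 0" using f'(2)[OF t(1)] t(2) identity_component_carrier by auto
    then show "f g = 0" using tc by (simp add: m_assoc)
  qed
qed

section \<open>Covering the identity component by words of bounded length\<close>

lemma commutators_subset_G0: "t \<in> carrier G \<Longrightarrow> commutators t \<subseteq> G0"
proof
  fix y assume t: "t \<in> carrier G" and "y \<in> commutators t"
  then obtain x where x: "x \<in> G0" "y = inv t \<otimes> x \<otimes> t \<otimes> inv x" by (auto simp: commutators_def)
  have "inv t \<otimes> x \<otimes> inv (inv t) \<in> G0" by (rule conj_G0[OF inv_closed[OF t] x(1)])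
  then show "y \<in> G0"
    using subgroup.m_closed[OF subgroup_G0 _ subgroup.m_inv_closed[OF subgroup_G0 x(1)]] x(2) t by simp
qed

text \<open>Conjugating \<open>x\<close> by the inverse of \<open>t\<close> gives the parameter that
  realises the inverse, with \<open>t\<close> replaced by its inverse.\<close>

lemma inv_commutators:
  assumes t: "t \<in> carrier G" and y: "y \<in> commutators t"
  shows "inv y \<in> commutators (inv t)"
proof -
  obtain x where x: "x \<in> G0" "y = inv t \<otimes> x \<otimes> t \<otimes> inv x" using y by (auto simp: commutators_def)
  have xc: "x \<in> carrier G" using x identity_component_carrier by blast
  let ?z = "inv t \<otimes> x \<otimes> inv (inv t)"
  have "inv y = inv (inv t) \<otimes> ?z \<otimes> inv t \<otimes> inv ?z"
    using t xc by (simp add: x(2) group_word_simps)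
  moreover have "?z \<in> G0" using conj_G0 x(1) t by blast
  ultimately show ?thesis unfolding commutators_def by blast
qed

lemma conj_commutators:
  assumes t: "t \<in> carrier G" and y: "y \<in> commutators t" and g: "g \<in> carrier G"
  shows "g \<otimes> y \<otimes> inv g \<in> commutators (g \<otimes> t \<otimes> inv g)"
proof -
  obtain x where x: "x \<in> G0" "y = inv t \<otimes> x \<otimes> t \<otimes> inv x" using y by (auto simp: commutators_def)
  have xc: "x \<in> carrier G" using x identity_component_carrier by blast
  let ?s = "g \<otimes> t \<otimes> inv g" and ?z = "g \<otimes> x \<otimes> inv g"
  have "g \<otimes> y \<otimes> inv g = inv ?s \<otimes> ?z \<otimes> ?s \<otimes> inv ?z"
    using t xc g by (simp add: x(2) group_word_simps)
  moreover have "?z \<in> G0" using conj_G0 x(1) g by blast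
  ultimately show ?thesis unfolding commutators_def by blast
qed

text \<open>The factor 4 has two sources: an element of \<open>G0\<close> is a quotient of two
  elements of \<open>Z\<close>, each a word of length \<open>n\<close> in commutators, and each
  commutator is a product of two elements of \<open>C\<close>. The same \<open>Z\<close> uses
  finitely many commutator sets, which gives the second claim.\<close>

lemma identity_component_words:
  assumes fin: "finite (rcosets (derived G (carrier G)))"
    and C: "C \<subseteq> carrier G" "\<And>t. t \<in> C \<Longrightarrow> inv t \<in> C"
      "\<And>t g. t \<in> C \<Longrightarrow> g \<in> carrier G \<Longrightarrow> g \<otimes> t \<otimes> inv g \<in> C" "generate G C = carrier G"
  shows "\<exists>n < 2 ^ card F. G0 \<subseteq> words C (4 * n)" (is ?lab1)
    and "\<exists>T\<subseteq>C. finite T \<and> G0 \<subseteq> generate G (\<Union>t\<in>T. commutators t)" (is ?lab2)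
proof -
  let ?U = "\<Union>t\<in>C. commutators t"
  have UG0: "?U \<subseteq> G0" using commutators_subset_G0 C(1) by blast
  then have U: "?U \<subseteq> carrier G" using identity_component_carrier by blast
  have Uinv: "inv u \<in> ?U" if u: "u \<in> ?U" for u
  proof -
    from u obtain t where t: "t \<in> C" "u \<in> commutators t" by blast
    show ?thesis by (rule UN_I, rule C(2)[OF t(1)], rule inv_commutators[OF subsetD[OF C(1) t(1)] t(2)])
  qed
  have Uconj: "g \<otimes> u \<otimes> inv g \<in> ?U" if u: "u \<in> ?U" and g: "g \<in> carrier G" for u g
  proof -
    from u obtain t where t: "t \<in> C" "u \<in> commutators t" by blast
    show ?thesis
      by (rule UN_I, rule C(3)[OF t(1) g], rule conj_commutators[OF subsetD[OF C(1) t(1)] t(2) g])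
  qed
  define N where "N = generate G ?U"
  have N: "N \<lhd> G" unfolding N_def by (rule normal_generateI[OF U Uconj])
  then have Ns: "subgroup N G" by (rule normal_imp_subgroup)
  have NG0: "N \<subseteq> G0" unfolding N_def by (rule generate_subgroup_incl[OF UG0 subgroup_G0])
  have comm_N: "inv t \<otimes> x \<otimes> t \<otimes> inv x \<in> N" if t: "t \<in> C" and x: "x \<in> G0" for t x
    unfolding N_def
    by (rule generate.incl, rule UN_I[OF t], unfold commutators_def, rule imageI[OF x])
  have central: "inv g \<otimes> x \<otimes> g \<otimes> inv x \<in> N" if "g \<in> carrier G" "x \<in> G0" for g x
  proof -
    have "g \<in> generate G C" unfolding C(4) by (rule that(1))
    then show ?thesis using that(2)
    proof (induction arbitrary: x rule: generate.induct)
      case one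
      then have "x \<in> carrier G" using identity_component_carrier by blast
      then show ?case using subgroup.one_closed[OF Ns] by simp
    next
      case (incl h)
      then show ?case by (rule comm_N)
    next
      case (inv h)
      show ?case by (rule comm_N[OF C(2)[OF inv.hyps] inv.prems])
    next
      case (eng h1 h2)
      have c: "h1 \<in> carrier G" "h2 \<in> carrier G" "x \<in> carrier G"
        using eng generate_in_carrier[OF C(1)] identity_component_carrier by auto
      \<comment> \<open>The commutator of a product \<open>h1 \<otimes> h2\<close> with
        \<open>x\<close> is a conjugate of the one for \<open>h1\<close> times the one for
        \<open>h2\<close>; normality of \<open>N\<close> carries the property from \<open>C\<close>
        to all of \<open>G\<close>.\<close>
      have "inv h2 \<otimes> (inv h1 \<otimes> x \<otimes> h1 \<otimes> inv x) \<otimes> inv (inv h2) \<in> N"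
        using normal.inv_op_closed2[OF N inv_closed[OF c(2)] eng.IH(1)[OF eng.prems]] .
      then have "(inv h2 \<otimes> (inv h1 \<otimes> x \<otimes> h1 \<otimes> inv x) \<otimes> inv (inv h2)) \<otimes> (inv h2 \<otimes> x \<otimes> h2 \<otimes> inv x) \<in> N"
        using eng.IH(2)[OF eng.prems] by (rule subgroup.m_closed[OF Ns])
      then show ?case using c by (simp add: group_word_simps)
    qed
  qed
  have finN: "finite (rcosets N)"
    by (rule finite_rcosets_central_quotient[OF N normal_G0 finite_index_G0 fin central])
  have good_C: "good X \<and> \<one> \<in> X" if X: "X \<in> commutators ` C" for X
  proof -
    from X obtain t where "t \<in> C" "X = commutators t" by blast
    with C(1) show ?thesis using good_commutators[of t] one_commutators[of t] by auto
  qed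
  have "\<exists>n Z \<Y>. n < 2 ^ card F \<and> good Z \<and> \<one> \<in> Z \<and> finite \<Y> \<and> \<Y> \<subseteq> commutators ` C \<and>
    Z \<subseteq> words (\<Union>\<Y>) n \<and> (\<forall>X\<in>commutators ` C. Z <#> X \<subseteq> cl Z)"
    by (rule maximal_product) (rule good_C)
  then
  obtain n Z \<Y> where n: "n < 2 ^ card F" and Z: "good Z" "\<one> \<in> Z" and \<Y>: "finite \<Y>" "\<Y> \<subseteq> commutators ` C"
    and ZY: "Z \<subseteq> words (\<Union>\<Y>) n" and max: "\<forall>X\<in>commutators ` C. Z <#> X \<subseteq> cl Z"
    by (elim exE conjE) (rule that)
  have Zc: "Z \<subseteq> carrier G" using Z(1) by (simp add: good_def)
  have YU: "\<Union>\<Y> \<subseteq> ?U" using \<Y>(2) by blast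
  have Zgen: "Z \<subseteq> generate G (\<Union>\<Y>)" using ZY words_generate[of "\<Union>\<Y>" n] YU U by blast
  have ZU: "Z \<subseteq> words ?U n" using ZY words_mono[OF YU, of n] by blast
  have "N \<subseteq> cl Z" unfolding N_def
  proof (rule generate_subset_closure[OF Zc Z(2) U Uinv])
    fix z u assume z: "z \<in> Z" and "u \<in> ?U"
    then obtain t where t: "t \<in> C" "u \<in> commutators t" by blast
    have "z \<otimes> u \<in> Z <#> commutators t" unfolding set_mult_def using z t(2) by blast
    then show "z \<otimes> u \<in> cl Z" using bspec[OF max imageI[OF t(1)]] by blast
  qed
  then have G0Z: "G0 \<subseteq> cl Z" using G0_subset_closure[OF Ns NG0 _ Zc finN] by blast
  have ZG0: "Z \<subseteq> G0" using ZU words_generate[OF U, of n] NG0 unfolding N_def by blast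
  \<comment> \<open>Once \<open>G0\<close> lies in the closure of \<open>Z\<close>, the quotient
    argument applies to \<open>G0\<close> directly, and equality of \<open>N\<close> with
    \<open>G0\<close> need not be derived first.\<close>
  have diff: "\<exists>a\<in>Z. \<exists>b\<in>Z. g = a \<otimes> inv b" if "g \<in> G0" for g
    by (rule good_difference[OF Z(1) subgroup_G0 ZG0 G0Z that])
  have two: "u \<in> words C 2" if u: "u \<in> ?U" for u
  proof -
    from u obtain t where t: "t \<in> C" "u \<in> commutators t" by blast
    then obtain x where tx: "t \<in> C" "x \<in> G0" "u = inv t \<otimes> x \<otimes> t \<otimes> inv x"
      by (auto simp: commutators_def)
    have c: "t \<in> carrier G" "x \<in> carrier G" using tx C(1) identity_component_carrier by auto
    \<comment> \<open>Bracketed this way, the commutator is the inverse of a letter times a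
      conjugate of that letter.\<close>
    have "inv t \<otimes> (x \<otimes> t \<otimes> inv x) \<in> words C (1 + 1)"
      by (intro words_mult[OF C(1)] words_one[OF C(1)] C(2) C(3) tx(1) c(2))
    then show ?thesis using c by (simp add: tx(3) m_assoc numeral_2_eq_2)
  qed
  have "G0 \<subseteq> words C (4 * n)"
  proof
    fix g assume "g \<in> G0"
    then obtain a b where ab: "a \<in> Z" "b \<in> Z" "g = a \<otimes> inv b" using diff by blast
    have "g \<in> words ?U (n + n)"
      unfolding ab(3)
      by (rule words_mult[OF U subsetD[OF ZU ab(1)] words_inv[OF U Uinv subsetD[OF ZU ab(2)]]])
    then have "g \<in> words C ((n + n) * 2)" by (rule words_subst[OF C(1), rotated]) (rule two)
    then show "g \<in> words C (4 * n)" by (simp add: mult.commute)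
  qed
  with n show "\<exists>n < 2 ^ card F. G0 \<subseteq> words C (4 * n)" by blast
  obtain T where T: "T \<subseteq> C" "finite T" "\<Y> = commutators ` T"
    using finite_subset_image[OF \<Y>] by blast
  have sub: "subgroup (generate G (\<Union>\<Y>)) G" using generate_is_subgroup[of "\<Union>\<Y>"] YU U by blast
  have "G0 \<subseteq> generate G (\<Union>\<Y>)"
  proof
    fix g assume "g \<in> G0"
    then obtain a b where ab: "a \<in> Z" "b \<in> Z" "g = a \<otimes> inv b" using diff by blast
    show "g \<in> generate G (\<Union>\<Y>)" unfolding ab(3)
      by (rule subgroup.m_closed[OF sub subsetD[OF Zgen ab(1)] subgroup.m_inv_closed[OF sub subsetD[OF Zgen ab(2)]]])
  qed
  with T show "\<exists>T\<subseteq>C. finite T \<and> G0 \<subseteq> generate G (\<Union>t\<in>T. commutators t)" by auto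
qed

end

section \<open>Uniform boundedness\<close>

context group
begin

lemma
  assumes S: "S \<subseteq> carrier G"
  shows sym_conjugates_carrier: "sym_conjugates G S \<subseteq> carrier G"
    and sym_conjugates_inv: "t \<in> sym_conjugates G S \<Longrightarrow> inv t \<in> sym_conjugates G S"
    and sym_conjugates_conj:
      "t \<in> sym_conjugates G S \<Longrightarrow> g \<in> carrier G \<Longrightarrow> g \<otimes> t \<otimes> inv g \<in> sym_conjugates G S"
    and subset_sym_conjugates: "S \<subseteq> sym_conjugates G S"
proof -
  let ?S = "S \<union> m_inv G ` S"
  have Sc: "?S \<subseteq> carrier G" using S by auto
  have Sinv: "inv s \<in> ?S" if s: "s \<in> ?S" for s
  proof -
    from s consider "s \<in> S" | u where "u \<in> S" "s = inv u" by blast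
    then show ?thesis using S by cases auto
  qed
  have mem: "x \<otimes> s \<otimes> inv x \<in> sym_conjugates G S" if "x \<in> carrier G" "s \<in> ?S" for x s
    using that unfolding sym_conjugates_def by blast
  have ex: "\<exists>x s. x \<in> carrier G \<and> s \<in> ?S \<and> t = x \<otimes> s \<otimes> inv x" if "t \<in> sym_conjugates G S" for t
    using that unfolding sym_conjugates_def by blast
  show "sym_conjugates G S \<subseteq> carrier G" using ex Sc by fastforce
  show "inv t \<in> sym_conjugates G S" if t: "t \<in> sym_conjugates G S"
  proof -
    from ex[OF t] obtain x s where xs: "x \<in> carrier G" "s \<in> ?S" "t = x \<otimes> s \<otimes> inv x" by blast
    then have "s \<in> carrier G" using Sc by blast
    then have "inv t = x \<otimes> inv s \<otimes> inv x" using xs(1) unfolding xs(3) by (simp add: group_word_simps)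
    then show ?thesis using mem[OF xs(1) Sinv[OF xs(2)]] by simp
  qed
  show "g \<otimes> t \<otimes> inv g \<in> sym_conjugates G S" if t: "t \<in> sym_conjugates G S" and g: "g \<in> carrier G"
  proof -
    from ex[OF t] obtain x s where xs: "x \<in> carrier G" "s \<in> ?S" "t = x \<otimes> s \<otimes> inv x" by blast
    then have "s \<in> carrier G" using Sc by blast
    then have "g \<otimes> t \<otimes> inv g = (g \<otimes> x) \<otimes> s \<otimes> inv (g \<otimes> x)"
      using xs(1) g unfolding xs(3) by (simp add: group_word_simps)
    then show ?thesis using mem[OF m_closed[OF g xs(1)] xs(2)] by simp
  qed
  show "S \<subseteq> sym_conjugates G S"
  proof
    fix s assume s: "s \<in> S"
    then have "\<one> \<otimes> s \<otimes> inv \<one> \<in> sym_conjugates G S" by (intro mem) auto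
    then show "s \<in> sym_conjugates G S" using s S by auto
  qed
qed

lemma normal_closure_subset: "N \<lhd> G \<Longrightarrow> S \<subseteq> N \<Longrightarrow> normal_closure G S \<subseteq> N"
  unfolding normal_closure_def by blast

lemma generate_sym_conjugates:
  assumes "normally_generates G S"
  shows "generate G (sym_conjugates G S) = carrier G"
proof
  have S: "S \<subseteq> carrier G" and nc: "normal_closure G S = carrier G"
    using assms by (auto simp: normally_generates_def)
  let ?C = "sym_conjugates G S"
  show "generate G ?C \<subseteq> carrier G" by (rule generate_incl[OF sym_conjugates_carrier[OF S]])
  have "generate G ?C \<lhd> G"
    by (rule normal_generateI[OF sym_conjugates_carrier[OF S] sym_conjugates_conj[OF S]])
  moreover have "S \<subseteq> generate G ?C" using subset_sym_conjugates[OF S] generate.incl[of _ ?C G] by blast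
  ultimately show "carrier G \<subseteq> generate G ?C" unfolding nc[symmetric] by (rule normal_closure_subset)
qed

lemma conj_norm_le:
  assumes "g \<in> words (sym_conjugates G S) n"
  shows "conj_norm G S g \<le> enat n"
  using assms unfolding conj_norm_def is_product_of_conjugates_def words_def
  by (intro INF_lower) blast

end

context affine_algebraic_group
begin

text \<open>Write \<open>g = h \<otimes> b\<close> with \<open>h\<close> in \<open>G0\<close> and
  \<open>b\<close> a word shorter than the index of \<open>G0\<close>. Both lengths are bounded by
  quantities attached to \<open>G\<close> and its coordinates, so the bound holds for all
  \<open>S\<close> at once.\<close>

lemma Delta_le:
  assumes fin: "finite (rcosets (derived G (carrier G)))"
  shows "Delta G \<le> enat (4 * 2 ^ card F + card (rcosets G0))"
  unfolding Delta_def conj_diameter_def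
proof (intro SUP_least)
  fix S g assume "S \<in> {S. finite S \<and> normally_generates G S}" and g: "g \<in> carrier G"
  then have ng: "normally_generates G S" by simp
  then have S: "S \<subseteq> carrier G" by (simp add: normally_generates_def)
  let ?C = "sym_conjugates G S"
  note C = sym_conjugates_carrier[OF S] sym_conjugates_inv[OF S] sym_conjugates_conj[OF S]
  note gen = generate_sym_conjugates[OF ng]
  obtain n where n: "n < 2 ^ card F" "G0 \<subseteq> words ?C (4 * n)"
    using identity_component_words(1)[OF fin C gen] by blast
  have "\<exists>k. g \<in> words ?C k" by (rule generate_words[OF C(1,2)]) (use g gen in auto)
  then obtain k where "g \<in> words ?C k" by blast
  from words_rcosets[OF subgroup_G0 finite_index_G0 C(1) this]
  obtain j b h where j: "j < card (rcosets G0)" and b: "b \<in> words ?C j" and h: "h \<in> G0" "g = h \<otimes> b"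
    by blast
  have "g \<in> words ?C (4 * n + j)" unfolding h(2) by (rule words_mult[OF C(1) subsetD[OF n(2) h(1)] b])
  then have "conj_norm G S g \<le> enat (4 * n + j)" by (rule conj_norm_le)
  also have "\<dots> \<le> enat (4 * 2 ^ card F + card (rcosets G0))" using n(1) j by simp
  finally show "conj_norm G S g \<le> enat (4 * 2 ^ card F + card (rcosets G0))" .
qed

text \<open>Taking all of \<open>G\<close> as the set of letters, finitely many \<open>t\<close>
  already have commutator sets generating a subgroup that contains \<open>G0\<close>; a normal
  subgroup containing \<open>t\<close> contains its commutators. Representatives of the cosets of
  \<open>G0\<close> supply the rest.\<close>

lemma finitely_normally_generated:
  assumes fin: "finite (rcosets (derived G (carrier G)))"
  shows "finitely_normally_generated G"
proof -
  have gen: "generate G (carrier G) = carrier G"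
    using generate_incl[of "carrier G"] generate.incl[of _ "carrier G" G] by blast
  obtain T where T: "T \<subseteq> carrier G" "finite T" "G0 \<subseteq> generate G (\<Union>t\<in>T. commutators t)"
    using identity_component_words(2)[OF fin subset_refl inv_closed _ gen] by auto
  obtain R where R: "R \<subseteq> carrier G" "finite R" "\<And>g. g \<in> carrier G \<Longrightarrow> \<exists>h\<in>G0. \<exists>t\<in>R. g = h \<otimes> t"
    using rcosets_representatives[OF subgroup_G0 finite_index_G0] by blast
  have "carrier G \<subseteq> N" if N: "N \<lhd> G" "T \<union> R \<subseteq> N" for N
  proof
    fix g assume "g \<in> carrier G"
    then obtain h t where ht: "h \<in> G0" "t \<in> R" "g = h \<otimes> t" using R(3) by blast
    have Ns: "subgroup N G" by (rule normal_imp_subgroup[OF N(1)])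
    have "commutators t \<subseteq> N" if t: "t \<in> T" for t
    proof
      fix u assume "u \<in> commutators t"
      then obtain x where x: "x \<in> G0" "u = inv t \<otimes> x \<otimes> t \<otimes> inv x" by (auto simp: commutators_def)
      have c: "x \<in> carrier G" "t \<in> carrier G" using x t T(1) identity_component_carrier by auto
      have tN: "t \<in> N" using t N(2) by blast
      have "inv t \<otimes> (x \<otimes> t \<otimes> inv x) \<in> N"
        by (rule subgroup.m_closed[OF Ns subgroup.m_inv_closed[OF Ns tN] normal.inv_op_closed2[OF N(1) c(1) tN]])
      then show "u \<in> N" using c by (simp add: x(2) m_assoc)
    qed
    then have "generate G (\<Union>t\<in>T. commutators t) \<subseteq> N" by (intro generate_subgroup_incl Ns) blast
    then have "h \<in> N" using T(3) ht(1) by blast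
    then show "g \<in> N" unfolding ht(3) using ht(2) N(2) subgroup.m_closed[OF Ns] by blast
  qed
  then have "carrier G \<subseteq> normal_closure G (T \<union> R)" unfolding normal_closure_def by blast
  moreover have "normal_closure G (T \<union> R) \<subseteq> carrier G"
    using T(1) R(1) by (intro normal_closure_subset normal_self) auto
  ultimately have "normally_generates G (T \<union> R)" using T(1) R(1) by (auto simp: normally_generates_def)
  with T(2) R(2) show ?thesis unfolding finitely_normally_generated_def by blast
qed

theorem uniformly_bounded_if_finite_abelianization:
  assumes "finite (carrier (abelianization G))"
  shows "uniformly_bounded G"
proof -
  have fin: "finite (rcosets (derived G (carrier G)))"
    using assms by (simp add: abelianization_def FactGroup_def)
  have "Delta G < \<infinity>" by (rule le_less_trans[OF Delta_le[OF fin]]) simp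
  with finitely_normally_generated[OF fin] show ?thesis by (simp add: uniformly_bounded_def)
qed

end

section \<open>Closed subgroups of the general linear group\<close>

text \<open>Entries of the inverse are included among the coordinates: inversion then merely
  permutes them, and a character yields a matrix together with its inverse. Values at singular
  matrices are irrelevant, since regularity is tested on subgroups of \<open>GL n\<close>.\<close>

definition GL_coordinates :: "nat \<Rightarrow> ('a::field mat \<Rightarrow> 'a) set" where
  "GL_coordinates n = (\<lambda>(i, j) A. A $$ (i, j)) ` ({..<n} \<times> {..<n}) \<union>
    (\<lambda>(i, j) A. (inv\<^bsub>GL n\<^esub> A) $$ (i, j)) ` ({..<n} \<times> {..<n})"

lemma GL_mult: "x \<otimes>\<^bsub>GL n\<^esub> y = x * y"
  unfolding GL_def units_of_mult by (simp add: ring_mat_simps)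

lemma GL_one: "\<one>\<^bsub>GL n\<^esub> = 1\<^sub>m n"
  unfolding GL_def units_of_one by (simp add: ring_mat_simps)

lemma mat_mult_entry:
  assumes "A \<in> carrier_mat n n" "B \<in> carrier_mat n n" "i < n" "j < n"
  shows "(A * B) $$ (i, j) = (\<Sum>k<n. A $$ (i, k) * B $$ (k, j))"
proof -
  have "(A * B) $$ (i, j) = row A i \<bullet> col B j" using assms by (intro index_mult_mat) auto
  also have "\<dots> = (\<Sum>k<n. A $$ (i, k) * B $$ (k, j))"
    unfolding scalar_prod_def using assms by (intro sum.cong) auto
  finally show ?thesis .
qed

lemma character_function_sum:
  assumes \<chi>: "character (function_algebra F) I \<chi>" and "finite S"
    and "\<And>k. k \<in> S \<Longrightarrow> f k \<in> function_algebra F" and zero: "\<chi> (\<lambda>_. 0) = 0"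
  shows "\<chi> (\<lambda>x. \<Sum>k\<in>S. f k x) = (\<Sum>k\<in>S. \<chi> (f k))"
  using assms(2,3)
proof (induction S rule: finite_induct)
  case (insert k S)
  have "\<chi> (f k + (\<lambda>x. \<Sum>k\<in>S. f k x)) = \<chi> (f k) + \<chi> (\<lambda>x. \<Sum>k\<in>S. f k x)"
    by (intro character_add[OF \<chi>] function_algebra_sum insert.prems) simp_all
  then show ?case using insert by (simp add: plus_fun_def)
qed (simp add: zero)

locale closed_subgroup_GL =
  fixes n :: nat and H :: "'a::alg_closed_field mat set"
  assumes subgroup_H: "subgroup H (GL n)" and closed_H: "zariski_closed_in_GL n H"
begin

abbreviation "GH \<equiv> (GL n)\<lparr>carrier := H\<rparr>"
abbreviation "R \<equiv> function_algebra (GL_coordinates n :: ('a mat \<Rightarrow> 'a) set)"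

interpretation GL: group "GL n :: 'a mat monoid" by (rule group_GL)

lemma H_carrier: "x \<in> H \<Longrightarrow> x \<in> carrier (GL n)"
  by (rule subgroup.mem_carrier[OF subgroup_H])

lemma GL_mat: "x \<in> carrier (GL n) \<Longrightarrow> x \<in> carrier_mat n n" for x :: "'a mat"
  by (simp add: carrier_GL)

lemma inv_GH: "x \<in> H \<Longrightarrow> inv\<^bsub>GH\<^esub> x = inv\<^bsub>GL n\<^esub> x"
  by (rule GL.m_inv_consistent[OF subgroup_H])

lemma entry_coord: "i < n \<Longrightarrow> j < n \<Longrightarrow> (\<lambda>A. A $$ (i, j)) \<in> GL_coordinates n"
  unfolding GL_coordinates_def by (rule UnI1, rule image_eqI[of _ _ "(i, j)"]) simp_all

lemma inv_entry_coord: "i < n \<Longrightarrow> j < n \<Longrightarrow> (\<lambda>A. (inv\<^bsub>GL n\<^esub> A) $$ (i, j)) \<in> GL_coordinates n"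
  unfolding GL_coordinates_def by (rule UnI2, rule image_eqI[of _ _ "(i, j)"]) simp_all

lemma GL_coordinates_cases:
  assumes "f \<in> GL_coordinates n"
  obtains (entry) i j where "i < n" "j < n" "f = (\<lambda>A. A $$ (i, j))"
    | (inv_entry) i j where "i < n" "j < n" "f = (\<lambda>A. (inv\<^bsub>GL n\<^esub> A) $$ (i, j))"
  using assms unfolding GL_coordinates_def
proof (elim UnE imageE)
  fix p assume p: "f = (case p of (i, j) \<Rightarrow> \<lambda>A. A $$ (i, j))" "p \<in> {..<n} \<times> {..<n}"
  obtain i j where "p = (i, j)" by (cases p)
  with p show thesis by (intro entry[of i j]) simp_all
next
  fix p assume p: "f = (case p of (i, j) \<Rightarrow> \<lambda>A. (inv\<^bsub>GL n\<^esub> A) $$ (i, j))" "p \<in> {..<n} \<times> {..<n}"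
  obtain i j where "p = (i, j)" by (cases p)
  with p show thesis by (intro inv_entry[of i j]) simp_all
qed

lemma finite_GL_coordinates: "finite (GL_coordinates n :: ('a mat \<Rightarrow> 'a) set)"
  by (simp add: GL_coordinates_def)

lemma mult_regular:
  "regular_map (product_gens (GL_coordinates n) (GL_coordinates n)) (H \<times> H) (GL_coordinates n)
    (\<lambda>p. fst p \<otimes>\<^bsub>GH\<^esub> snd p)"
  unfolding regular_map_def
proof
  let ?R = "function_algebra (product_gens (GL_coordinates n) (GL_coordinates n :: ('a mat \<Rightarrow> 'a) set))"
  fix f :: "'a mat \<Rightarrow> 'a" assume "f \<in> GL_coordinates n"
  have fst_mem: "(\<lambda>p. g (fst p)) \<in> ?R" and snd_mem: "(\<lambda>p. g (snd p)) \<in> ?R"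
    if "g \<in> GL_coordinates n" for g
    using that by (auto intro!: function_algebra.gen simp: product_gens_def)
  from \<open>f \<in> GL_coordinates n\<close>
  show "\<exists>f'\<in>?R. \<forall>p\<in>H \<times> H. f (fst p \<otimes>\<^bsub>GH\<^esub> snd p) = f' p"
  proof (cases rule: GL_coordinates_cases)
    case (entry i j)
    show ?thesis
    proof (intro bexI ballI)
      show "(\<lambda>p. \<Sum>k<n. fst p $$ (i, k) * snd p $$ (k, j)) \<in> ?R"
        using entry(1,2)
        by (intro function_algebra_sum function_algebra.mult fst_mem[OF entry_coord] snd_mem[OF entry_coord]) auto
      fix p assume "p \<in> H \<times> H"
      then have c: "fst p \<in> carrier_mat n n" "snd p \<in> carrier_mat n n" using H_carrier GL_mat by auto
      show "f (fst p \<otimes>\<^bsub>GH\<^esub> snd p) = (\<Sum>k<n. fst p $$ (i, k) * snd p $$ (k, j))"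
        using mat_mult_entry[OF c entry(1,2)] by (simp add: entry(3) GL_mult del: index_mult_mat)
    qed
  next
    case (inv_entry i j)
    show ?thesis
    proof (intro bexI ballI)
      show "(\<lambda>p. \<Sum>k<n. (inv\<^bsub>GL n\<^esub> (snd p)) $$ (i, k) * (inv\<^bsub>GL n\<^esub> (fst p)) $$ (k, j)) \<in> ?R"
        using inv_entry(1,2)
        by (intro function_algebra_sum function_algebra.mult fst_mem[OF inv_entry_coord] snd_mem[OF inv_entry_coord]) auto
      fix p assume "p \<in> H \<times> H"
      then have c: "fst p \<in> carrier (GL n)" "snd p \<in> carrier (GL n)" using H_carrier by auto
      have "inv\<^bsub>GL n\<^esub> (fst p \<otimes>\<^bsub>GL n\<^esub> snd p) = inv\<^bsub>GL n\<^esub> (snd p) \<otimes>\<^bsub>GL n\<^esub> inv\<^bsub>GL n\<^esub> (fst p)"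
        by (rule GL.inv_mult_group[OF c])
      then show "f (fst p \<otimes>\<^bsub>GH\<^esub> snd p) =
          (\<Sum>k<n. (inv\<^bsub>GL n\<^esub> (snd p)) $$ (i, k) * (inv\<^bsub>GL n\<^esub> (fst p)) $$ (k, j))"
        using mat_mult_entry[OF GL_mat[OF GL.inv_closed[OF c(2)]] GL_mat[OF GL.inv_closed[OF c(1)]] inv_entry(1,2)]
        by (simp add: inv_entry(3) GL_mult del: index_mult_mat)
    qed
  qed
qed

lemma inv_regular: "regular_map (GL_coordinates n) H (GL_coordinates n) (\<lambda>x. inv\<^bsub>GH\<^esub> x)"
  unfolding regular_map_def
proof
  fix f :: "'a mat \<Rightarrow> 'a" assume "f \<in> GL_coordinates n"
  then show "\<exists>f'\<in>R. \<forall>x\<in>H. f (inv\<^bsub>GH\<^esub> x) = f' x"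
  proof (cases rule: GL_coordinates_cases)
    case (entry i j)
    show ?thesis
      by (rule bexI[OF _ function_algebra.gen[OF inv_entry_coord[OF entry(1,2)]]]) (simp add: entry(3) inv_GH)
  next
    case (inv_entry i j)
    show ?thesis
      by (rule bexI[OF _ function_algebra.gen[OF entry_coord[OF inv_entry(1,2)]]])
        (simp add: inv_entry(3) inv_GH GL.inv_inv H_carrier)
  qed
qed

text \<open>The values of a character on the coordinates form two matrices \<open>A\<close> and
  \<open>B\<close>. Identities valid on \<open>H\<close> are preserved, so \<open>B\<close> is
  inverse to \<open>A\<close> and the equations defining \<open>H\<close> hold at \<open>A\<close>;
  this \<open>A\<close> is the required point.\<close>

lemma affine_H: "affine_set (GL_coordinates n) H"
  unfolding affine_set_def
proof (intro allI impI)
  fix \<chi> :: "('a mat \<Rightarrow> 'a) \<Rightarrow> 'a"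
  assume \<chi>: "character R (vanishing_ideal H) \<chi>" and const: "\<forall>c. \<chi> (\<lambda>_. c) = c"
  \<comment> \<open>A function constant on \<open>H\<close> differs from a constant by a function
    vanishing on \<open>H\<close>. This transports both the matrix identity and the defining
    equations.\<close>
  have char_const: "\<chi> f = c" if f: "f \<in> R" and fc: "\<And>x. x \<in> H \<Longrightarrow> f x = c" for f c
  proof -
    have "\<chi> (f - (\<lambda>_. c)) = 0"
      using fc by (intro character_vanish[OF \<chi>] subring_diff[OF function_algebra_subring] f function_algebra.const)
        (simp add: vanishing_ideal_def)
    then show ?thesis
      using character_diff[OF \<chi> function_algebra_subring f function_algebra.const[of c]] const by simp
  qed
  define A where "A = mat n n (\<lambda>(i, j). \<chi> (\<lambda>x. x $$ (i, j)))"
  define B where "B = mat n n (\<lambda>(i, j). \<chi> (\<lambda>x. (inv\<^bsub>GL n\<^esub> x) $$ (i, j)))"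
  have AB: "A \<in> carrier_mat n n" "B \<in> carrier_mat n n" by (auto simp: A_def B_def)
  note ent = function_algebra.gen[OF entry_coord] and ient = function_algebra.gen[OF inv_entry_coord]
  have "A * B = 1\<^sub>m n"
  proof (rule eq_matI)
    fix i j assume "i < dim_row (1\<^sub>m n :: 'a mat)" "j < dim_col (1\<^sub>m n :: 'a mat)"
    then have ij: "i < n" "j < n" by auto
    let ?f = "\<lambda>k x. x $$ (i, k) * (inv\<^bsub>GL n\<^esub> x) $$ (k, j)"
    have fR: "?f k \<in> R" if "k \<in> {..<n}" for k
      using that ij by (intro function_algebra.mult ent ient) auto
    have "(A * B) $$ (i, j) = (\<Sum>k<n. \<chi> (\<lambda>x. x $$ (i, k)) * \<chi> (\<lambda>x. (inv\<^bsub>GL n\<^esub> x) $$ (k, j)))"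
      unfolding mat_mult_entry[OF AB ij] using ij by (simp add: A_def B_def)
    also have "\<dots> = (\<Sum>k<n. \<chi> (?f k))"
    proof (rule sum.cong[OF refl])
      fix k assume "k \<in> {..<n}"
      then have k: "k < n" by simp
      show "\<chi> (\<lambda>x. x $$ (i, k)) * \<chi> (\<lambda>x. (inv\<^bsub>GL n\<^esub> x) $$ (k, j)) = \<chi> (?f k)"
        using character_mult[OF \<chi> ent[OF ij(1) k] ient[OF k ij(2)]] by (simp add: times_fun_def)
    qed
    also have "\<dots> = \<chi> (\<lambda>x. \<Sum>k<n. ?f k x)"
      by (rule character_function_sum[OF \<chi> _ fR, symmetric]) (use const in auto)
    also have "\<dots> = 1\<^sub>m n $$ (i, j)"
    proof (rule char_const)
      show "(\<lambda>x. \<Sum>k<n. ?f k x) \<in> R" by (rule function_algebra_sum[OF fR])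
      fix x assume "x \<in> H"
      then have x: "x \<in> carrier (GL n)" by (rule H_carrier)
      have "x * inv\<^bsub>GL n\<^esub> x = 1\<^sub>m n" using GL.r_inv[OF x] by (simp only: GL_mult GL_one)
      then show "(\<Sum>k<n. ?f k x) = 1\<^sub>m n $$ (i, j)"
        using mat_mult_entry[OF GL_mat[OF x] GL_mat[OF GL.inv_closed[OF x]] ij] by simp
    qed
    finally show "(A * B) $$ (i, j) = 1\<^sub>m n $$ (i, j)" .
  qed (use AB in auto)
  then have "det A * det B = 1" using det_mult[OF AB] by simp
  then have "det A \<noteq> 0" "det B \<noteq> 0" by auto
  then have AG: "A \<in> carrier (GL n)" and BG: "B \<in> carrier (GL n)" using AB by (simp_all add: carrier_GL)
  have "A \<otimes>\<^bsub>GL n\<^esub> B = \<one>\<^bsub>GL n\<^esub>" using \<open>A * B = 1\<^sub>m n\<close> by (simp only: GL_mult GL_one)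
  then have invA: "inv\<^bsub>GL n\<^esub> A = B" using AG BG GL.inv_comm GL.inv_equality by blast
  obtain P where P: "\<And>p. p \<in> P \<Longrightarrow> matrix_polynomial n p"
    and H: "H = {A \<in> carrier (GL n). \<forall>p\<in>P. p A = 0}"
    using closed_H unfolding zariski_closed_in_GL_def by blast
  \<comment> \<open>Defining polynomials involve only entries of the matrix, so the character
    evaluates them at \<open>A\<close>.\<close>
  have poly: "p \<in> R \<and> \<chi> p = p A" if "matrix_polynomial n p" for p
    using that
  proof (induction rule: matrix_polynomial.induct)
    case (const c)
    then show ?case using \<open>\<forall>c. \<chi> (\<lambda>_. c) = c\<close> function_algebra.const by blast
  next
    case (entry i j)
    then show ?case using ent[OF entry] by (simp add: A_def)
  next
    case (add p q)
    then show ?case using character_add[OF \<chi>, of p q] by (simp add: plus_fun_def function_algebra.add)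
  next
    case (mult p q)
    then show ?case using character_mult[OF \<chi>, of p q] by (simp add: times_fun_def function_algebra.mult)
  qed
  have "p A = 0" if "p \<in> P" for p
    using poly[OF P[OF that]] char_const[of p 0] that unfolding H by auto
  then have AH: "A \<in> H" using AG unfolding H by blast
  have "\<chi> f = f A" if f: "f \<in> GL_coordinates n" for f
    using f
  proof (cases rule: GL_coordinates_cases)
    case (entry i j)
    then show ?thesis by (simp add: A_def)
  next
    case (inv_entry i j)
    then show ?thesis by (simp add: invA B_def)
  qed
  then have "\<forall>f\<in>R. \<chi> f = f A" using character_eq_eval[OF \<chi>] const by blast
  with AH show "\<exists>x\<in>H. \<forall>f\<in>R. \<chi> f = f x" by blast
qed

lemma affine_algebraic_group_GH: "affine_algebraic_group GH (GL_coordinates n)"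
proof -
  interpret GH: group GH by (rule GL.subgroup_imp_group[OF subgroup_H])
  show ?thesis
  proof
    show "finite (GL_coordinates n :: ('a mat \<Rightarrow> 'a) set)" by (rule finite_GL_coordinates)
    fix x y assume "x \<in> carrier GH" "y \<in> carrier GH"
    then have xy: "x \<in> carrier_mat n n" "y \<in> carrier_mat n n" using H_carrier GL_mat by auto
    assume eq: "\<And>f. f \<in> GL_coordinates n \<Longrightarrow> f x = f y"
    show "x = y"
    proof (rule eq_matI)
      fix i j assume "i < dim_row y" "j < dim_col y"
      then show "x $$ (i, j) = y $$ (i, j)" using eq[OF entry_coord, of i j] xy by auto
    qed (use xy in auto)
  next
    show "affine_set (GL_coordinates n) (carrier GH)" using affine_H by simp
    show "regular_map (product_gens (GL_coordinates n) (GL_coordinates n)) (carrier GH \<times> carrier GH)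
      (GL_coordinates n) (\<lambda>p. fst p \<otimes>\<^bsub>GH\<^esub> snd p)" using mult_regular by simp
    show "regular_map (GL_coordinates n) (carrier GH) (GL_coordinates n) (\<lambda>x. inv\<^bsub>GH\<^esub> x)"
      using inv_regular by simp
  qed
qed

end

theorem theorem1p3:
  fixes G :: "'a::alg_closed_field mat monoid"
  assumes "linear_algebraic_group G"
    and "finite (carrier (abelianization G))"
  shows "uniformly_bounded G"
proof -
  obtain n H where H: "subgroup H (GL n)" "zariski_closed_in_GL n H" and G: "G = (GL n)\<lparr>carrier := H\<rparr>"
    using assms(1) unfolding linear_algebraic_group_def by blast
  interpret closed_subgroup_GL n H by (rule closed_subgroup_GL.intro) (rule H)+
  interpret affine_algebraic_group G "GL_coordinates n"
    unfolding G by (rule affine_algebraic_group_GH)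
  show ?thesis by (rule uniformly_bounded_if_finite_abelianization[OF assms(2)])
qed

end
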